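(* Let $H$ be a commutative bialgebra over a commutative ring $k$ and let $A$ be a commutative right $H$-comodule algebra. Then there is an isomorphism of abelian groups $$\mathrm{Ker}\bigl(\mathrm{Pic}^H(A)\to \mathrm{Pic}(A)\bigr)\cong H^1_{\mathrm{Harr}}(H,A,\mathbb{G}_m),$$ where $\mathrm{Pic}^H(A)\to\mathrm{Pic}(A)$ is the map forgetting the $H$-coaction.
   Context: Notation: $\rho(a)=a_{[0]}\otimes a_{[1]}\in A\otimes H$ is the coaction on $A$ (an algebra map), and $\Delta(h)=h_{(1)}\otimes h_{(2)}$ is the comultiplication of $H$. $\mathbb{G}_m(R)$ is the unit group of a commutative ring $R$, and $\mathrm{Pic}(R)$ its Picard group. A relative Hopf module is an $A$-module $M$ with a right $H$-coaction $\rho_M(m)=m_{[0]}\otimes m_{[1]}$ such that $\rho_M(ma)=m_{[0]}a_{[0]}\otimes m_{[1]}a_{[1]}$ for all $a\in A$, $m\in M$. Relative Hopf modules with $A$-linear $H$-colinear maps form a category $\mathcal{M}^H_A$. It is symmetric monoidal under $\otimes_A$ with unit object $A$, where the coaction on $M\otimes_A N$ is $m\otimes_A n\mapsto m_{[0]}\otimes_A n_{[0]}\otimes m_{[1]}n_{[1]}$. The relative Picard group $\mathrm{Pic}^H(A)$ is the group of isomorphism classes of invertible objects of $(\mathcal{M}^H_A,\otimes_A,A)$. $H^1_{\mathrm{Harr}}(H,A,\mathbb{G}_m)$ is the first Harrison cohomology group, i.e. the quotient of the group of 1-cocycles by the group of 1-coboundaries. With $A\otimes H$ viewed as a commutative algebra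 under $(a\otimes h)(b\otimes k)=ab\otimes hk$, a 1-cocycle is an invertible element $X=\sum_i a_i\otimes h_i\in \mathbb{G}_m(A\otimes H)$ with $$\sum_i a_i\otimes h_{i(1)}\otimes h_{i(2)}=\sum_{i,j}a_i a_{j[0]}\otimes h_i a_{j[1]}\otimes h_j,$$ and a 1-coboundary is an element $a^{-1}a_{[0]}\otimes a_{[1]}$ with $a\in\mathbb{G}_m(A)$. (The 1-cocycles automatically satisfy $\sum_i a_i\varepsilon(h_i)=1$, where $\varepsilon$ is the counit of $H$.) *)

theory Defs
  imports "HOL-Algebra.Module" "HOL-Algebra.Free_Abelian_Groups" "HOL-Algebra.Generated_Groups"
begin

section \<open>Modules, linear maps, tensor products\<close>

definition linear_maps ::
    "('r, 'x) ring_scheme \<Rightarrow> ('r, 'm, 'y) module_scheme \<Rightarrow> ('r, 'n, 'z) module_scheme \<Rightarrow> ('m \<Rightarrow> 'n) set"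
  where "linear_maps R M N =
    {f \<in> carrier M \<rightarrow> carrier N.
       (\<forall>x\<in>carrier M. \<forall>y\<in>carrier M. f (x \<oplus>\<^bsub>M\<^esub> y) = f x \<oplus>\<^bsub>N\<^esub> f y) \<and>
       (\<forall>r\<in>carrier R. \<forall>x\<in>carrier M. f (r \<odot>\<^bsub>M\<^esub> x) = r \<odot>\<^bsub>N\<^esub> f x)}"

definition regular_module :: "('r, 'x) ring_scheme \<Rightarrow> ('r, 'r) module"
  where "regular_module R =
    \<lparr>carrier = carrier R, monoid.mult = monoid.mult R, one = \<one>\<^bsub>R\<^esub>, ring.zero = \<zero>\<^bsub>R\<^esub>, ring.add = add R,
     smult = monoid.mult R\<rparr>"

text \<open>An \<open>A\<close>-module as a \<open>k\<close>-module along the structure map \<open>c \<mapsto> c \<cdot> 1\<close> of the \<open>k\<close>-algebra \<open>A\<close>.\<close>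

definition restrict_scalars ::
    "('k, 'a, 'x) module_scheme \<Rightarrow> ('a, 'm, 'y) module_scheme \<Rightarrow> ('k, 'm) module"
  where "restrict_scalars A M =
    \<lparr>carrier = carrier M, monoid.mult = monoid.mult M, one = \<one>\<^bsub>M\<^esub>, ring.zero = \<zero>\<^bsub>M\<^esub>, ring.add = add M,
     smult = (\<lambda>c m. (c \<odot>\<^bsub>A\<^esub> \<one>\<^bsub>A\<^esub>) \<odot>\<^bsub>M\<^esub> m)\<rparr>"

text \<open>The tensor product of two \<open>R\<close>-modules is the quotient of the free abelian group on
  \<open>M \<times> N\<close> by the subgroup generated by the bilinearity relations; its elements are cosets of
  integral formal sums of pairs.\<close>

definition tensor_relators ::
    "('r, 'x) ring_scheme \<Rightarrow> ('r, 'm, 'y) module_scheme \<Rightarrow> ('r, 'n, 'z) module_scheme \<Rightarrow>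
     ('m \<times> 'n \<Rightarrow>\<^sub>0 int) set"
  where "tensor_relators R M N =
    {frag_of (m \<oplus>\<^bsub>M\<^esub> m', n) - frag_of (m, n) - frag_of (m', n) |m m' n.
       m \<in> carrier M \<and> m' \<in> carrier M \<and> n \<in> carrier N} \<union>
    {frag_of (m, n \<oplus>\<^bsub>N\<^esub> n') - frag_of (m, n) - frag_of (m, n') |m n n'.
       m \<in> carrier M \<and> n \<in> carrier N \<and> n' \<in> carrier N} \<union>
    {frag_of (r \<odot>\<^bsub>M\<^esub> m, n) - frag_of (m, r \<odot>\<^bsub>N\<^esub> n) |r m n.
       r \<in> carrier R \<and> m \<in> carrier M \<and> n \<in> carrier N}"

definition tensor_relations ::
    "('r, 'x) ring_scheme \<Rightarrow> ('r, 'm, 'y) module_scheme \<Rightarrow> ('r, 'n, 'z) module_scheme \<Rightarrow>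
     ('m \<times> 'n \<Rightarrow>\<^sub>0 int) set"
  where "tensor_relations R M N =
    generate (free_Abelian_group (carrier M \<times> carrier N)) (tensor_relators R M N)"

definition tensor_group ::
    "('r, 'x) ring_scheme \<Rightarrow> ('r, 'm, 'y) module_scheme \<Rightarrow> ('r, 'n, 'z) module_scheme \<Rightarrow>
     ('m \<times> 'n \<Rightarrow>\<^sub>0 int) set monoid"
  where "tensor_group R M N =
    free_Abelian_group (carrier M \<times> carrier N) Mod tensor_relations R M N"

definition pure_tensor ::
    "('r, 'x) ring_scheme \<Rightarrow> ('r, 'm, 'y) module_scheme \<Rightarrow> ('r, 'n, 'z) module_scheme \<Rightarrow>
     'm \<Rightarrow> 'n \<Rightarrow> ('m \<times> 'n \<Rightarrow>\<^sub>0 int) set"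
  where "pure_tensor R M N m n =
    tensor_relations R M N #>\<^bsub>free_Abelian_group (carrier M \<times> carrier N)\<^esub> frag_of (m, n)"

text \<open>Given a map \<open>f\<close> on pairs with values in a (multiplicatively written) commutative group \<open>G\<close>,
  the following is the value on the tensor \<open>t\<close> of the homomorphism that sends each pure tensor
  \<open>m \<otimes> n\<close> to \<open>f m n\<close>, computed from an arbitrarily chosen representative of \<open>t\<close>. It does not
  depend on the choice when \<open>f\<close> is biadditive and balanced, which is the case in all uses below.\<close>

definition tensor_lift ::
    "('c, 'w) monoid_scheme \<Rightarrow> ('m \<times> 'n \<Rightarrow>\<^sub>0 int) set \<Rightarrow> ('m \<Rightarrow> 'n \<Rightarrow> 'c) \<Rightarrow> 'c"
  where "tensor_lift G t f =
    (let c = (SOME c. c \<in> t)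
     in finprod G (\<lambda>p. f (fst p) (snd p) [^]\<^bsub>G\<^esub> Poly_Mapping.lookup c p) (Poly_Mapping.keys c))"

text \<open>Sweedler notation: if \<open>t = \<Sum>\<^sub>i m\<^sub>i \<otimes> n\<^sub>i\<close>, then \<open>sweedler P t f\<close> is \<open>\<Sum>\<^sub>i f m\<^sub>i n\<^sub>i\<close> in the
  additive group of \<open>P\<close>.\<close>

abbreviation sweedler ::
    "('c, 'w) ring_scheme \<Rightarrow> ('m \<times> 'n \<Rightarrow>\<^sub>0 int) set \<Rightarrow> ('m \<Rightarrow> 'n \<Rightarrow> 'c) \<Rightarrow> 'c"
  where "sweedler P t f \<equiv> tensor_lift (add_monoid P) t f"

text \<open>The fields \<open>mult\<close> and \<open>one\<close> are meaningful when \<open>M\<close> and \<open>N\<close> are algebras, in which case they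
  are \<open>(m \<otimes> n)(m' \<otimes> n') = m m' \<otimes> n n'\<close> and \<open>1 \<otimes> 1\<close>; for mere modules they are irrelevant.\<close>

definition tensor ::
    "('r, 'x) ring_scheme \<Rightarrow> ('r, 'm, 'y) module_scheme \<Rightarrow> ('r, 'n, 'z) module_scheme \<Rightarrow>
     ('r, ('m \<times> 'n \<Rightarrow>\<^sub>0 int) set) module"
  where "tensor R M N =
    \<lparr>carrier = carrier (tensor_group R M N),
     monoid.mult = (\<lambda>s t.
       tensor_lift (tensor_group R M N) s (\<lambda>m n.
         tensor_lift (tensor_group R M N) t (\<lambda>m' n'.
           pure_tensor R M N (m \<otimes>\<^bsub>M\<^esub> m') (n \<otimes>\<^bsub>N\<^esub> n')))),
     one = pure_tensor R M N \<one>\<^bsub>M\<^esub> \<one>\<^bsub>N\<^esub>,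
     ring.zero = \<one>\<^bsub>tensor_group R M N\<^esub>,
     ring.add = monoid.mult (tensor_group R M N),
     smult = (\<lambda>r t.
       tensor_lift (tensor_group R M N) t (\<lambda>m n. pure_tensor R M N (r \<odot>\<^bsub>M\<^esub> m) n))\<rparr>"


section \<open>Commutative bialgebras and comodule algebras\<close>

record ('k, 'h) bialgebra = "('k, 'h) module" +
  comult :: "'h \<Rightarrow> ('h \<times> 'h \<Rightarrow>\<^sub>0 int) set"
  counit :: "'h \<Rightarrow> 'k"

text \<open>The two sides of coassociativity are compared in \<open>M \<otimes> (H \<otimes> H)\<close>, the tensor
  \<open>(x \<otimes> y) \<otimes> z\<close> being identified with \<open>x \<otimes> (y \<otimes> z)\<close>.\<close>

definition coassociative ::
    "('k, 'x) ring_scheme \<Rightarrow> ('k, 'h, 'y) bialgebra_scheme \<Rightarrow> ('k, 'm, 'z) module_scheme \<Rightarrow>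
     ('m \<Rightarrow> ('m \<times> 'h \<Rightarrow>\<^sub>0 int) set) \<Rightarrow> bool"
  where "coassociative k H M \<rho> \<longleftrightarrow>
    (let HH = tensor k H H; T = tensor k M HH in
     \<forall>m\<in>carrier M.
       sweedler T (\<rho> m) (\<lambda>m0 m1.
         sweedler T (\<rho> m0) (\<lambda>m00 m01. pure_tensor k M HH m00 (pure_tensor k H H m01 m1))) =
       sweedler T (\<rho> m) (\<lambda>m0 m1. pure_tensor k M HH m0 (comult H m1)))"

locale comm_bialgebra = algebra k H
  for k :: "('k, 'x) ring_scheme" and H :: "('k, 'h, 'y) bialgebra_scheme" +
  assumes comult_linear: "comult H \<in> linear_maps k H (tensor k H H)"
    and comult_ring_hom: "comult H \<in> ring_hom H (tensor k H H)"
    and counit_linear: "counit H \<in> linear_maps k H (regular_module k)"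
    and counit_ring_hom: "counit H \<in> ring_hom H k"
    and comult_coassociative: "coassociative k H H (comult H)"
    and counit_left:
      "\<And>h. h \<in> carrier H \<Longrightarrow> sweedler H (comult H h) (\<lambda>h1 h2. counit H h1 \<odot>\<^bsub>H\<^esub> h2) = h"
    and counit_right:
      "\<And>h. h \<in> carrier H \<Longrightarrow> sweedler H (comult H h) (\<lambda>h1 h2. counit H h2 \<odot>\<^bsub>H\<^esub> h1) = h"

locale right_comodule = comm_bialgebra k H + M: module k M
  for k :: "('k, 'x) ring_scheme" and H :: "('k, 'h, 'y) bialgebra_scheme"
    and M :: "('k, 'm, 'z) module_scheme" and \<rho> :: "'m \<Rightarrow> ('m \<times> 'h \<Rightarrow>\<^sub>0 int) set" +
  assumes coaction_linear: "\<rho> \<in> linear_maps k M (tensor k M H)"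
    and coaction_coassociative: "coassociative k H M \<rho>"
    and coaction_counit:
      "\<And>m. m \<in> carrier M \<Longrightarrow> sweedler M (\<rho> m) (\<lambda>m0 m1. counit H m1 \<odot>\<^bsub>M\<^esub> m0) = m"

record ('r, 'm, 'h) comodule = "('r, 'm) module" +
  coact :: "'m \<Rightarrow> ('m \<times> 'h \<Rightarrow>\<^sub>0 int) set"

definition with_coact ::
    "('r, 'm, 'x) module_scheme \<Rightarrow> ('m \<Rightarrow> ('m \<times> 'h \<Rightarrow>\<^sub>0 int) set) \<Rightarrow> ('r, 'm, 'h) comodule"
  where "with_coact M \<rho> =
    \<lparr>carrier = carrier M, monoid.mult = monoid.mult M, one = \<one>\<^bsub>M\<^esub>, ring.zero = \<zero>\<^bsub>M\<^esub>, ring.add = add M,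
     smult = smult M, coact = \<rho>\<rparr>"

locale comm_comodule_algebra =
  algebra k A + right_comodule k H A "coact A"
  for k :: "('k, 'x) ring_scheme" and H :: "('k, 'h, 'y) bialgebra_scheme"
    and A :: "('k, 'a, 'h, 'z) comodule_scheme" +
  assumes coaction_ring_hom: "coact A \<in> ring_hom A (tensor k A H)"


section \<open>Relative Hopf modules\<close>

text \<open>A relative Hopf module is a record whose scalars are those of \<open>A\<close>; its coaction takes values in
  the tensor product over \<open>k\<close>. Since \<open>A\<close> is commutative, \<open>m a\<close> is written \<open>a \<odot> m\<close>.\<close>

locale rel_hopf_module =
  comm_comodule_algebra k H A + M: module A M +
  right_comodule k H "restrict_scalars A M" "coact M"
  for k :: "('k, 'x) ring_scheme" and H :: "('k, 'h, 'y) bialgebra_scheme"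
    and A :: "('k, 'a, 'h, 'z) comodule_scheme" and M :: "('a, 'm, 'h, 'w) comodule_scheme" +
  assumes coaction_smult:
    "\<And>a m. a \<in> carrier A \<Longrightarrow> m \<in> carrier M \<Longrightarrow>
      coact M (a \<odot>\<^bsub>M\<^esub> m) =
      sweedler (tensor k (restrict_scalars A M) H) (coact M m) (\<lambda>m0 m1.
        sweedler (tensor k (restrict_scalars A M) H) (coact A a) (\<lambda>a0 a1.
          pure_tensor k (restrict_scalars A M) H (a0 \<odot>\<^bsub>M\<^esub> m0) (m1 \<otimes>\<^bsub>H\<^esub> a1)))"

definition hopf_maps ::
    "('k, 'x) ring_scheme \<Rightarrow> ('k, 'h, 'y) bialgebra_scheme \<Rightarrow> ('k, 'a, 'h, 'z) comodule_scheme \<Rightarrow>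
     ('a, 'm, 'h, 'v) comodule_scheme \<Rightarrow> ('a, 'n, 'h, 'w) comodule_scheme \<Rightarrow> ('m \<Rightarrow> 'n) set"
  where "hopf_maps k H A M N =
    {f \<in> linear_maps A M N.
       \<forall>m\<in>carrier M. coact N (f m) =
         sweedler (tensor k (restrict_scalars A N) H) (coact M m) (\<lambda>m0 m1.
           pure_tensor k (restrict_scalars A N) H (f m0) m1)}"

definition hopf_isomorphic ::
    "('k, 'x) ring_scheme \<Rightarrow> ('k, 'h, 'y) bialgebra_scheme \<Rightarrow> ('k, 'a, 'h, 'z) comodule_scheme \<Rightarrow>
     ('a, 'm, 'h, 'v) comodule_scheme \<Rightarrow> ('a, 'n, 'h, 'w) comodule_scheme \<Rightarrow> bool"
  where "hopf_isomorphic k H A M N \<longleftrightarrow>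
    (\<exists>f\<in>hopf_maps k H A M N. \<exists>g\<in>hopf_maps k H A N M.
       (\<forall>m\<in>carrier M. g (f m) = m) \<and> (\<forall>n\<in>carrier N. f (g n) = n))"

definition hopf_unit :: "('k, 'a, 'h, 'z) comodule_scheme \<Rightarrow> ('a, 'a, 'h) comodule"
  where "hopf_unit A = with_coact (regular_module A) (coact A)"

definition hopf_tensor ::
    "('k, 'x) ring_scheme \<Rightarrow> ('k, 'h, 'y) bialgebra_scheme \<Rightarrow> ('k, 'a, 'h, 'z) comodule_scheme \<Rightarrow>
     ('a, 'm, 'h, 'v) comodule_scheme \<Rightarrow> ('a, 'n, 'h, 'w) comodule_scheme \<Rightarrow>
     ('a, ('m \<times> 'n \<Rightarrow>\<^sub>0 int) set, 'h) comodule"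
  where "hopf_tensor k H A M N =
    (let MN = restrict_scalars A (tensor A M N); T = tensor k MN H in
     with_coact (tensor A M N) (\<lambda>t.
       sweedler T t (\<lambda>m n.
         sweedler T (coact M m) (\<lambda>m0 m1.
           sweedler T (coact N n) (\<lambda>n0 n1.
             pure_tensor k MN H (pure_tensor A M N m0 n0) (m1 \<otimes>\<^bsub>H\<^esub> n1))))))"


section \<open>Picard groups\<close>

text \<open>Isomorphism classes are formed among the (Hopf) modules whose underlying set lies in a fixed
  type \<open>'u\<close>. If \<open>'u\<close> is infinite and contains a copy of \<open>A\<close>, then this is no restriction: a tensor
  product of two such modules has cardinality at most that of \<open>'u\<close>, hence is isomorphic to such a
  module, and an invertible module is finitely generated over \<open>A\<close>, hence is isomorphic to such a
  module as well. The product of two classes is the class of the tensor product of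
  representatives.\<close>

definition hopf_class ::
    "('k, 'x) ring_scheme \<Rightarrow> ('k, 'h, 'y) bialgebra_scheme \<Rightarrow> ('k, 'a, 'h, 'z) comodule_scheme \<Rightarrow>
     ('a, 'm, 'h, 'v) comodule_scheme \<Rightarrow> ('a, 'u, 'h) comodule set"
  where "hopf_class k H A M = {P. rel_hopf_module k H A P \<and> hopf_isomorphic k H A P M}"

definition hopf_invertible ::
    "('k, 'x) ring_scheme \<Rightarrow> ('k, 'h, 'y) bialgebra_scheme \<Rightarrow> ('k, 'a, 'h, 'z) comodule_scheme \<Rightarrow>
     ('a, 'u, 'h) comodule \<Rightarrow> bool"
  where "hopf_invertible k H A M \<longleftrightarrow>
    rel_hopf_module k H A M \<and>
    (\<exists>N :: ('a, 'u, 'h) comodule. rel_hopf_module k H A N \<and>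
       hopf_isomorphic k H A (hopf_tensor k H A M N) (hopf_unit A))"

definition relative_Pic ::
    "('k, 'x) ring_scheme \<Rightarrow> ('k, 'h, 'y) bialgebra_scheme \<Rightarrow> ('k, 'a, 'h, 'z) comodule_scheme \<Rightarrow>
     ('a, 'u, 'h) comodule set monoid"
  where "relative_Pic k H A =
    \<lparr>carrier = {hopf_class k H A M |M :: ('a, 'u, 'h) comodule. hopf_invertible k H A M},
     monoid.mult = (\<lambda>X Y. \<Union>M\<in>X. \<Union>N\<in>Y. hopf_class k H A (hopf_tensor k H A M N)),
     one = hopf_class k H A (hopf_unit A)\<rparr>"

definition module_isomorphic ::
    "('a, 'x) ring_scheme \<Rightarrow> ('a, 'm, 'y) module_scheme \<Rightarrow> ('a, 'n, 'z) module_scheme \<Rightarrow> bool"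
  where "module_isomorphic A M N \<longleftrightarrow>
    (\<exists>f\<in>linear_maps A M N. \<exists>g\<in>linear_maps A N M.
       (\<forall>m\<in>carrier M. g (f m) = m) \<and> (\<forall>n\<in>carrier N. f (g n) = n))"

definition module_class ::
    "('a, 'x) ring_scheme \<Rightarrow> ('a, 'm, 'y) module_scheme \<Rightarrow> ('a, 'u) module set"
  where "module_class A M = {P. module A P \<and> module_isomorphic A P M}"

definition module_invertible :: "('a, 'x) ring_scheme \<Rightarrow> ('a, 'u) module \<Rightarrow> bool"
  where "module_invertible A M \<longleftrightarrow>
    module A M \<and>
    (\<exists>N :: ('a, 'u) module. module A N \<and>
       module_isomorphic A (tensor A M N) (regular_module A))"

definition Pic :: "('a, 'x) ring_scheme \<Rightarrow> ('a, 'u) module set monoid"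
  where "Pic A =
    \<lparr>carrier = {module_class A M |M :: ('a, 'u) module. module_invertible A M},
     monoid.mult = (\<lambda>X Y. \<Union>M\<in>X. \<Union>N\<in>Y. module_class A (tensor A M N)),
     one = module_class A (regular_module A)\<rparr>"

definition forget_coaction ::
    "('a, 'x) ring_scheme \<Rightarrow> ('a, 'u, 'h) comodule set \<Rightarrow> ('a, 'u) module set"
  where "forget_coaction A X = (\<Union>M\<in>X. module_class A M)"


section \<open>First Harrison cohomology\<close>

definition harrison_cocycles ::
    "('k, 'x) ring_scheme \<Rightarrow> ('k, 'h, 'y) bialgebra_scheme \<Rightarrow> ('k, 'a, 'h, 'z) comodule_scheme \<Rightarrow>
     ('a \<times> 'h \<Rightarrow>\<^sub>0 int) set set"
  where "harrison_cocycles k H A =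
    (let HH = tensor k H H; T = tensor k A HH in
     {X \<in> Units (tensor k A H).
        sweedler T X (\<lambda>a h. pure_tensor k A HH a (comult H h)) =
        sweedler T X (\<lambda>a h.
          sweedler T X (\<lambda>b g.
            sweedler T (coact A b) (\<lambda>b0 b1.
              pure_tensor k A HH (a \<otimes>\<^bsub>A\<^esub> b0) (pure_tensor k H H (h \<otimes>\<^bsub>H\<^esub> b1) g))))})"

definition harrison_coboundaries ::
    "('k, 'x) ring_scheme \<Rightarrow> ('k, 'h, 'y) bialgebra_scheme \<Rightarrow> ('k, 'a, 'h, 'z) comodule_scheme \<Rightarrow>
     ('a \<times> 'h \<Rightarrow>\<^sub>0 int) set set"
  where "harrison_coboundaries k H A =
    {sweedler (tensor k A H) (coact A a) (\<lambda>a0 a1. pure_tensor k A H (inv\<^bsub>A\<^esub> a \<otimes>\<^bsub>A\<^esub> a0) a1) |a.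
       a \<in> Units A}"

definition harrison_H1 ::
    "('k, 'x) ring_scheme \<Rightarrow> ('k, 'h, 'y) bialgebra_scheme \<Rightarrow> ('k, 'a, 'h, 'z) comodule_scheme \<Rightarrow>
     ('a \<times> 'h \<Rightarrow>\<^sub>0 int) set set monoid"
  where "harrison_H1 k H A =
    (units_of (tensor k A H))\<lparr>carrier := harrison_cocycles k H A\<rparr> Mod harrison_coboundaries k H A"

end

theory Submission
  imports Defs
begin

text \<open>An element of the kernel is the class of a Hopf module \<open>M\<close> that admits an \<open>A\<close>-linear isomorphism
  \<open>f: M \<rightarrow> A\<close>. Through \<open>f\<close>, compatibility with the action of \<open>A\<close> forces the coaction of \<open>M\<close> to be
  \<open>a \<mapsto> X \<rho>(a)\<close> for some \<open>X \<in> A \<otimes> H\<close>. All maps in the comodule axioms are induced by algebra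
  homomorphisms, so these axioms need only be checked at \<open>a = 1\<close>: coassociativity becomes the cocycle
  equation of \<open>X\<close>, and counitality becomes \<open>(id \<otimes> \<epsilon>) X = 1\<close>, which is automatic for units.
  The tensor product over \<open>A\<close> multiplies the elements \<open>X\<close>, hence \<open>M\<close> is invertible iff \<open>X\<close> is a unit.
  An \<open>A\<close>-linear automorphism of \<open>A\<close> is multiplication by a unit \<open>u\<close>, and it intertwines the coactions
  of \<open>X\<close> and \<open>Y\<close> iff \<open>X = (u\<^sup>-\<^sup>1 \<otimes> 1) \<rho>(u) Y\<close>. Thus \<open>X\<close> and \<open>Y\<close> give the same class
  iff they are cohomologous.\<close>

section \<open>The universal property of the tensor product\<close>

text \<open>A tensor is a coset of formal sums and \<open>sweedler\<close> evaluates a chosen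
  representative, so a Sweedler sum has a meaning only once its summand is known to be balanced.
  Over \<open>k\<close> this follows from bilinearity, and the sums are replaced by linear maps that
  are compared on pure tensors. Over \<open>A\<close> it is less direct:
  \<open>m0 \<otimes> n0 \<otimes> m1 n1\<close> is balanced in \<open>m\<close> and
  \<open>n\<close> only because both coactions are compatible with the action of \<open>A\<close>,
  which is why products are treated in coordinates. A kernel element is a priori only a Hopf module
  that is free of rank one and has some inverse \<open>N\<close>. To see that \<open>X\<close> is a
  unit, \<open>N\<close> needs a coordinate as well; it has one since
  \<open>N \<cong> M \<otimes>_A N \<cong> A\<close> as modules. If \<open>Y\<close> belongs to
  \<open>N\<close>, the isomorphism with the unit object gives
  \<open>\<rho> u = (u \<otimes> 1) X Y\<close> for a unit \<open>u\<close> of \<open>A\<close>, so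
  \<open>X\<close> divides a unit. The kernel receives its group laws as the image of the group of
  cocycles under a multiplicative map.\<close>

lemma (in comm_group) free_Abelian_group_eval_hom:
  fixes f :: "'c \<Rightarrow> 'a"
  assumes f: "f \<in> S \<rightarrow> carrier G"
  shows "(\<lambda>c :: 'c \<Rightarrow>\<^sub>0 int. finprod G (\<lambda>p. f p [^] Poly_Mapping.lookup c p) (Poly_Mapping.keys c))
    \<in> hom (free_Abelian_group S) G"
proof -
  define e where "e c K = finprod G (\<lambda>p. f p [^] Poly_Mapping.lookup c p) K"
    for c :: "'c \<Rightarrow>\<^sub>0 int" and K
  have closed: "f p [^] (i::int) \<in> carrier G" if "p \<in> S" for p i
    using that f by (auto intro: int_pow_closed)
  \<comment> \<open>The supports of \<open>x\<close>, \<open>y\<close> and \<open>x + y\<close>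
    differ. Extra factors are zeroth powers, so all three products can be taken over one common
    finite set.\<close>
  have e_keys: "e c (Poly_Mapping.keys c) = e c K"
    if "finite K" "Poly_Mapping.keys c \<subseteq> K" "K \<subseteq> S" for c K
    unfolding e_def
  proof (rule finprod_mono_neutral_cong_left)
    show "f p [^] Poly_Mapping.lookup c p = \<one>" if "p \<in> K - Poly_Mapping.keys c" for p
      using that by (simp add: in_keys_iff int_pow_def2)
  qed (use that closed in auto)
  have "e (x + y) (Poly_Mapping.keys (x + y)) = e x (Poly_Mapping.keys x) \<otimes> e y (Poly_Mapping.keys y)"
    if x: "Poly_Mapping.keys x \<subseteq> S" and y: "Poly_Mapping.keys y \<subseteq> S" for x y
  proof -
    let ?K = "Poly_Mapping.keys x \<union> Poly_Mapping.keys y"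
    have K: "finite ?K" "?K \<subseteq> S" "Poly_Mapping.keys (x + y) \<subseteq> ?K"
      using x y keys_add[of x y] by auto
    have "e (x + y) (Poly_Mapping.keys (x + y)) = e (x + y) ?K"
      by (rule e_keys) (use K in auto)
    also have "\<dots> = finprod G (\<lambda>p. f p [^] Poly_Mapping.lookup x p \<otimes> f p [^] Poly_Mapping.lookup y p) ?K"
      unfolding e_def
    proof (rule finprod_cong')
      fix p
      assume "p \<in> ?K"
      then have "f p \<in> carrier G"
        using K f by blast
      then show "f p [^] Poly_Mapping.lookup (x + y) p
          = f p [^] Poly_Mapping.lookup x p \<otimes> f p [^] Poly_Mapping.lookup y p"
        by (simp add: lookup_add int_pow_mult)
    qed (use K closed in auto)
    also have "\<dots> = e x ?K \<otimes> e y ?K"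
      unfolding e_def using K closed by (intro finprod_multf) auto
    also have "\<dots> = e x (Poly_Mapping.keys x) \<otimes> e y (Poly_Mapping.keys y)"
      using e_keys[of ?K x] e_keys[of ?K y] K by simp
    finally show ?thesis .
  qed
  moreover have "e c (Poly_Mapping.keys c) \<in> carrier G" if "Poly_Mapping.keys c \<subseteq> S" for c
    unfolding e_def using that closed by (intro finprod_closed) auto
  ultimately show ?thesis
    by (intro homI) (auto simp: e_def)
qed

text \<open>The target \<open>P\<close> carries no action of \<open>R\<close>: the coaction of M
  \<otimes>_A N is balanced over \<open>A\<close>, but its values lie in a tensor product over
  \<open>k\<close>.\<close>

definition balanced ::
    "('r, 'x) ring_scheme \<Rightarrow> ('r, 'm, 'y) module_scheme \<Rightarrow> ('r, 'n, 'z) module_scheme \<Rightarrow>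
     ('c, 'w) ring_scheme \<Rightarrow> ('m \<Rightarrow> 'n \<Rightarrow> 'c) \<Rightarrow> bool"
  where "balanced R M N P f \<longleftrightarrow>
    (\<forall>m\<in>carrier M. \<forall>n\<in>carrier N. f m n \<in> carrier P) \<and>
    (\<forall>m\<in>carrier M. \<forall>m'\<in>carrier M. \<forall>n\<in>carrier N. f (m \<oplus>\<^bsub>M\<^esub> m') n = f m n \<oplus>\<^bsub>P\<^esub> f m' n) \<and>
    (\<forall>m\<in>carrier M. \<forall>n\<in>carrier N. \<forall>n'\<in>carrier N. f m (n \<oplus>\<^bsub>N\<^esub> n') = f m n \<oplus>\<^bsub>P\<^esub> f m n') \<and>
    (\<forall>r\<in>carrier R. \<forall>m\<in>carrier M. \<forall>n\<in>carrier N. f (r \<odot>\<^bsub>M\<^esub> m) n = f m (r \<odot>\<^bsub>N\<^esub> n))"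

lemma balancedI:
  assumes "\<And>m n. m \<in> carrier M \<Longrightarrow> n \<in> carrier N \<Longrightarrow> f m n \<in> carrier P"
    and "\<And>m m' n. m \<in> carrier M \<Longrightarrow> m' \<in> carrier M \<Longrightarrow> n \<in> carrier N \<Longrightarrow>
      f (m \<oplus>\<^bsub>M\<^esub> m') n = f m n \<oplus>\<^bsub>P\<^esub> f m' n"
    and "\<And>m n n'. m \<in> carrier M \<Longrightarrow> n \<in> carrier N \<Longrightarrow> n' \<in> carrier N \<Longrightarrow>
      f m (n \<oplus>\<^bsub>N\<^esub> n') = f m n \<oplus>\<^bsub>P\<^esub> f m n'"
    and "\<And>r m n. r \<in> carrier R \<Longrightarrow> m \<in> carrier M \<Longrightarrow> n \<in> carrier N \<Longrightarrow>
      f (r \<odot>\<^bsub>M\<^esub> m) n = f m (r \<odot>\<^bsub>N\<^esub> n)"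
  shows "balanced R M N P f"
  using assms by (simp add: balanced_def)

lemma carrier_tensor: "carrier (tensor R M N) = carrier (tensor_group R M N)"
  and add_tensor: "add (tensor R M N) = monoid.mult (tensor_group R M N)"
  and zero_tensor: "\<zero>\<^bsub>tensor R M N\<^esub> = \<one>\<^bsub>tensor_group R M N\<^esub>"
  by (simp_all add: tensor_def)

text \<open>The product and the scalar action of \<open>tensor\<close> are defined by lifts into the
  multiplicatively written \<open>tensor_group\<close>. Rewritten as Sweedler sums they fall under
  the universal property.\<close>

lemma tensor_lift_tensor_group:
  "tensor_lift (tensor_group R M N) t f = sweedler (tensor R M N) t f"
  by (simp add: tensor_lift_def Let_def finprod_def int_pow_def nat_pow_def m_inv_def
      carrier_tensor add_tensor zero_tensor cong: if_cong)

context
  fixes R :: "('r, 'x) ring_scheme" and M :: "('r, 'm, 'y) module_scheme"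
    and N :: "('r, 'n, 'z) module_scheme"
  assumes M: "module R M" and N: "module R N"
begin

interpretation M: module R M by (fact M)
interpretation N: module R N by (fact N)

private abbreviation "F \<equiv> free_Abelian_group (carrier M \<times> carrier N)"
private abbreviation "K \<equiv> tensor_relations R M N"

interpretation F: comm_group F
  by (rule abelian_free_Abelian_group)

lemma tensor_relators_in_carrier: "tensor_relators R M N \<subseteq> carrier F"
proof -
  have sub: "u - v \<in> carrier F" if "u \<in> carrier F" "v \<in> carrier F" for u v
    using that keys_diff[of u v] by auto
  show ?thesis
    unfolding tensor_relators_def
    by (intro Un_least subsetI; elim CollectE exE conjE; hypsubst)
      (intro sub; simp)+
qed

lemma tensor_relations_subgroup: "subgroup K F"
  unfolding tensor_relations_def by (intro F.generate_is_subgroup tensor_relators_in_carrier)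

interpretation K: normal K F
  using tensor_relations_subgroup by (simp add: F.normal_iff_subgroup)

lemma tensor_abelian_group: "abelian_group (tensor R M N)"
proof -
  interpret T: comm_group "tensor_group R M N"
    unfolding tensor_group_def by (rule F.abelian_FactGroup[OF tensor_relations_subgroup])
  show ?thesis
    by (rule abelian_groupI)
      (auto simp: carrier_tensor add_tensor zero_tensor T.m_ac intro: T.l_inv)
qed

lemma tensor_cosetE:
  assumes "t \<in> carrier (tensor R M N)"
  obtains c where "c \<in> carrier F" "t = K #>\<^bsub>F\<^esub> c"
  using assms by (auto simp: tensor_def tensor_group_def carrier_FactGroup)

lemma coset_in_tensor: "c \<in> carrier F \<Longrightarrow> K #>\<^bsub>F\<^esub> c \<in> carrier (tensor R M N)"
  by (auto simp: tensor_def tensor_group_def carrier_FactGroup)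

lemma coset_add:
  "c \<in> carrier F \<Longrightarrow> d \<in> carrier F \<Longrightarrow>
    (K #>\<^bsub>F\<^esub> c) \<oplus>\<^bsub>tensor R M N\<^esub> (K #>\<^bsub>F\<^esub> d) = K #>\<^bsub>F\<^esub> (c + d)"
  using K.rcos_sum[of c d] by (simp add: tensor_def tensor_group_def)

lemma coset_eqI:
  assumes "c \<in> carrier F" "d \<in> carrier F" "c - d \<in> K"
  shows "K #>\<^bsub>F\<^esub> c = K #>\<^bsub>F\<^esub> d"
proof -
  have "c = (c - d) + d"
    by simp
  then have "c \<in> K #>\<^bsub>F\<^esub> d"
    using assms(3) unfolding r_coset_def by force
  then show ?thesis
    using F.repr_independence[OF _ assms(2) tensor_relations_subgroup] by simp
qed

lemma pure_tensor_closed [intro]: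
  "m \<in> carrier M \<Longrightarrow> n \<in> carrier N \<Longrightarrow> pure_tensor R M N m n \<in> carrier (tensor R M N)"
  unfolding pure_tensor_def by (intro coset_in_tensor) simp

lemma balanced_pure_tensor: "balanced R M N (tensor R M N) (pure_tensor R M N)"
proof (rule balancedI)
  have rel: "r \<in> tensor_relators R M N \<Longrightarrow> r \<in> K" for r
    unfolding tensor_relations_def by (rule generate.incl)
  fix m n
  assume m: "m \<in> carrier M" and n: "n \<in> carrier N"
  then show "pure_tensor R M N m n \<in> carrier (tensor R M N)"
    by (rule pure_tensor_closed)
  show "pure_tensor R M N (m \<oplus>\<^bsub>M\<^esub> m') n
      = pure_tensor R M N m n \<oplus>\<^bsub>tensor R M N\<^esub> pure_tensor R M N m' n"
    if m': "m' \<in> carrier M" for m'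
  proof -
    have "frag_of (m \<oplus>\<^bsub>M\<^esub> m', n) - frag_of (m, n) - frag_of (m', n) \<in> K"
      by (rule rel) (use m m' n in \<open>auto simp: tensor_relators_def\<close>)
    moreover have "frag_of (m, n) + frag_of (m', n) \<in> carrier F"
      using F.m_closed[of "frag_of (m, n)" "frag_of (m', n)"] m m' n by simp
    ultimately show ?thesis
      unfolding pure_tensor_def using m m' n
      by (simp add: coset_add) (rule coset_eqI; simp add: diff_diff_eq)
  qed
  show "pure_tensor R M N m (n \<oplus>\<^bsub>N\<^esub> n')
      = pure_tensor R M N m n \<oplus>\<^bsub>tensor R M N\<^esub> pure_tensor R M N m n'"
    if n': "n' \<in> carrier N" for n'
  proof -
    have "frag_of (m, n \<oplus>\<^bsub>N\<^esub> n') - frag_of (m, n) - frag_of (m, n') \<in> K"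
      by (rule rel) (use m n' n in \<open>auto simp: tensor_relators_def\<close>)
    moreover have "frag_of (m, n) + frag_of (m, n') \<in> carrier F"
      using F.m_closed[of "frag_of (m, n)" "frag_of (m, n')"] m n' n by simp
    ultimately show ?thesis
      unfolding pure_tensor_def using m n' n
      by (simp add: coset_add) (rule coset_eqI; simp add: diff_diff_eq)
  qed
  show "pure_tensor R M N (r \<odot>\<^bsub>M\<^esub> m) n = pure_tensor R M N m (r \<odot>\<^bsub>N\<^esub> n)"
    if r: "r \<in> carrier R" for r
  proof -
    have "frag_of (r \<odot>\<^bsub>M\<^esub> m, n) - frag_of (m, r \<odot>\<^bsub>N\<^esub> n) \<in> K"
      by (rule rel) (use m r n in \<open>auto simp: tensor_relators_def\<close>)
    then show ?thesis
      unfolding pure_tensor_def using m n r by (intro coset_eqI) auto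
  qed
qed

text \<open>Formal sums have negative coefficients, but
  \<open>- (m \<otimes> n) = (- m) \<otimes> n\<close> and \<open>0 = 0 \<otimes> n\<close>, so sums
  of pure tensors already exhaust the tensor product.\<close>

lemma tensor_induct [consumes 1, case_names pure add]:
  assumes t: "t \<in> carrier (tensor R M N)"
    and pure: "\<And>m n. m \<in> carrier M \<Longrightarrow> n \<in> carrier N \<Longrightarrow> Q (pure_tensor R M N m n)"
    and add: "\<And>s t. s \<in> carrier (tensor R M N) \<Longrightarrow> t \<in> carrier (tensor R M N) \<Longrightarrow>
      Q s \<Longrightarrow> Q t \<Longrightarrow> Q (s \<oplus>\<^bsub>tensor R M N\<^esub> t)"
  shows "Q t"
proof -
  interpret T: abelian_group "tensor R M N"
    by (rule tensor_abelian_group)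
  note P = balanced_pure_tensor[unfolded balanced_def]
  have pure_zero: "pure_tensor R M N \<zero>\<^bsub>M\<^esub> n = \<zero>\<^bsub>tensor R M N\<^esub>" if n: "n \<in> carrier N" for n
  proof -
    have "pure_tensor R M N (\<zero>\<^bsub>M\<^esub> \<oplus>\<^bsub>M\<^esub> \<zero>\<^bsub>M\<^esub>) n =
        pure_tensor R M N \<zero>\<^bsub>M\<^esub> n \<oplus>\<^bsub>tensor R M N\<^esub> pure_tensor R M N \<zero>\<^bsub>M\<^esub> n"
      using P n by blast
    then have "pure_tensor R M N \<zero>\<^bsub>M\<^esub> n =
        pure_tensor R M N \<zero>\<^bsub>M\<^esub> n \<oplus>\<^bsub>tensor R M N\<^esub> pure_tensor R M N \<zero>\<^bsub>M\<^esub> n"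
      by simp
    then show ?thesis
      using pure_tensor_closed[OF M.zero_closed n] by (metis T.add.r_cancel_one')
  qed
  \<comment> \<open>Induction on the free abelian group passes through differences, so the claim is
    carried for \<open>c\<close> and \<open>- c\<close> together.\<close>
  have "Q (K #>\<^bsub>F\<^esub> c) \<and> Q (K #>\<^bsub>F\<^esub> (- c))" if "Poly_Mapping.keys c \<subseteq> carrier M \<times> carrier N" for c
    using that
  proof (induction c rule: free_Abelian_group_induct[consumes 1, case_names zero diff one])
    case zero
    have "K #>\<^bsub>F\<^esub> 0 = \<zero>\<^bsub>tensor R M N\<^esub>"
      using K.subset K.normal_axioms F.coset_mult_one[of K]
      by (simp add: tensor_def tensor_group_def)
    then show ?case
      using pure[of "\<zero>\<^bsub>M\<^esub>" "\<zero>\<^bsub>N\<^esub>"] pure_zero[of "\<zero>\<^bsub>N\<^esub>"] by simp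
  next
    case (diff x y)
    have "x - y = x + - y" "- (x - y) = - x + y"
      by simp_all
    moreover have "x \<in> carrier F" "y \<in> carrier F" "- x \<in> carrier F" "- y \<in> carrier F"
      using diff by auto
    ultimately show ?case
      using diff add coset_in_tensor coset_add by metis
  next
    case (one a)
    then obtain m n where a: "a = (m, n)" and m: "m \<in> carrier M" and n: "n \<in> carrier N"
      by auto
    have "pure_tensor R M N m n \<oplus>\<^bsub>tensor R M N\<^esub> pure_tensor R M N (\<ominus>\<^bsub>M\<^esub> m) n
        = pure_tensor R M N (m \<oplus>\<^bsub>M\<^esub> \<ominus>\<^bsub>M\<^esub> m) n"
      using P m n by simp
    also have "\<dots> = \<zero>\<^bsub>tensor R M N\<^esub>"
      using m n pure_zero by (simp add: M.r_neg)
    finally have "pure_tensor R M N (\<ominus>\<^bsub>M\<^esub> m) n = \<ominus>\<^bsub>tensor R M N\<^esub> pure_tensor R M N m n"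
      using m n by (intro T.minus_equality[symmetric]) (auto simp: T.a_comm pure_tensor_closed)
    moreover have "K #>\<^bsub>F\<^esub> (- frag_of a) = \<ominus>\<^bsub>tensor R M N\<^esub> (K #>\<^bsub>F\<^esub> frag_of a)"
    proof (rule T.minus_equality[symmetric])
      show "(K #>\<^bsub>F\<^esub> - frag_of a) \<oplus>\<^bsub>tensor R M N\<^esub> (K #>\<^bsub>F\<^esub> frag_of a) = \<zero>\<^bsub>tensor R M N\<^esub>"
        using one K.subset F.coset_mult_one[of K]
        by (subst coset_add) (auto simp: tensor_def tensor_group_def)
    qed (use one in \<open>auto intro!: coset_in_tensor\<close>)
    ultimately show ?case
      using pure[OF m n] pure[of "\<ominus>\<^bsub>M\<^esub> m" n] m n by (simp add: a pure_tensor_def)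
  qed
  moreover obtain c where "c \<in> carrier F" "t = K #>\<^bsub>F\<^esub> c"
    using tensor_cosetE[OF t] .
  ultimately show ?thesis
    by simp
qed

text \<open>The universal property: the evaluation homomorphism \<open>h\<close> on the free abelian
  group kills the relators, hence all of \<open>K\<close>. Whatever representative
  \<open>SOME\<close> picks, it is \<open>r + c\<close> with \<open>r\<close> in \<open>K\<close>,
  and \<open>h\<close> gives it the value \<open>h c\<close>.\<close>

lemma sweedler_props:
  assumes P: "abelian_group P" and f: "balanced R M N P f"
  shows sweedler_closed:
      "t \<in> carrier (tensor R M N) \<Longrightarrow> sweedler P t f \<in> carrier P"
    and sweedler_add:
      "s \<in> carrier (tensor R M N) \<Longrightarrow> t \<in> carrier (tensor R M N) \<Longrightarrow>
       sweedler P (s \<oplus>\<^bsub>tensor R M N\<^esub> t) f = sweedler P s f \<oplus>\<^bsub>P\<^esub> sweedler P t f"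
    and sweedler_pure:
      "m \<in> carrier M \<Longrightarrow> n \<in> carrier N \<Longrightarrow> sweedler P (pure_tensor R M N m n) f = f m n"
proof -
  let ?G = "add_monoid P"
  interpret P: abelian_group P by (fact P)
  have comm: "comm_group ?G"
    by (rule P.a_comm_group)
  note group = comm_group.axioms(2)[OF comm]
  define h where "h c = finprod ?G (\<lambda>p. f (fst p) (snd p) [^]\<^bsub>?G\<^esub> Poly_Mapping.lookup c p)
    (Poly_Mapping.keys c)" for c :: "'m \<times> 'n \<Rightarrow>\<^sub>0 int"
  have closed: "f m n \<in> carrier P" if "m \<in> carrier M" "n \<in> carrier N" for m n
    using f that by (simp add: balanced_def)
  have hom: "h \<in> hom F ?G"
    unfolding h_def using closed
    by (intro comm_group.free_Abelian_group_eval_hom[OF comm, of "\<lambda>p. f (fst p) (snd p)"]) auto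
  then interpret h: group_hom F ?G h
    by (intro group_hom.intro group_hom_axioms.intro F.is_group group)
  have h_closed: "h c \<in> carrier P" if "c \<in> carrier F" for c
    using hom_in_carrier[OF hom that] by simp
  have h_add: "h (c + d) = h c \<oplus>\<^bsub>P\<^esub> h d" if "c \<in> carrier F" "d \<in> carrier F" for c d
    using h.hom_mult[OF that] by simp
  have h_of: "h (frag_of (m, n)) = f m n" if "m \<in> carrier M" "n \<in> carrier N" for m n
    using closed[OF that] comm_group.axioms(1)[OF comm]
    by (simp add: h_def comm_monoid.finprod_insert comm_monoid.finprod_empty group.int_pow_1[OF group]
        comm_monoid.axioms(1) monoid.r_one flip: One_nat_def)
  have h_diff: "h (c - d) = h c \<ominus>\<^bsub>P\<^esub> h d" if "c \<in> carrier F" "d \<in> carrier F" for c d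
  proof -
    have cd: "c - d \<in> carrier F"
      using that keys_diff[of c d] by auto
    have "h c = h ((c - d) + d)"
      by simp
    also have "\<dots> = h (c - d) \<oplus>\<^bsub>P\<^esub> h d"
      by (rule h_add[OF cd that(2)])
    finally show ?thesis
      using h_closed[OF cd] h_closed[OF that(2)]
      by (simp add: P.minus_eq P.a_assoc P.r_neg)
  qed
  have diff: "frag_of p - frag_of q \<in> carrier F"
    if "p \<in> carrier M \<times> carrier N" "q \<in> carrier M \<times> carrier N" for p q
    using that keys_diff[of "frag_of p" "frag_of q"] by auto
  \<comment> \<open>The shape in which the additivity relators appear after \<open>h\<close> is
    applied and the differences are expanded.\<close>
  have cancel: "x \<oplus>\<^bsub>P\<^esub> (y \<oplus>\<^bsub>P\<^esub> (\<ominus>\<^bsub>P\<^esub> x \<oplus>\<^bsub>P\<^esub> \<ominus>\<^bsub>P\<^esub> y)) = \<zero>\<^bsub>P\<^esub>"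
    if "x \<in> carrier P" "y \<in> carrier P" for x y
    using P.r_neg[of "x \<oplus>\<^bsub>P\<^esub> y"] that by (simp add: P.minus_add P.a_assoc)
  have "r \<in> kernel F ?G h" if "r \<in> tensor_relators R M N" for r
  proof -
    have "h r = \<zero>\<^bsub>P\<^esub>"
      using that f unfolding tensor_relators_def balanced_def
      by (auto simp: h_diff diff[simplified] h_of closed P.minus_eq P.a_assoc P.r_neg cancel)
    then show ?thesis
      using subsetD[OF tensor_relators_in_carrier that] by (simp add: kernel_def)
  qed
  then have "K \<subseteq> kernel F ?G h"
    unfolding tensor_relations_def
    by (intro F.generate_subgroup_incl h.subgroup_kernel) auto
  then have h_K: "h r = \<zero>\<^bsub>P\<^esub>" if "r \<in> K" for r
    using that by (auto simp: kernel_def)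
  have lift: "sweedler P (K #>\<^bsub>F\<^esub> c) f = h c" if c: "c \<in> carrier F" for c
  proof -
    have "c \<in> K #>\<^bsub>F\<^esub> c"
      by (rule F.rcos_self[OF c tensor_relations_subgroup])
    then have "(SOME d. d \<in> K #>\<^bsub>F\<^esub> c) \<in> K #>\<^bsub>F\<^esub> c"
      by (rule someI[of "\<lambda>d. d \<in> K #>\<^bsub>F\<^esub> c"])
    then obtain r where r: "r \<in> K" "(SOME d. d \<in> K #>\<^bsub>F\<^esub> c) = r + c"
      unfolding r_coset_def by auto
    have "h (r + c) = h r \<oplus>\<^bsub>P\<^esub> h c"
      by (rule h_add[OF subsetD[OF K.subset r(1)] c])
    then show ?thesis
      using h_closed[OF c] by (simp add: tensor_lift_def Let_def r h_K flip: h_def)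
  qed
  show "sweedler P t f \<in> carrier P" if t: "t \<in> carrier (tensor R M N)" for t
  proof -
    obtain c where "c \<in> carrier F" "t = K #>\<^bsub>F\<^esub> c"
      using tensor_cosetE[OF t] .
    then show ?thesis
      using h_closed by (simp add: lift)
  qed
  show "sweedler P (s \<oplus>\<^bsub>tensor R M N\<^esub> t) f = sweedler P s f \<oplus>\<^bsub>P\<^esub> sweedler P t f"
    if s: "s \<in> carrier (tensor R M N)" and t: "t \<in> carrier (tensor R M N)" for s t
  proof -
    obtain c where "c \<in> carrier F" "s = K #>\<^bsub>F\<^esub> c"
      using tensor_cosetE[OF s] .
    moreover obtain d where "d \<in> carrier F" "t = K #>\<^bsub>F\<^esub> d"
      using tensor_cosetE[OF t] .
    ultimately show ?thesis
      using F.m_closed[of c d] h_add[of c d] by (simp add: coset_add lift)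
  qed
  show "sweedler P (pure_tensor R M N m n) f = f m n" if "m \<in> carrier M" "n \<in> carrier N" for m n
    unfolding pure_tensor_def using that by (simp add: lift h_of)
qed

text \<open>Both sides evaluate the same chosen representative, and its support lies in
  \<open>carrier M \<times> carrier N\<close>, so agreement there is enough.\<close>

lemma sweedler_cong:
  assumes "t \<in> carrier (tensor R M N)"
    and "\<And>m n. m \<in> carrier M \<Longrightarrow> n \<in> carrier N \<Longrightarrow> f m n = g m n"
    and "abelian_group P"
    and "\<And>m n. m \<in> carrier M \<Longrightarrow> n \<in> carrier N \<Longrightarrow> g m n \<in> carrier P"
  shows "sweedler P t f = sweedler P t g"
proof -
  interpret P: abelian_group P by (fact assms(3))
  have "comm_group (add_monoid P)"
    by (rule P.a_comm_group)
  note group = comm_group.axioms[OF this]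
  obtain c where c: "c \<in> carrier F" "t = K #>\<^bsub>F\<^esub> c"
    using tensor_cosetE[OF assms(1)] .
  then have "(SOME d. d \<in> t) \<in> K #>\<^bsub>F\<^esub> c"
    using F.rcos_self[OF c(1) tensor_relations_subgroup] someI[of "\<lambda>d. d \<in> t" c] by simp
  then have d: "(SOME d. d \<in> t) \<in> carrier F"
    using F.r_coset_subset_G[OF K.subset c(1)] by blast
  show ?thesis
    unfolding tensor_lift_def Let_def
  proof (rule comm_monoid.finprod_cong'[OF group(1)])
    fix p
    assume "p \<in> Poly_Mapping.keys (SOME d. d \<in> t)"
    then show "f (fst p) (snd p) [^]\<^bsub>add_monoid P\<^esub> Poly_Mapping.lookup (SOME c. c \<in> t) p
        = g (fst p) (snd p) [^]\<^bsub>add_monoid P\<^esub> Poly_Mapping.lookup (SOME c. c \<in> t) p"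
      using d assms(2) by (auto dest!: subsetD)
  next
    show "(\<lambda>p. g (fst p) (snd p) [^]\<^bsub>add_monoid P\<^esub> Poly_Mapping.lookup (SOME c. c \<in> t) p)
        \<in> Poly_Mapping.keys (SOME c. c \<in> t) \<rightarrow> carrier (add_monoid P)"
      using d assms(4) group.int_pow_closed[OF group(2)] by (auto dest!: subsetD)
  qed simp
qed

end

section \<open>Linear and bilinear maps\<close>

text \<open>Closure rules that show a nested Sweedler sum to be linear in one variable at a time;
  together with \<open>bilinear_mapsI\<close> they discharge bilinearity conditions by
  resolution.\<close>

named_theorems linear_intros

lemma linear_mapsI:
  assumes "\<And>x. x \<in> carrier M \<Longrightarrow> f x \<in> carrier N"
    and "\<And>x y. x \<in> carrier M \<Longrightarrow> y \<in> carrier M \<Longrightarrow> f (x \<oplus>\<^bsub>M\<^esub> y) = f x \<oplus>\<^bsub>N\<^esub> f y"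
    and "\<And>r x. r \<in> carrier R \<Longrightarrow> x \<in> carrier M \<Longrightarrow> f (r \<odot>\<^bsub>M\<^esub> x) = r \<odot>\<^bsub>N\<^esub> f x"
  shows "f \<in> linear_maps R M N"
  using assms by (simp add: linear_maps_def)

lemma linear_maps_closed: "f \<in> linear_maps R M N \<Longrightarrow> x \<in> carrier M \<Longrightarrow> f x \<in> carrier N"
  and linear_maps_add: "f \<in> linear_maps R M N \<Longrightarrow> x \<in> carrier M \<Longrightarrow> y \<in> carrier M \<Longrightarrow>
    f (x \<oplus>\<^bsub>M\<^esub> y) = f x \<oplus>\<^bsub>N\<^esub> f y"
  and linear_maps_smult: "f \<in> linear_maps R M N \<Longrightarrow> r \<in> carrier R \<Longrightarrow> x \<in> carrier M \<Longrightarrow>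
    f (r \<odot>\<^bsub>M\<^esub> x) = r \<odot>\<^bsub>N\<^esub> f x"
  by (auto simp: linear_maps_def)

lemma linear_maps_cong:
  assumes "f \<in> linear_maps R M N" "\<And>x. x \<in> carrier M \<Longrightarrow> g x = f x" "module R M"
  shows "g \<in> linear_maps R M N"
proof -
  interpret M: module R M by fact
  show ?thesis
    using assms(1,2) by (intro linear_mapsI) (auto simp: linear_maps_def)
qed

lemma linear_maps_id [linear_intros]: "(\<lambda>x. x) \<in> linear_maps R M M"
  by (simp add: linear_maps_def)

lemma linear_maps_comp:
  assumes f: "f \<in> linear_maps R M N" and g: "g \<in> linear_maps R N P"
  shows "(\<lambda>x. g (f x)) \<in> linear_maps R M P"
  by (rule linear_mapsI)
    (simp_all add: linear_maps_closed[OF f] linear_maps_add[OF f] linear_maps_smult[OF f]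
      linear_maps_closed[OF g] linear_maps_add[OF g] linear_maps_smult[OF g])

lemma linear_maps_inverse:
  assumes f: "f \<in> linear_maps R M N" and M: "module R M"
    and g: "\<And>y. y \<in> carrier N \<Longrightarrow> g y \<in> carrier M" "\<And>y. y \<in> carrier N \<Longrightarrow> f (g y) = y"
      "\<And>x. x \<in> carrier M \<Longrightarrow> g (f x) = x"
  shows "g \<in> linear_maps R N M"
proof -
  interpret M: module R M by fact
  show ?thesis
  proof (rule linear_mapsI)
    fix x y
    assume "x \<in> carrier N" "y \<in> carrier N"
    then show "g (x \<oplus>\<^bsub>N\<^esub> y) = g x \<oplus>\<^bsub>M\<^esub> g y"
      using linear_maps_add[OF f, of "g x" "g y"] g by (metis M.add.m_closed)
  next
    fix r x
    assume "r \<in> carrier R" "x \<in> carrier N"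
    then show "g (r \<odot>\<^bsub>N\<^esub> x) = r \<odot>\<^bsub>M\<^esub> g x"
      using linear_maps_smult[OF f, of r "g x"] g by (metis M.smult_closed)
  qed (rule g)
qed

lemma linear_maps_inv_into:
  assumes "f \<in> linear_maps R M P" "bij_betw f (carrier M) (carrier P)" "module R M"
  shows "inv_into (carrier M) f \<in> linear_maps R P M"
  using assms(1,3) by (rule linear_maps_inverse)
    (use assms(2) in \<open>auto simp: bij_betw_def f_inv_into_f inv_into_into\<close>)

lemma linear_maps_smult_const [linear_intros]:
  assumes "module R M" "r \<in> carrier R"
  shows "(\<lambda>x. r \<odot>\<^bsub>M\<^esub> x) \<in> linear_maps R M M"
proof -
  interpret M: module R M by fact
  show ?thesis
    using assms(2) by (intro linear_mapsI)
      (auto simp: M.smult_r_distr M.smult_assoc1[symmetric] M.R.m_comm)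
qed

text \<open>With the counit as \<open>f\<close> this is linearity of
  \<open>h \<mapsto> \<epsilon>(h) m\<close>; with a coordinate as \<open>f\<close>, of
  \<open>m \<mapsto> f(m) n\<close>.\<close>

lemma linear_maps_regular_smult [linear_intros]:
  assumes "module R M" "f \<in> linear_maps R X (regular_module R)" "m \<in> carrier M"
  shows "(\<lambda>x. f x \<odot>\<^bsub>M\<^esub> m) \<in> linear_maps R X M"
proof -
  interpret M: module R M by fact
  show ?thesis
    using assms(2,3)
    by (intro linear_mapsI) (auto simp: linear_maps_def regular_module_def M.smult_l_distr M.smult_assoc1 Pi_def)
qed

definition bilinear_maps ::
    "('r, 'x) ring_scheme \<Rightarrow> ('r, 'm, 'y) module_scheme \<Rightarrow> ('r, 'n, 'z) module_scheme \<Rightarrow>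
     ('r, 'p, 'w) module_scheme \<Rightarrow> ('m \<Rightarrow> 'n \<Rightarrow> 'p) set"
  where "bilinear_maps R M N P =
    {f. (\<forall>m\<in>carrier M. f m \<in> linear_maps R N P) \<and>
        (\<forall>n\<in>carrier N. (\<lambda>m. f m n) \<in> linear_maps R M P)}"

lemma bilinear_mapsI:
  assumes "\<And>n. n \<in> carrier N \<Longrightarrow> (\<lambda>m. f m n) \<in> linear_maps R M P"
    and "\<And>m. m \<in> carrier M \<Longrightarrow> (\<lambda>n. f m n) \<in> linear_maps R N P"
  shows "f \<in> bilinear_maps R M N P"
  using assms by (simp add: bilinear_maps_def)

lemma bilinear_maps_right:
  "f \<in> bilinear_maps R M N P \<Longrightarrow> m \<in> carrier M \<Longrightarrow> (\<lambda>n. f m n) \<in> linear_maps R N P"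
  and bilinear_maps_left:
  "f \<in> bilinear_maps R M N P \<Longrightarrow> n \<in> carrier N \<Longrightarrow> (\<lambda>m. f m n) \<in> linear_maps R M P"
  by (auto simp: bilinear_maps_def)

lemma bilinear_maps_closed:
  "f \<in> bilinear_maps R M N P \<Longrightarrow> m \<in> carrier M \<Longrightarrow> n \<in> carrier N \<Longrightarrow> f m n \<in> carrier P"
  by (auto simp: bilinear_maps_def linear_maps_def)

lemma bilinear_maps_balanced: "f \<in> bilinear_maps R M N P \<Longrightarrow> balanced R M N P f"
  by (auto simp: bilinear_maps_def balanced_def linear_maps_def)

context
  fixes R :: "('r, 'x) ring_scheme" and M :: "('r, 'm, 'y) module_scheme"
    and N :: "('r, 'n, 'z) module_scheme"
  assumes M: "module R M" and N: "module R N"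
begin

interpretation M: module R M by (fact M)
interpretation N: module R N by (fact N)
interpretation T: abelian_group "tensor R M N" by (rule tensor_abelian_group[OF M N])

private lemmas pure_simps = balanced_pure_tensor[OF M N, unfolded balanced_def]

lemma pure_tensor_add_left: "m \<in> carrier M \<Longrightarrow> m' \<in> carrier M \<Longrightarrow> n \<in> carrier N \<Longrightarrow>
    pure_tensor R M N (m \<oplus>\<^bsub>M\<^esub> m') n = pure_tensor R M N m n \<oplus>\<^bsub>tensor R M N\<^esub> pure_tensor R M N m' n"
  and pure_tensor_add_right: "m \<in> carrier M \<Longrightarrow> n \<in> carrier N \<Longrightarrow> n' \<in> carrier N \<Longrightarrow>
    pure_tensor R M N m (n \<oplus>\<^bsub>N\<^esub> n') = pure_tensor R M N m n \<oplus>\<^bsub>tensor R M N\<^esub> pure_tensor R M N m n'"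
  and pure_tensor_balanced: "r \<in> carrier R \<Longrightarrow> m \<in> carrier M \<Longrightarrow> n \<in> carrier N \<Longrightarrow>
    pure_tensor R M N (r \<odot>\<^bsub>M\<^esub> m) n = pure_tensor R M N m (r \<odot>\<^bsub>N\<^esub> n)"
  using pure_simps by blast+

lemma balanced_smult_pure_tensor:
  "r \<in> carrier R \<Longrightarrow> balanced R M N (tensor R M N) (\<lambda>m n. pure_tensor R M N (r \<odot>\<^bsub>M\<^esub> m) n)"
  by (rule balancedI)
    (simp_all add: pure_tensor_closed[OF M N] M.smult_r_distr pure_tensor_add_left
      pure_tensor_add_right pure_tensor_balanced M.R.m_comm M.smult_assoc1[symmetric]
      N.smult_assoc1[symmetric])

lemma smult_tensor: "r \<odot>\<^bsub>tensor R M N\<^esub> t =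
    sweedler (tensor R M N) t (\<lambda>m n. pure_tensor R M N (r \<odot>\<^bsub>M\<^esub> m) n)"
proof -
  have "r \<odot>\<^bsub>tensor R M N\<^esub> t =
      tensor_lift (tensor_group R M N) t (\<lambda>m n. pure_tensor R M N (r \<odot>\<^bsub>M\<^esub> m) n)"
    by (simp add: tensor_def)
  then show ?thesis
    by (simp only: tensor_lift_tensor_group)
qed

lemmas smult_tensor_props =
  sweedler_props[OF M N tensor_abelian_group[OF M N] balanced_smult_pure_tensor, folded smult_tensor]

lemma tensor_module: "module R (tensor R M N)"
proof (rule moduleI)
  note closed = smult_tensor_props(1) and add = smult_tensor_props(2)
    and pure = smult_tensor_props(3)
  note pc = pure_tensor_closed[OF M N]
  show "cring R" "abelian_group (tensor R M N)"
    by (unfold_locales)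
  show "\<one>\<^bsub>R\<^esub> \<odot>\<^bsub>tensor R M N\<^esub> x = x" if x: "x \<in> carrier (tensor R M N)" for x
    using x
    by (induction x rule: tensor_induct[OF M N, consumes 1, case_names pure add])
      (simp_all add: pure add closed pc)
  fix a x
  assume a: "a \<in> carrier R" and x: "x \<in> carrier (tensor R M N)"
  show "a \<odot>\<^bsub>tensor R M N\<^esub> x \<in> carrier (tensor R M N)"
    using a x by (rule closed)
  show "a \<odot>\<^bsub>tensor R M N\<^esub> (x \<oplus>\<^bsub>tensor R M N\<^esub> y) = a \<odot>\<^bsub>tensor R M N\<^esub> x \<oplus>\<^bsub>tensor R M N\<^esub> a \<odot>\<^bsub>tensor R M N\<^esub> y"
    if "y \<in> carrier (tensor R M N)" for y
    using a x that by (rule add)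
  show "(a \<oplus>\<^bsub>R\<^esub> b) \<odot>\<^bsub>tensor R M N\<^esub> x = a \<odot>\<^bsub>tensor R M N\<^esub> x \<oplus>\<^bsub>tensor R M N\<^esub> b \<odot>\<^bsub>tensor R M N\<^esub> x"
    if b: "b \<in> carrier R" for b
    using x a b
    by (induction x rule: tensor_induct[OF M N, consumes 1, case_names pure add])
      (simp_all add: pure add closed pc M.smult_l_distr pure_tensor_add_left T.a_ac)
  show "(a \<otimes>\<^bsub>R\<^esub> b) \<odot>\<^bsub>tensor R M N\<^esub> x = a \<odot>\<^bsub>tensor R M N\<^esub> (b \<odot>\<^bsub>tensor R M N\<^esub> x)"
    if b: "b \<in> carrier R" for b
    using x a b
    by (induction x rule: tensor_induct[OF M N, consumes 1, case_names pure add])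
      (simp_all add: pure add closed pc M.smult_assoc1)
qed

lemma smult_pure_tensor: "r \<in> carrier R \<Longrightarrow> m \<in> carrier M \<Longrightarrow> n \<in> carrier N \<Longrightarrow>
    r \<odot>\<^bsub>tensor R M N\<^esub> pure_tensor R M N m n = pure_tensor R M N (r \<odot>\<^bsub>M\<^esub> m) n"
  by (rule smult_tensor_props(3))

lemma pure_tensor_bilinear: "pure_tensor R M N \<in> bilinear_maps R M N (tensor R M N)"
  by (intro bilinear_mapsI linear_mapsI)
    (simp_all add: pure_tensor_closed[OF M N] pure_tensor_add_left pure_tensor_add_right
      smult_pure_tensor pure_tensor_balanced)

lemma pure_tensor_linear_left [linear_intros]:
  "f \<in> linear_maps R X M \<Longrightarrow> n \<in> carrier N \<Longrightarrow>
    (\<lambda>x. pure_tensor R M N (f x) n) \<in> linear_maps R X (tensor R M N)"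
  by (rule linear_maps_comp[OF _ bilinear_maps_left[OF pure_tensor_bilinear]])

lemma pure_tensor_linear_right [linear_intros]:
  "f \<in> linear_maps R X N \<Longrightarrow> m \<in> carrier M \<Longrightarrow>
    (\<lambda>x. pure_tensor R M N m (f x)) \<in> linear_maps R X (tensor R M N)"
  by (rule linear_maps_comp[OF _ bilinear_maps_right[OF pure_tensor_bilinear]])

lemma tensor_ext:
  assumes "f \<in> linear_maps R (tensor R M N) P" "g \<in> linear_maps R (tensor R M N) P"
    and "\<And>m n. m \<in> carrier M \<Longrightarrow> n \<in> carrier N \<Longrightarrow> f (pure_tensor R M N m n) = g (pure_tensor R M N m n)"
    and "t \<in> carrier (tensor R M N)"
  shows "f t = g t"
  using assms(4)
  by (induction t rule: tensor_induct[OF M N, consumes 1, case_names pure add])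
    (simp_all add: assms(3) linear_maps_add[OF assms(1)] linear_maps_add[OF assms(2)])

lemma sweedler_pure_tensor_id:
  "t \<in> carrier (tensor R M N) \<Longrightarrow> sweedler (tensor R M N) t (pure_tensor R M N) = t"
  by (induction t rule: tensor_induct[OF M N, consumes 1, case_names pure add])
    (simp_all add: sweedler_props[OF M N tensor_abelian_group[OF M N] balanced_pure_tensor[OF M N]])

text \<open>Stated for additive \<open>g\<close>, because it is also applied to sums over M
  \<otimes>_A N whose values are mapped into a \<open>k\<close>-module such as A \<otimes>
  H.\<close>

lemma sweedler_additive_comp:
  assumes f: "balanced R M N P f" and P: "abelian_group P" and Q: "abelian_group Q"
    and g: "\<And>x. x \<in> carrier P \<Longrightarrow> g x \<in> carrier Q"
      "\<And>x y. x \<in> carrier P \<Longrightarrow> y \<in> carrier P \<Longrightarrow> g (x \<oplus>\<^bsub>P\<^esub> y) = g x \<oplus>\<^bsub>Q\<^esub> g y"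
    and t: "t \<in> carrier (tensor R M N)"
  shows "g (sweedler P t f) = sweedler Q t (\<lambda>m n. g (f m n))"
proof -
  interpret P: abelian_group P by fact
  have gf: "balanced R M N Q (\<lambda>m n. g (f m n))"
    using f g by (auto simp: balanced_def)
  show ?thesis
    using t
    by (induction t rule: tensor_induct[OF M N, consumes 1, case_names pure add])
      (simp_all add: sweedler_props[OF M N P f] sweedler_props[OF M N Q gf] g)
qed

context
  fixes P :: "('r, 'p, 'w) module_scheme"
  assumes P: "module R P"
begin

interpretation P: module R P by (fact P)

lemma bilinear_sweedler_props:
  assumes f: "f \<in> bilinear_maps R M N P"
  shows sweedler_closed_bilinear: "t \<in> carrier (tensor R M N) \<Longrightarrow> sweedler P t f \<in> carrier P"
    and sweedler_add_bilinear:
      "s \<in> carrier (tensor R M N) \<Longrightarrow> t \<in> carrier (tensor R M N) \<Longrightarrow>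
       sweedler P (s \<oplus>\<^bsub>tensor R M N\<^esub> t) f = sweedler P s f \<oplus>\<^bsub>P\<^esub> sweedler P t f"
    and sweedler_pure_bilinear:
      "m \<in> carrier M \<Longrightarrow> n \<in> carrier N \<Longrightarrow> sweedler P (pure_tensor R M N m n) f = f m n"
  by (intro sweedler_props[OF M N P.abelian_group_axioms bilinear_maps_balanced[OF f]]; assumption)+

lemma sweedler_linear:
  assumes f: "f \<in> bilinear_maps R M N P"
  shows "(\<lambda>t. sweedler P t f) \<in> linear_maps R (tensor R M N) P"
proof (intro linear_mapsI)
  interpret TM: module R "tensor R M N" by (rule tensor_module)
  fix r t
  assume r: "r \<in> carrier R" and t: "t \<in> carrier (tensor R M N)"
  show "sweedler P (r \<odot>\<^bsub>tensor R M N\<^esub> t) f = r \<odot>\<^bsub>P\<^esub> sweedler P t f"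
    using t r
    by (induction t rule: tensor_induct[OF M N, consumes 1, case_names pure add])
      (simp_all add: smult_pure_tensor bilinear_sweedler_props[OF f] TM.smult_r_distr
        P.smult_r_distr linear_maps_smult[OF bilinear_maps_left[OF f]])
qed (simp_all add: bilinear_sweedler_props[OF f])

lemma sweedler_linear_arg:
  assumes "f \<in> bilinear_maps R M N P" "g \<in> linear_maps R X (tensor R M N)"
  shows "(\<lambda>x. sweedler P (g x) f) \<in> linear_maps R X P"
  by (rule linear_maps_comp[OF assms(2) sweedler_linear[OF assms(1)]])

text \<open>Here the tensor is fixed and the summand varies, as it does for the outer variable of
  nested Sweedler sums. Induction on the tensor reduces the claim to the summand at one
  pair.\<close>

lemma sweedler_linear_param:
  assumes X: "module R X"
    and F: "\<And>x. x \<in> carrier X \<Longrightarrow> F x \<in> bilinear_maps R M N P"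
    and lin: "\<And>m n. m \<in> carrier M \<Longrightarrow> n \<in> carrier N \<Longrightarrow> (\<lambda>x. F x m n) \<in> linear_maps R X P"
    and t: "t \<in> carrier (tensor R M N)"
  shows "(\<lambda>x. sweedler P t (F x)) \<in> linear_maps R X P"
proof (intro linear_mapsI)
  interpret X: module R X by (fact X)
  note F_props = bilinear_sweedler_props[OF F]
  fix x
  assume x: "x \<in> carrier X"
  show "sweedler P t (F x) \<in> carrier P"
    using x t by (rule F_props)
  show "sweedler P t (F (x \<oplus>\<^bsub>X\<^esub> y)) = sweedler P t (F x) \<oplus>\<^bsub>P\<^esub> sweedler P t (F y)"
    if y: "y \<in> carrier X" for y
    using t x y
    by (induction t rule: tensor_induct[OF M N, consumes 1, case_names pure add])
      (simp_all add: F_props linear_maps_add[OF lin] P.a_ac)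
  show "sweedler P t (F (r \<odot>\<^bsub>X\<^esub> x)) = r \<odot>\<^bsub>P\<^esub> sweedler P t (F x)"
    if r: "r \<in> carrier R" for r
    using t x r
    by (induction t rule: tensor_induct[OF M N, consumes 1, case_names pure add])
      (simp_all add: F_props linear_maps_smult[OF lin] P.smult_r_distr)
qed

lemma sweedler_linear_comp:
  assumes "g \<in> linear_maps R P Q" "f \<in> bilinear_maps R M N P" "t \<in> carrier (tensor R M N)" "module R Q"
  shows "g (sweedler P t f) = sweedler Q t (\<lambda>m n. g (f m n))"
proof -
  interpret Q: module R Q by fact
  show ?thesis
    using assms
    by (intro sweedler_additive_comp bilinear_maps_balanced P.abelian_group_axioms
        Q.abelian_group_axioms) (auto simp: linear_maps_closed linear_maps_add)
qed

end

end

text \<open>Premises are ordered so that resolution first determines the modules \<open>M\<close> and \<open>N\<close>.\<close>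

lemmas [linear_intros] = sweedler_linear_arg[rotated 4] sweedler_linear_param[rotated 6]

lemma sweedler_of_linear:
  assumes "module R M" "module R N" "module R P"
    and f: "f \<in> linear_maps R (tensor R M N) P" and t: "t \<in> carrier (tensor R M N)"
  shows "sweedler P t (\<lambda>m n. f (pure_tensor R M N m n)) = f t"
  using sweedler_linear_comp[OF assms(1,2) tensor_module[OF assms(1,2)] f
      pure_tensor_bilinear[OF assms(1,2)] t assms(3)]
  by (simp add: sweedler_pure_tensor_id[OF assms(1,2) t])

text \<open>The main device for turning the Sweedler sums of the definitions into linear maps: the
  summand is compared with \<open>f\<close> on pure tensors, and bilinearity is inherited from
  \<open>f\<close>.\<close>

lemma sweedler_eq_linear:
  assumes "module R M" "module R N" "module R P"
    and f: "f \<in> linear_maps R (tensor R M N) P" and t: "t \<in> carrier (tensor R M N)"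
    and g: "\<And>m n. m \<in> carrier M \<Longrightarrow> n \<in> carrier N \<Longrightarrow> g m n = f (pure_tensor R M N m n)"
  shows "sweedler P t g = f t"
proof -
  interpret P: module R P by fact
  have "sweedler P t g = sweedler P t (\<lambda>m n. f (pure_tensor R M N m n))"
    by (rule sweedler_cong[OF assms(1,2) t g P.abelian_group_axioms])
      (auto intro!: linear_maps_closed[OF f] pure_tensor_closed[OF assms(1,2)])
  then show ?thesis
    by (simp add: sweedler_of_linear[OF assms(1-5)])
qed

section \<open>The maps \<open>f \<otimes> id\<close>: functoriality of the tensor product in its
  first factor\<close>

definition tensor_map ::
    "('r, 'x) ring_scheme \<Rightarrow> ('r, 'm, 'y) module_scheme \<Rightarrow> ('r, 'p, 'w) module_scheme \<Rightarrow>
     ('r, 'n, 'z) module_scheme \<Rightarrow> ('m \<Rightarrow> 'p) \<Rightarrow> ('m \<times> 'n \<Rightarrow>\<^sub>0 int) set \<Rightarrow> ('p \<times> 'n \<Rightarrow>\<^sub>0 int) set"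
  where "tensor_map R M P N f t = sweedler (tensor R P N) t (\<lambda>m n. pure_tensor R P N (f m) n)"

context
  fixes R :: "('r, 'x) ring_scheme" and M :: "('r, 'm, 'y) module_scheme"
    and N :: "('r, 'n, 'z) module_scheme" and P :: "('r, 'p, 'w) module_scheme" and f
  assumes M: "module R M" and N: "module R N" and P: "module R P"
    and f: "f \<in> linear_maps R M P"
begin

lemma tensor_map_bilinear:
  "(\<lambda>m n. pure_tensor R P N (f m) n) \<in> bilinear_maps R M N (tensor R P N)"
  by (intro bilinear_mapsI linear_intros M N P f linear_maps_closed[OF f])

lemma tensor_map_linear: "tensor_map R M P N f \<in> linear_maps R (tensor R M N) (tensor R P N)"
  using sweedler_linear[OF M N tensor_module[OF P N] tensor_map_bilinear]
  by (simp add: tensor_map_def[abs_def])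

lemma tensor_map_pure: "m \<in> carrier M \<Longrightarrow> n \<in> carrier N \<Longrightarrow>
    tensor_map R M P N f (pure_tensor R M N m n) = pure_tensor R P N (f m) n"
  unfolding tensor_map_def
  by (rule sweedler_pure_bilinear[OF M N tensor_module[OF P N] tensor_map_bilinear])

end

lemma tensor_map_inverse:
  assumes mods: "module R M" "module R P" "module R N"
    and f: "f \<in> linear_maps R M P" and g: "g \<in> linear_maps R P M"
    and gf: "\<And>m. m \<in> carrier M \<Longrightarrow> g (f m) = m"
    and t: "t \<in> carrier (tensor R M N)"
  shows "tensor_map R P M N g (tensor_map R M P N f t) = t"
proof -
  note Mf = tensor_map_linear[OF mods(1,3,2) f] and Pg = tensor_map_linear[OF mods(2,3,1) g]
  show ?thesis
    by (rule tensor_ext[OF mods(1,3) linear_maps_comp[OF Mf Pg] linear_maps_id _ t])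
      (simp add: tensor_map_pure[OF mods(1,3,2) f] tensor_map_pure[OF mods(2,3,1) g]
        linear_maps_closed[OF f] gf)
qed

lemma tensor_map_bij_betw:
  assumes mods: "module R M" "module R P" "module R N"
    and f: "f \<in> linear_maps R M P" and bij: "bij_betw f (carrier M) (carrier P)"
  shows "bij_betw (tensor_map R M P N f) (carrier (tensor R M N)) (carrier (tensor R P N))"
proof (rule bij_betwI)
  let ?g = "inv_into (carrier M) f"
  have g: "?g \<in> linear_maps R P M"
    by (rule linear_maps_inv_into[OF f bij mods(1)])
  show "tensor_map R M P N f \<in> carrier (tensor R M N) \<rightarrow> carrier (tensor R P N)"
    "tensor_map R P M N ?g \<in> carrier (tensor R P N) \<rightarrow> carrier (tensor R M N)"
    using linear_maps_closed[OF tensor_map_linear[OF mods(1,3,2) f]]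
      linear_maps_closed[OF tensor_map_linear[OF mods(2,3,1) g]] by auto
  show "tensor_map R P M N ?g (tensor_map R M P N f t) = t" if "t \<in> carrier (tensor R M N)" for t
    using that bij by (intro tensor_map_inverse[OF mods f g]) (auto simp: bij_betw_def)
  show "tensor_map R M P N f (tensor_map R P M N ?g t) = t" if "t \<in> carrier (tensor R P N)" for t
    using that bij by (intro tensor_map_inverse[OF mods(2,1,3) g f]) (auto simp: bij_betw_def f_inv_into_f)
qed

lemma tensor_map_comp:
  assumes mods: "module R M" "module R P" "module R Q" "module R N"
    and f: "f \<in> linear_maps R M P" and g: "g \<in> linear_maps R P Q"
    and t: "t \<in> carrier (tensor R M N)"
  shows "tensor_map R P Q N g (tensor_map R M P N f t) = tensor_map R M Q N (\<lambda>m. g (f m)) t"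
proof -
  note gf = linear_maps_comp[OF f g]
  show ?thesis
    by (rule tensor_ext[OF mods(1,4) linear_maps_comp[OF tensor_map_linear[OF mods(1,4,2) f]
            tensor_map_linear[OF mods(2,4,3) g]] tensor_map_linear[OF mods(1,4,3) gf] _ t])
      (simp add: tensor_map_pure[OF mods(1,4,2) f] tensor_map_pure[OF mods(2,4,3) g]
        tensor_map_pure[OF mods(1,4,3) gf] linear_maps_closed[OF f])
qed

lemma tensor_map_cong:
  assumes mods: "module R M" "module R P" "module R N"
    and f: "f \<in> linear_maps R M P" and eq: "\<And>m. m \<in> carrier M \<Longrightarrow> g m = f m"
    and t: "t \<in> carrier (tensor R M N)"
  shows "tensor_map R M P N g t = tensor_map R M P N f t"
proof -
  have g: "g \<in> linear_maps R M P"
    by (rule linear_maps_cong[OF f eq mods(1)])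
  show ?thesis
    by (rule tensor_ext[OF mods(1,3) tensor_map_linear[OF mods(1,3,2) g]
          tensor_map_linear[OF mods(1,3,2) f] _ t])
      (simp add: tensor_map_pure[OF mods(1,3,2) f] tensor_map_pure[OF mods(1,3,2) g] eq)
qed

section \<open>Tensor products of commutative algebras\<close>

definition algebra_homs ::
    "('r, 'x) ring_scheme \<Rightarrow> ('r, 'a, 'y) module_scheme \<Rightarrow> ('r, 'b, 'z) module_scheme \<Rightarrow> ('a \<Rightarrow> 'b) set"
  where "algebra_homs R A B = linear_maps R A B \<inter> ring_hom A B"

lemma algebra_homs_linear: "f \<in> algebra_homs R A B \<Longrightarrow> f \<in> linear_maps R A B"
  and algebra_homs_closed: "f \<in> algebra_homs R A B \<Longrightarrow> x \<in> carrier A \<Longrightarrow> f x \<in> carrier B"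
  and algebra_homs_mult: "f \<in> algebra_homs R A B \<Longrightarrow> x \<in> carrier A \<Longrightarrow> y \<in> carrier A \<Longrightarrow>
    f (x \<otimes>\<^bsub>A\<^esub> y) = f x \<otimes>\<^bsub>B\<^esub> f y"
  and algebra_homs_one: "f \<in> algebra_homs R A B \<Longrightarrow> f \<one>\<^bsub>A\<^esub> = \<one>\<^bsub>B\<^esub>"
  by (auto simp: algebra_homs_def linear_maps_closed ring_hom_mult ring_hom_one)

lemma algebra_homsI:
  assumes "f \<in> linear_maps R A B"
    and "\<And>x y. x \<in> carrier A \<Longrightarrow> y \<in> carrier A \<Longrightarrow> f (x \<otimes>\<^bsub>A\<^esub> y) = f x \<otimes>\<^bsub>B\<^esub> f y"
    and "f \<one>\<^bsub>A\<^esub> = \<one>\<^bsub>B\<^esub>"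
  shows "f \<in> algebra_homs R A B"
  using assms by (auto simp: algebra_homs_def ring_hom_def linear_maps_def)

lemma algebra_homs_comp:
  assumes f: "f \<in> algebra_homs R A B" and g: "g \<in> algebra_homs R B C"
  shows "(\<lambda>x. g (f x)) \<in> algebra_homs R A C"
  by (rule algebra_homsI[OF linear_maps_comp[OF algebra_homs_linear[OF f] algebra_homs_linear[OF g]]])
    (simp_all add: algebra_homs_closed[OF f] algebra_homs_mult[OF f] algebra_homs_one[OF f]
      algebra_homs_mult[OF g] algebra_homs_one[OF g])

lemma algebra_homs_id: "(\<lambda>x. x) \<in> algebra_homs R A A"
  by (auto simp: algebra_homs_def linear_maps_id ring_hom_def)

lemma algebra_homs_Units:
  assumes f: "f \<in> algebra_homs R A B" and u: "u \<in> Units A"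
  shows "f u \<in> Units B"
proof -
  obtain v where v: "v \<in> carrier A" "v \<otimes>\<^bsub>A\<^esub> u = \<one>\<^bsub>A\<^esub>" "u \<otimes>\<^bsub>A\<^esub> v = \<one>\<^bsub>A\<^esub>" "u \<in> carrier A"
    using u unfolding Units_def by blast
  then have "f v \<otimes>\<^bsub>B\<^esub> f u = \<one>\<^bsub>B\<^esub>" "f u \<otimes>\<^bsub>B\<^esub> f v = \<one>\<^bsub>B\<^esub>"
    by (simp_all add: algebra_homs_mult[OF f, symmetric] algebra_homs_one[OF f])
  then show ?thesis
    using v algebra_homs_closed[OF f] unfolding Units_def by blast
qed

lemma mult_linear_left [linear_intros]:
  assumes "algebra R A" "f \<in> linear_maps R X A" "b \<in> carrier A"
  shows "(\<lambda>x. f x \<otimes>\<^bsub>A\<^esub> b) \<in> linear_maps R X A"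
proof -
  interpret A: cring A by (rule algebra.M_cring[OF assms(1)])
  interpret algebra R A by fact
  show ?thesis
    using assms(2,3)
    by (auto simp: linear_maps_def Pi_def A.l_distr smult_assoc2)
qed

lemma mult_linear_right [linear_intros]:
  assumes "algebra R A" "f \<in> linear_maps R X A" "b \<in> carrier A"
  shows "(\<lambda>x. b \<otimes>\<^bsub>A\<^esub> f x) \<in> linear_maps R X A"
proof -
  interpret A: cring A by (rule algebra.M_cring[OF assms(1)])
  interpret algebra R A by fact
  have comm: "b \<otimes>\<^bsub>A\<^esub> y = y \<otimes>\<^bsub>A\<^esub> b" if "y \<in> carrier A" for y
    by (rule A.m_comm[OF assms(3) that])
  show ?thesis
    using assms(2,3) module_axioms
    by (auto simp: linear_maps_def Pi_def A.l_distr comm smult_assoc2 module.smult_closed)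
qed

context
  fixes R :: "('r, 'x) ring_scheme" and A :: "('r, 'a, 'y) module_scheme"
    and B :: "('r, 'b, 'z) module_scheme"
  assumes A: "algebra R A" and B: "algebra R B"
begin

interpretation Ar: cring A by (rule algebra.M_cring[OF A])
interpretation A: algebra R A by (fact A)
interpretation Br: cring B by (rule algebra.M_cring[OF B])
interpretation B: algebra R B by (fact B)

private lemmas mods = A.module_axioms B.module_axioms
private lemmas pure_closed = pure_tensor_closed[OF mods]

interpretation T: module R "tensor R A B" by (rule tensor_module[OF mods])

private lemma mult_bilinear:
  assumes "a \<in> carrier A" "b \<in> carrier B"
  shows "(\<lambda>a' b'. pure_tensor R A B (a \<otimes>\<^bsub>A\<^esub> a') (b \<otimes>\<^bsub>B\<^esub> b')) \<in> bilinear_maps R A B (tensor R A B)"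
  by (rule bilinear_mapsI linear_intros mods A B Ar.m_closed Br.m_closed assms | assumption)+

private lemma mult_bilinear_outer:
  assumes "t \<in> carrier (tensor R A B)"
  shows "(\<lambda>a b. sweedler (tensor R A B) t (\<lambda>a' b'. pure_tensor R A B (a \<otimes>\<^bsub>A\<^esub> a') (b \<otimes>\<^bsub>B\<^esub> b')))
    \<in> bilinear_maps R A B (tensor R A B)"
  by (rule bilinear_mapsI mult_bilinear linear_intros assms mods A B T.module_axioms
      Ar.m_closed Br.m_closed | assumption)+

lemma mult_tensor: "s \<otimes>\<^bsub>tensor R A B\<^esub> t = sweedler (tensor R A B) s (\<lambda>a b.
    sweedler (tensor R A B) t (\<lambda>a' b'. pure_tensor R A B (a \<otimes>\<^bsub>A\<^esub> a') (b \<otimes>\<^bsub>B\<^esub> b')))"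
proof -
  have "s \<otimes>\<^bsub>tensor R A B\<^esub> t = tensor_lift (tensor_group R A B) s (\<lambda>a b.
      tensor_lift (tensor_group R A B) t (\<lambda>a' b'. pure_tensor R A B (a \<otimes>\<^bsub>A\<^esub> a') (b \<otimes>\<^bsub>B\<^esub> b')))"
    by (simp add: tensor_def)
  then show ?thesis
    by (simp only: tensor_lift_tensor_group)
qed

lemma one_tensor: "\<one>\<^bsub>tensor R A B\<^esub> = pure_tensor R A B \<one>\<^bsub>A\<^esub> \<one>\<^bsub>B\<^esub>"
  by (simp add: tensor_def)

lemma mult_pure_tensor:
  "a \<in> carrier A \<Longrightarrow> b \<in> carrier B \<Longrightarrow> a' \<in> carrier A \<Longrightarrow> b' \<in> carrier B \<Longrightarrow>
    pure_tensor R A B a b \<otimes>\<^bsub>tensor R A B\<^esub> pure_tensor R A B a' b' =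
    pure_tensor R A B (a \<otimes>\<^bsub>A\<^esub> a') (b \<otimes>\<^bsub>B\<^esub> b')"
  unfolding mult_tensor
  by (simp add: sweedler_pure_bilinear[OF mods T.module_axioms mult_bilinear_outer]
      sweedler_pure_bilinear[OF mods T.module_axioms mult_bilinear] pure_closed)

lemma mult_tensor_bilinear:
  "monoid.mult (tensor R A B) \<in> bilinear_maps R (tensor R A B) (tensor R A B) (tensor R A B)"
  unfolding mult_tensor[abs_def]
  by (rule bilinear_mapsI mult_bilinear mult_bilinear_outer linear_intros mods T.module_axioms
      | assumption)+

text \<open>Every ring law is additive in each variable, so induction on the tensors, one after the
  other, reduces it to pure tensors, where it is the law in \<open>A\<close> and in
  \<open>B\<close>.\<close>

lemma tensor_algebra: "algebra R (tensor R A B)"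
proof -
  let ?T = "tensor R A B"
  note left = bilinear_maps_left[OF mult_tensor_bilinear]
    and right = bilinear_maps_right[OF mult_tensor_bilinear]
  have closed: "x \<otimes>\<^bsub>?T\<^esub> y \<in> carrier ?T" if "x \<in> carrier ?T" "y \<in> carrier ?T" for x y
    by (rule bilinear_maps_closed[OF mult_tensor_bilinear that])
  note simps = linear_maps_add[OF left] linear_maps_add[OF right] closed mult_pure_tensor pure_closed
  have comm: "x \<otimes>\<^bsub>?T\<^esub> y = y \<otimes>\<^bsub>?T\<^esub> x" if "x \<in> carrier ?T" "y \<in> carrier ?T" for x y
    using that(1)
  proof (induction x rule: tensor_induct[OF mods, consumes 1, case_names pure add])
    case x: (pure a b)
    show ?case
      using that(2) x
      by (induction y rule: tensor_induct[OF mods, consumes 1, case_names pure add])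
        (simp_all add: simps Ar.m_comm Br.m_comm)
  qed (simp add: simps that)
  have assoc: "x \<otimes>\<^bsub>?T\<^esub> y \<otimes>\<^bsub>?T\<^esub> z = x \<otimes>\<^bsub>?T\<^esub> (y \<otimes>\<^bsub>?T\<^esub> z)"
    if "x \<in> carrier ?T" "y \<in> carrier ?T" "z \<in> carrier ?T" for x y z
    using that(1)
  proof (induction x rule: tensor_induct[OF mods, consumes 1, case_names pure add])
    case x: (pure a b)
    show ?case
      using that(2)
    proof (induction y rule: tensor_induct[OF mods, consumes 1, case_names pure add])
      case y: (pure a' b')
      show ?case
        using that(3) x y
        by (induction z rule: tensor_induct[OF mods, consumes 1, case_names pure add])
          (simp_all add: simps Ar.m_assoc Br.m_assoc)
    qed (use x that(3) in \<open>simp add: simps\<close>)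
  qed (use that in \<open>simp add: simps\<close>)
  have one: "\<one>\<^bsub>?T\<^esub> \<otimes>\<^bsub>?T\<^esub> x = x" if "x \<in> carrier ?T" for x
    using that
    by (induction x rule: tensor_induct[OF mods, consumes 1, case_names pure add]) (simp_all add: one_tensor simps)
  have "comm_monoid ?T"
    by (rule comm_monoidI)
      (simp_all only: closed assoc one, simp add: one_tensor pure_closed, rule comm)
  then have "cring ?T"
    by (intro cringI tensor_abelian_group mods) (simp_all add: simps)
  then show ?thesis
    by (intro algebra.intro algebra_axioms.intro T.module_axioms linear_maps_smult[OF left])
qed

lemma algebra_hom_left: "(\<lambda>a. pure_tensor R A B a \<one>\<^bsub>B\<^esub>) \<in> algebra_homs R A (tensor R A B)"
  by (intro algebra_homsI linear_intros mods) (simp_all add: one_tensor mult_pure_tensor)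

lemma algebra_hom_right: "(\<lambda>b. pure_tensor R A B \<one>\<^bsub>A\<^esub> b) \<in> algebra_homs R B (tensor R A B)"
  by (intro algebra_homsI linear_intros mods) (simp_all add: one_tensor mult_pure_tensor)

context
  fixes C :: "('r, 'c, 'w) module_scheme"
  assumes C: "algebra R C"
begin

interpretation Cr: cring C by (rule algebra.M_cring[OF C])
interpretation C: algebra R C by (fact C)

text \<open>Because \<open>a \<otimes> b = (a \<otimes> 1) (1 \<otimes> b)\<close>, the images of
  the two factors generate the tensor product. This reduces later identities of homomorphisms to one
  leg at a time.\<close>

lemma algebra_hom_tensor_ext:
  assumes f: "f \<in> algebra_homs R (tensor R A B) C" and g: "g \<in> algebra_homs R (tensor R A B) C"
    and left: "\<And>a. a \<in> carrier A \<Longrightarrow> f (pure_tensor R A B a \<one>\<^bsub>B\<^esub>) = g (pure_tensor R A B a \<one>\<^bsub>B\<^esub>)"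
    and right: "\<And>b. b \<in> carrier B \<Longrightarrow> f (pure_tensor R A B \<one>\<^bsub>A\<^esub> b) = g (pure_tensor R A B \<one>\<^bsub>A\<^esub> b)"
    and t: "t \<in> carrier (tensor R A B)"
  shows "f t = g t"
proof (rule tensor_ext[OF mods algebra_homs_linear[OF f] algebra_homs_linear[OF g] _ t])
  fix a b
  assume ab: "a \<in> carrier A" "b \<in> carrier B"
  then have "pure_tensor R A B a b = pure_tensor R A B a \<one>\<^bsub>B\<^esub> \<otimes>\<^bsub>tensor R A B\<^esub> pure_tensor R A B \<one>\<^bsub>A\<^esub> b"
    by (simp add: mult_pure_tensor)
  then show "f (pure_tensor R A B a b) = g (pure_tensor R A B a b)"
    using ab by (simp add: algebra_homs_mult[OF f] algebra_homs_mult[OF g] left right pure_closed)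
qed

context
  fixes f :: "'a \<Rightarrow> 'c" and g :: "'b \<Rightarrow> 'c"
  assumes f: "f \<in> algebra_homs R A C" and g: "g \<in> algebra_homs R B C"
begin

lemma algebra_hom_lift_bilinear: "(\<lambda>a b. f a \<otimes>\<^bsub>C\<^esub> g b) \<in> bilinear_maps R A B C"
  by (intro bilinear_mapsI linear_intros mods C algebra_homs_linear[OF f] algebra_homs_linear[OF g]
      algebra_homs_closed[OF f] algebra_homs_closed[OF g])

lemma algebra_hom_lift_pure: "a \<in> carrier A \<Longrightarrow> b \<in> carrier B \<Longrightarrow>
    sweedler C (pure_tensor R A B a b) (\<lambda>a b. f a \<otimes>\<^bsub>C\<^esub> g b) = f a \<otimes>\<^bsub>C\<^esub> g b"
  by (rule sweedler_pure_bilinear[OF mods C.module_axioms algebra_hom_lift_bilinear])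

text \<open>The coproduct property of \<otimes> among commutative algebras. Commutativity of
  \<open>C\<close> lets \<open>f a'\<close> move past \<open>g b\<close>, which gives
  multiplicativity on pure tensors.\<close>

lemma algebra_hom_lift:
  "(\<lambda>t. sweedler C t (\<lambda>a b. f a \<otimes>\<^bsub>C\<^esub> g b)) \<in> algebra_homs R (tensor R A B) C"
proof -
  interpret Tr: cring "tensor R A B" by (rule algebra.M_cring[OF tensor_algebra])
  note fc = algebra_homs_closed[OF f] and gc = algebra_homs_closed[OF g]
  let ?h = "\<lambda>t. sweedler C t (\<lambda>a b. f a \<otimes>\<^bsub>C\<^esub> g b)"
  have lin: "?h \<in> linear_maps R (tensor R A B) C"
    by (rule sweedler_linear[OF mods C.module_axioms algebra_hom_lift_bilinear])
  note simps = linear_maps_add[OF lin] linear_maps_closed[OF lin] algebra_hom_lift_pure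
    mult_pure_tensor pure_closed algebra_homs_mult[OF f] algebra_homs_mult[OF g] fc gc
  show ?thesis
  proof (rule algebra_homsI[OF lin])
    fix x y
    assume x: "x \<in> carrier (tensor R A B)" and y: "y \<in> carrier (tensor R A B)"
    show "?h (x \<otimes>\<^bsub>tensor R A B\<^esub> y) = ?h x \<otimes>\<^bsub>C\<^esub> ?h y"
      using x
    proof (induction x rule: tensor_induct[OF mods, consumes 1, case_names pure add])
      case x: (pure a b)
      show ?case
        using y x
        by (induction y rule: tensor_induct[OF mods, consumes 1, case_names pure add])
          (simp_all add: simps Tr.r_distr Cr.r_distr Cr.m_ac)
    qed (use y in \<open>simp add: simps Tr.l_distr Cr.l_distr\<close>)
  next
    show "?h \<one>\<^bsub>tensor R A B\<^esub> = \<one>\<^bsub>C\<^esub>"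
      by (simp add: one_tensor algebra_hom_lift_pure algebra_homs_one[OF f] algebra_homs_one[OF g])
  qed
qed

end

end

end

section \<open>Harrison cocycles as equations between algebra homomorphisms\<close>

context comm_bialgebra
begin

lemma H_algebra: "algebra k H"
  by unfold_locales

lemma HH_algebra: "algebra k (tensor k H H)"
  by (rule tensor_algebra[OF H_algebra H_algebra])

lemma H_module: "module k H" and HH_module: "module k (tensor k H H)"
  by (rule algebra.axioms(1) H_algebra HH_algebra)+

lemma comult_hom: "comult H \<in> algebra_homs k H (tensor k H H)"
  using comult_linear comult_ring_hom by (simp add: algebra_homs_def)

text \<open>The counit followed by the structure map of \<open>C\<close>. In this form \<epsilon>
  can be a factor in a product of homomorphisms into \<open>A\<close> or into A \<otimes> H.\<close>

lemma counit_unit_hom: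
  assumes "algebra k C"
  shows "(\<lambda>h. counit H h \<odot>\<^bsub>C\<^esub> \<one>\<^bsub>C\<^esub>) \<in> algebra_homs k H C"
proof -
  interpret Cr: cring C by (rule algebra.M_cring[OF assms])
  interpret C: algebra k C by (rule assms)
  have closed: "counit H h \<in> carrier k" if "h \<in> carrier H" for h
    using counit_ring_hom that by (rule ring_hom_closed)
  show ?thesis
  proof (rule algebra_homsI)
    show "(\<lambda>h. counit H h \<odot>\<^bsub>C\<^esub> \<one>\<^bsub>C\<^esub>) \<in> linear_maps k H C"
      by (intro linear_intros counit_linear C.module_axioms) simp
    fix x y
    assume xy: "x \<in> carrier H" "y \<in> carrier H"
    then show "counit H (x \<otimes>\<^bsub>H\<^esub> y) \<odot>\<^bsub>C\<^esub> \<one>\<^bsub>C\<^esub>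
        = (counit H x \<odot>\<^bsub>C\<^esub> \<one>\<^bsub>C\<^esub>) \<otimes>\<^bsub>C\<^esub> (counit H y \<odot>\<^bsub>C\<^esub> \<one>\<^bsub>C\<^esub>)"
      by (simp add: ring_hom_mult[OF counit_ring_hom] C.smult_assoc2 C.smult_assoc1 closed)
  next
    show "counit H \<one>\<^bsub>H\<^esub> \<odot>\<^bsub>C\<^esub> \<one>\<^bsub>C\<^esub> = \<one>\<^bsub>C\<^esub>"
      by (simp add: ring_hom_one[OF counit_ring_hom])
  qed
qed

end

context comm_comodule_algebra
begin

abbreviation "AH \<equiv> tensor k A H"
abbreviation "HH \<equiv> tensor k H H"
abbreviation "AHH \<equiv> tensor k A HH"

lemma A_algebra: "algebra k A"
  by unfold_locales

lemma AH_algebra: "algebra k AH"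
  by (rule tensor_algebra[OF A_algebra H_algebra])

lemma AHH_algebra: "algebra k AHH"
  by (rule tensor_algebra[OF A_algebra HH_algebra])

lemma A_module: "module k A" and AH_module: "module k AH" and AHH_module: "module k AHH"
  by (rule algebra.axioms(1) A_algebra AH_algebra AHH_algebra)+

lemma A_cring: "cring A" and HH_cring: "cring HH"
  and AH_cring: "cring AH" and AHH_cring: "cring AHH"
  by (rule algebra.M_cring A_algebra H_algebra HH_algebra AH_algebra AHH_algebra)+

lemma coaction_hom: "coact A \<in> algebra_homs k A AH"
  using coaction_linear coaction_ring_hom by (simp add: algebra_homs_def)

lemma coaction_closed: "a \<in> carrier A \<Longrightarrow> coact A a \<in> carrier AH"
  by (rule algebra_homs_closed[OF coaction_hom])

text \<open>The maps \<open>id \<otimes> \<epsilon>\<close>, \<open>id \<otimes> \<Delta>\<close>, \<open>x \<mapsto> x \<otimes> 1\<close> and \<open>\<rho> \<otimes> id\<close>, written as products of two algebra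
  homomorphisms so that they are multiplicative by construction.\<close>

definition counit_map where
  "counit_map t = sweedler A t (\<lambda>a h. a \<otimes>\<^bsub>A\<^esub> (counit H h \<odot>\<^bsub>A\<^esub> \<one>\<^bsub>A\<^esub>))"

definition comult_map where
  "comult_map t = sweedler AHH t (\<lambda>a h.
    pure_tensor k A HH a \<one>\<^bsub>HH\<^esub> \<otimes>\<^bsub>AHH\<^esub> pure_tensor k A HH \<one>\<^bsub>A\<^esub> (comult H h))"

definition face_left where
  "face_left t = sweedler AHH t (\<lambda>a h. pure_tensor k A HH a \<one>\<^bsub>HH\<^esub> \<otimes>\<^bsub>AHH\<^esub>
    pure_tensor k A HH \<one>\<^bsub>A\<^esub> (pure_tensor k H H h \<one>\<^bsub>H\<^esub>))"

definition coact_map where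
  "coact_map t = sweedler AHH t (\<lambda>a h. face_left (coact A a) \<otimes>\<^bsub>AHH\<^esub>
    pure_tensor k A HH \<one>\<^bsub>A\<^esub> (pure_tensor k H H \<one>\<^bsub>H\<^esub> h))"

lemma counit_map_hom: "counit_map \<in> algebra_homs k AH A"
  unfolding counit_map_def[abs_def]
  by (rule algebra_hom_lift[OF A_algebra H_algebra A_algebra algebra_homs_id counit_unit_hom[OF A_algebra]])

lemma comult_map_hom: "comult_map \<in> algebra_homs k AH AHH"
  unfolding comult_map_def[abs_def]
  by (rule algebra_hom_lift[OF A_algebra H_algebra AHH_algebra algebra_hom_left[OF A_algebra HH_algebra]
        algebra_homs_comp[OF comult_hom algebra_hom_right[OF A_algebra HH_algebra]]])

lemma face_left_hom: "face_left \<in> algebra_homs k AH AHH"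
  unfolding face_left_def[abs_def]
  by (rule algebra_hom_lift[OF A_algebra H_algebra AHH_algebra algebra_hom_left[OF A_algebra HH_algebra]
        algebra_homs_comp[OF algebra_hom_left[OF H_algebra H_algebra]
          algebra_hom_right[OF A_algebra HH_algebra]]])

lemma coact_map_hom: "coact_map \<in> algebra_homs k AH AHH"
  unfolding coact_map_def[abs_def]
  by (rule algebra_hom_lift[OF A_algebra H_algebra AHH_algebra
        algebra_homs_comp[OF coaction_hom face_left_hom]
        algebra_homs_comp[OF algebra_hom_right[OF H_algebra H_algebra]
          algebra_hom_right[OF A_algebra HH_algebra]]])

lemma AH_pure_closed: "a \<in> carrier A \<Longrightarrow> h \<in> carrier H \<Longrightarrow> pure_tensor k A H a h \<in> carrier AH"
  by (rule pure_tensor_closed[OF A_module H_module])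

lemma HH_pure_closed: "g \<in> carrier H \<Longrightarrow> h \<in> carrier H \<Longrightarrow> pure_tensor k H H g h \<in> carrier HH"
  by (rule pure_tensor_closed[OF H_module H_module])

lemma AHH_pure_closed: "a \<in> carrier A \<Longrightarrow> u \<in> carrier HH \<Longrightarrow> pure_tensor k A HH a u \<in> carrier AHH"
  by (rule pure_tensor_closed[OF A_module HH_module])

lemmas pure_closed = AH_pure_closed HH_pure_closed AHH_pure_closed

lemmas mult_pure = mult_pure_tensor[OF A_algebra H_algebra] mult_pure_tensor[OF H_algebra H_algebra]
  mult_pure_tensor[OF A_algebra HH_algebra]

lemma comult_closed: "h \<in> carrier H \<Longrightarrow> comult H h \<in> carrier HH"
  by (rule algebra_homs_closed[OF comult_hom])

lemma counit_map_pure: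
  assumes "a \<in> carrier A" "h \<in> carrier H"
  shows "counit_map (pure_tensor k A H a h) = counit H h \<odot>\<^bsub>A\<^esub> a"
proof -
  have c: "counit H h \<in> carrier k"
    using counit_ring_hom assms(2) by (rule ring_hom_closed)
  have "a \<otimes>\<^bsub>A\<^esub> (counit H h \<odot>\<^bsub>A\<^esub> \<one>\<^bsub>A\<^esub>) = (counit H h \<odot>\<^bsub>A\<^esub> \<one>\<^bsub>A\<^esub>) \<otimes>\<^bsub>A\<^esub> a"
    using c assms(1) by (intro comm_monoid.m_comm[OF cring.axioms(2)[OF A_cring]]) simp_all
  also have "\<dots> = counit H h \<odot>\<^bsub>A\<^esub> a"
    using c assms(1) by (simp add: algebra.smult_assoc2[OF A_algebra])
  finally have "a \<otimes>\<^bsub>A\<^esub> (counit H h \<odot>\<^bsub>A\<^esub> \<one>\<^bsub>A\<^esub>) = counit H h \<odot>\<^bsub>A\<^esub> a" .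
  then show ?thesis
    using algebra_hom_lift_pure[OF A_algebra H_algebra A_algebra algebra_homs_id
        counit_unit_hom[OF A_algebra] assms]
    by (simp add: counit_map_def)
qed

lemma comult_map_pure:
  assumes "a \<in> carrier A" "h \<in> carrier H"
  shows "comult_map (pure_tensor k A H a h) = pure_tensor k A HH a (comult H h)"
proof -
  interpret HH: cring HH by (rule HH_cring)
  show ?thesis
    using algebra_hom_lift_pure[OF A_algebra H_algebra AHH_algebra algebra_hom_left[OF A_algebra HH_algebra]
        algebra_homs_comp[OF comult_hom algebra_hom_right[OF A_algebra HH_algebra]] assms]
    using assms by (simp add: comult_map_def mult_pure comult_closed)
qed

lemma face_left_pure:
  assumes "a \<in> carrier A" "h \<in> carrier H"
  shows "face_left (pure_tensor k A H a h) = pure_tensor k A HH a (pure_tensor k H H h \<one>\<^bsub>H\<^esub>)"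
proof -
  interpret HH: cring HH by (rule HH_cring)
  show ?thesis
    using algebra_hom_lift_pure[OF A_algebra H_algebra AHH_algebra algebra_hom_left[OF A_algebra HH_algebra]
        algebra_homs_comp[OF algebra_hom_left[OF H_algebra H_algebra]
          algebra_hom_right[OF A_algebra HH_algebra]] assms]
    using assms by (simp add: face_left_def mult_pure pure_closed)
qed

lemma coact_map_pure:
  assumes "a \<in> carrier A" "h \<in> carrier H"
  shows "coact_map (pure_tensor k A H a h) = face_left (coact A a) \<otimes>\<^bsub>AHH\<^esub>
    pure_tensor k A HH \<one>\<^bsub>A\<^esub> (pure_tensor k H H \<one>\<^bsub>H\<^esub> h)"
  unfolding coact_map_def
  by (rule algebra_hom_lift_pure[OF A_algebra H_algebra AHH_algebra
        algebra_homs_comp[OF coaction_hom face_left_hom]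
        algebra_homs_comp[OF algebra_hom_right[OF H_algebra H_algebra]
          algebra_hom_right[OF A_algebra HH_algebra]] assms])

text \<open>Holding the last leg fixed amounts to multiplying by
  \<open>1 \<otimes> 1 \<otimes> g\<close>. In this form a Sweedler sum over the first two legs
  becomes a multiple of \<open>face_left\<close>.\<close>

lemma face_left_mult_pure:
  assumes "a \<in> carrier A" "h \<in> carrier H" "g \<in> carrier H"
  shows "face_left (pure_tensor k A H a h) \<otimes>\<^bsub>AHH\<^esub>
      pure_tensor k A HH \<one>\<^bsub>A\<^esub> (pure_tensor k H H \<one>\<^bsub>H\<^esub> g) =
    pure_tensor k A HH a (pure_tensor k H H h g)"
proof -
  show ?thesis
    using assms by (simp add: face_left_pure mult_pure pure_closed)
qed

lemma coact_map_left:
  assumes a: "a \<in> carrier A"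
  shows "coact_map (pure_tensor k A H a \<one>\<^bsub>H\<^esub>) = face_left (coact A a)"
proof -
  interpret AHH: cring AHH by (rule AHH_cring)
  show ?thesis
    using a by (simp add: coact_map_pure coaction_closed algebra_homs_closed[OF face_left_hom]
        flip: one_tensor[OF H_algebra H_algebra] one_tensor[OF A_algebra HH_algebra])
qed

text \<open>Coassociativity of \<open>A\<close>, that is \<open>(\<rho> \<otimes> id) \<rho> = (id
  \<otimes> \<Delta>) \<rho>\<close>, once the nested sums of the axiom are rewritten as
  homomorphisms from the inside outwards.\<close>

lemma coact_map_coaction:
  assumes a: "a \<in> carrier A"
  shows "coact_map (coact A a) = comult_map (coact A a)"
proof -
  have "sweedler AHH (coact A a) (\<lambda>m0 m1.
      sweedler AHH (coact A m0) (\<lambda>m00 m01. pure_tensor k A HH m00 (pure_tensor k H H m01 m1)))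
    = coact_map (coact A a)"
  proof (rule sweedler_eq_linear[OF A_module H_module AHH_module
        algebra_homs_linear[OF coact_map_hom] coaction_closed[OF a]])
    fix b h
    assume b: "b \<in> carrier A" and h: "h \<in> carrier H"
    have "sweedler AHH (coact A b) (\<lambda>m00 m01. pure_tensor k A HH m00 (pure_tensor k H H m01 h))
      = face_left (coact A b) \<otimes>\<^bsub>AHH\<^esub> pure_tensor k A HH \<one>\<^bsub>A\<^esub> (pure_tensor k H H \<one>\<^bsub>H\<^esub> h)"
      by (rule sweedler_eq_linear[OF A_module H_module AHH_module
            mult_linear_left[OF AHH_algebra algebra_homs_linear[OF face_left_hom]]])
        (use b h in \<open>simp_all add: pure_closed coaction_closed face_left_mult_pure\<close>)
    also have "\<dots> = coact_map (pure_tensor k A H b h)"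
      using b h by (simp add: coact_map_pure)
    finally show "sweedler AHH (coact A b) (\<lambda>m00 m01. pure_tensor k A HH m00 (pure_tensor k H H m01 h))
      = coact_map (pure_tensor k A H b h)" .
  qed
  moreover have "sweedler AHH (coact A a) (\<lambda>m0 m1. pure_tensor k A HH m0 (comult H m1))
    = comult_map (coact A a)"
    by (rule sweedler_eq_linear[OF A_module H_module AHH_module
          algebra_homs_linear[OF comult_map_hom] coaction_closed[OF a]])
      (simp add: comult_map_pure)
  ultimately show ?thesis
    using coaction_coassociative a by (simp add: coassociative_def Let_def)
qed

lemma counit_map_coaction:
  assumes a: "a \<in> carrier A"
  shows "counit_map (coact A a) = a"
proof -
  have "sweedler A (coact A a) (\<lambda>m0 m1. counit H m1 \<odot>\<^bsub>A\<^esub> m0) = counit_map (coact A a)"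
    by (rule sweedler_eq_linear[OF A_module H_module A_module
          algebra_homs_linear[OF counit_map_hom] coaction_closed[OF a]])
      (simp add: counit_map_pure)
  then show ?thesis
    using coaction_counit[OF a] by simp
qed

text \<open>The equation \<open>(id \<otimes> \<Delta>) X = (X \<otimes> 1) (\<rho> \<otimes> id)
  X\<close>, kept apart from invertibility of \<open>X\<close> because coassociativity of a free
  module is equivalent to it for arbitrary \<open>X\<close>.\<close>

definition cocycle_eq where
  "cocycle_eq X \<longleftrightarrow> comult_map X = face_left X \<otimes>\<^bsub>AHH\<^esub> coact_map X"

lemma harrison_cocycles_eq: "harrison_cocycles k H A = {X \<in> Units AH. cocycle_eq X}"
proof -
  interpret AHH: cring AHH by (rule AHH_cring)
  have "sweedler AHH X (\<lambda>a h. pure_tensor k A HH a (comult H h)) = comult_map X"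
    if "X \<in> carrier AH" for X
    by (rule sweedler_eq_linear[OF A_module H_module AHH_module
          algebra_homs_linear[OF comult_map_hom] that])
      (simp add: comult_map_pure)
  moreover have "sweedler AHH X (\<lambda>a h.
      sweedler AHH X (\<lambda>b g.
        sweedler AHH (coact A b) (\<lambda>b0 b1.
          pure_tensor k A HH (a \<otimes>\<^bsub>A\<^esub> b0) (pure_tensor k H H (h \<otimes>\<^bsub>H\<^esub> b1) g))))
    = face_left X \<otimes>\<^bsub>AHH\<^esub> coact_map X"
    if X: "X \<in> carrier AH" for X
  proof (rule sweedler_eq_linear[OF A_module H_module AHH_module
        mult_linear_left[OF AHH_algebra algebra_homs_linear[OF face_left_hom]
          algebra_homs_closed[OF coact_map_hom X]] X])
    fix a h
    assume ah: "a \<in> carrier A" "h \<in> carrier H"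
    have face: "face_left (pure_tensor k A H a h) \<in> carrier AHH"
      using ah by (intro algebra_homs_closed[OF face_left_hom] pure_closed)
    show "sweedler AHH X (\<lambda>b g.
        sweedler AHH (coact A b) (\<lambda>b0 b1.
          pure_tensor k A HH (a \<otimes>\<^bsub>A\<^esub> b0) (pure_tensor k H H (h \<otimes>\<^bsub>H\<^esub> b1) g)))
      = face_left (pure_tensor k A H a h) \<otimes>\<^bsub>AHH\<^esub> coact_map X"
    proof (rule sweedler_eq_linear[OF A_module H_module AHH_module
        mult_linear_right[OF AHH_algebra algebra_homs_linear[OF coact_map_hom] face] X])
      fix b g
      assume bg: "b \<in> carrier A" "g \<in> carrier H"
      let ?g = "pure_tensor k A HH \<one>\<^bsub>A\<^esub> (pure_tensor k H H \<one>\<^bsub>H\<^esub> g)"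
      \<comment> \<open>The summand factors as \<open>a b0 \<otimes> h b1 \<otimes> g = (a \<otimes>
        h \<otimes> 1) (b0 \<otimes> b1 \<otimes> 1) (1 \<otimes> 1 \<otimes> g)\<close>.\<close>
      have "sweedler AHH (coact A b) (\<lambda>b0 b1.
          pure_tensor k A HH (a \<otimes>\<^bsub>A\<^esub> b0) (pure_tensor k H H (h \<otimes>\<^bsub>H\<^esub> b1) g))
        = face_left (pure_tensor k A H a h) \<otimes>\<^bsub>AHH\<^esub> (face_left (coact A b) \<otimes>\<^bsub>AHH\<^esub> ?g)"
        by (rule sweedler_eq_linear[OF A_module H_module AHH_module
            mult_linear_right[OF AHH_algebra mult_linear_left[OF AHH_algebra
                algebra_homs_linear[OF face_left_hom]] face]])
          (use ah bg in \<open>simp_all add: face_left_mult_pure face_left_pure mult_pure pure_closed coaction_closed\<close>)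
      then show "sweedler AHH (coact A b) (\<lambda>b0 b1.
          pure_tensor k A HH (a \<otimes>\<^bsub>A\<^esub> b0) (pure_tensor k H H (h \<otimes>\<^bsub>H\<^esub> b1) g))
        = face_left (pure_tensor k A H a h) \<otimes>\<^bsub>AHH\<^esub> coact_map (pure_tensor k A H b g)"
        using bg by (simp add: coact_map_pure)
    qed
  qed
  ultimately show ?thesis
    unfolding harrison_cocycles_def cocycle_eq_def Let_def by (auto simp: Units_def)
qed

text \<open>Applying \<open>id \<otimes> \<epsilon> \<otimes> id\<close> to the cocycle equation of \<open>X\<close> gives \<open>X = (E X \<otimes> 1) X\<close>,
  where \<open>E = id \<otimes> \<epsilon>\<close>.\<close>

lemma cocycle_counit:
  assumes X: "X \<in> Units AH" and coc: "cocycle_eq X"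
  shows "counit_map X = \<one>\<^bsub>A\<^esub>"
proof -
  interpret HH: cring HH by (rule HH_cring)
  interpret AH: cring AH by (rule AH_cring)
  interpret AHH: cring AHH by (rule AHH_cring)
  have Xc: "X \<in> carrier AH"
    using X by auto
  \<comment> \<open>\<open>c\<close> is \<open>\<epsilon> \<otimes> id\<close> on H \<otimes> H,
    with values placed in 1 \<otimes> H; the map \<open>G\<close> below extends it to
    \<open>id \<otimes> \<epsilon> \<otimes> id\<close>.\<close>
  define c where "c u = sweedler AH u (\<lambda>h g.
    (counit H h \<odot>\<^bsub>AH\<^esub> \<one>\<^bsub>AH\<^esub>) \<otimes>\<^bsub>AH\<^esub> pure_tensor k A H \<one>\<^bsub>A\<^esub> g)" for u
  note c_args = H_algebra H_algebra AH_algebra counit_unit_hom[OF AH_algebra]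
    algebra_hom_right[OF A_algebra H_algebra]
  have c_hom: "c \<in> algebra_homs k HH AH"
    unfolding c_def[abs_def] by (rule algebra_hom_lift[OF c_args])
  have counit_closed: "counit H h \<in> carrier k" if "h \<in> carrier H" for h
    using counit_ring_hom that by (rule ring_hom_closed)
  interpret AHa: algebra k AH by (rule AH_algebra)
  have c_pure: "c (pure_tensor k H H h g) = counit H h \<odot>\<^bsub>AH\<^esub> pure_tensor k A H \<one>\<^bsub>A\<^esub> g"
    if "h \<in> carrier H" "g \<in> carrier H" for h g
    using algebra_hom_lift_pure[OF c_args that] that
    by (simp add: c_def AHa.smult_assoc2 pure_closed counit_closed)
  define G where "G t = sweedler AH t (\<lambda>a u. pure_tensor k A H a \<one>\<^bsub>H\<^esub> \<otimes>\<^bsub>AH\<^esub> c u)" for t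
  note G_args = A_algebra HH_algebra AH_algebra algebra_hom_left[OF A_algebra H_algebra] c_hom
  have G_hom: "G \<in> algebra_homs k AHH AH"
    unfolding G_def[abs_def] by (rule algebra_hom_lift[OF G_args])
  have G_pure: "G (pure_tensor k A HH a u) = pure_tensor k A H a \<one>\<^bsub>H\<^esub> \<otimes>\<^bsub>AH\<^esub> c u"
    if "a \<in> carrier A" "u \<in> carrier HH" for a u
    using algebra_hom_lift_pure[OF G_args that] by (simp add: G_def)
  have c_comult: "c (comult H h) = pure_tensor k A H \<one>\<^bsub>A\<^esub> h" if h: "h \<in> carrier H" for h
  proof -
    have "c (comult H h) = sweedler AH (comult H h)
        (\<lambda>h1 h2. pure_tensor k A H \<one>\<^bsub>A\<^esub> (counit H h1 \<odot>\<^bsub>H\<^esub> h2))"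
      by (rule sweedler_eq_linear[OF H_module H_module AH_module algebra_homs_linear[OF c_hom]
            comult_closed[OF h], symmetric])
        (simp add: c_pure counit_closed
          linear_maps_smult[OF algebra_homs_linear[OF algebra_hom_right[OF A_algebra H_algebra]]])
    also have "\<dots> = pure_tensor k A H \<one>\<^bsub>A\<^esub>
        (sweedler H (comult H h) (\<lambda>h1 h2. counit H h1 \<odot>\<^bsub>H\<^esub> h2))"
    proof (rule sweedler_linear_comp[OF H_module H_module H_module
          algebra_homs_linear[OF algebra_hom_right[OF A_algebra H_algebra]] _
          comult_closed[OF h] AH_module, symmetric])
      show "(\<lambda>h1. (\<odot>\<^bsub>H\<^esub>) (counit H h1)) \<in> bilinear_maps k H H H"
        by (rule bilinear_mapsI linear_intros H_module counit_linear counit_closed | assumption)+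
    qed
    finally show ?thesis
      using counit_left[OF h] by simp
  qed
  have G_comult: "G (comult_map X) = X"
    by (rule algebra_hom_tensor_ext[OF A_algebra H_algebra AH_algebra
          algebra_homs_comp[OF comult_map_hom G_hom] algebra_homs_id _ _ Xc])
      (simp_all add: comult_map_pure G_pure c_comult algebra_homs_one[OF comult_hom]
        algebra_homs_one[OF c_hom] comult_closed pure_closed mult_pure)
  have G_face: "G (face_left s) = pure_tensor k A H (counit_map s) \<one>\<^bsub>H\<^esub>" if s: "s \<in> carrier AH" for s
    by (rule algebra_hom_tensor_ext[OF A_algebra H_algebra AH_algebra
          algebra_homs_comp[OF face_left_hom G_hom]
          algebra_homs_comp[OF counit_map_hom algebra_hom_left[OF A_algebra H_algebra]] _ _ s])
      (simp_all add: face_left_pure G_pure c_pure counit_map_pure pure_closed counit_closed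
        ring_hom_one[OF counit_ring_hom] algebra_homs_one[OF c_hom]
        smult_pure_tensor[OF A_module H_module, symmetric]
        flip: one_tensor[OF H_algebra H_algebra] one_tensor[OF A_algebra H_algebra])
  \<comment> \<open>On \<open>a \<otimes> 1\<close> this is counitality of \<rho>; on
    \<open>1 \<otimes> h\<close> it is \<epsilon>(1) = 1.\<close>
  have G_coact: "G (coact_map X) = X"
  proof (rule algebra_hom_tensor_ext[OF A_algebra H_algebra AH_algebra
          algebra_homs_comp[OF coact_map_hom G_hom] algebra_homs_id _ _ Xc])
    fix a
    assume a: "a \<in> carrier A"
    show "G (coact_map (pure_tensor k A H a \<one>\<^bsub>H\<^esub>)) = pure_tensor k A H a \<one>\<^bsub>H\<^esub>"
      using a by (simp add: coact_map_left G_face coaction_closed counit_map_coaction)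
  next
    fix h
    assume h: "h \<in> carrier H"
    have "coact_map (pure_tensor k A H \<one>\<^bsub>A\<^esub> h) = pure_tensor k A HH \<one>\<^bsub>A\<^esub> (pure_tensor k H H \<one>\<^bsub>H\<^esub> h)"
      using h by (simp add: coact_map_pure pure_closed algebra_homs_one[OF coaction_hom]
          algebra_homs_one[OF face_left_hom])
    then show "G (coact_map (pure_tensor k A H \<one>\<^bsub>A\<^esub> h)) = pure_tensor k A H \<one>\<^bsub>A\<^esub> h"
      using h by (simp add: G_pure c_pure pure_closed mult_pure ring_hom_one[OF counit_ring_hom])
  qed
  let ?e = "pure_tensor k A H (counit_map X) \<one>\<^bsub>H\<^esub>"
  have e_closed: "counit_map X \<in> carrier A" "?e \<in> carrier AH"
    using algebra_homs_closed[OF counit_map_hom Xc] by (auto intro: pure_closed)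
  have "X = ?e \<otimes>\<^bsub>AH\<^esub> X"
    using arg_cong[OF coc[unfolded cocycle_eq_def], of G]
    by (simp add: G_comult G_face G_coact Xc algebra_homs_mult[OF G_hom]
        algebra_homs_closed[OF face_left_hom] algebra_homs_closed[OF coact_map_hom])
  then have "X \<otimes>\<^bsub>AH\<^esub> inv\<^bsub>AH\<^esub> X = ?e \<otimes>\<^bsub>AH\<^esub> X \<otimes>\<^bsub>AH\<^esub> inv\<^bsub>AH\<^esub> X"
    by simp
  then have "\<one>\<^bsub>AH\<^esub> = ?e"
    using X Xc e_closed by (simp add: AH.m_assoc)
  \<comment> \<open>Since \<epsilon>(1) = 1, \<open>counit_map\<close> is a left inverse of
    \<open>a \<mapsto> a \<otimes> 1\<close> and recovers \<open>counit_map X\<close> from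
    \<open>?e\<close>.\<close>
  then have "counit_map \<one>\<^bsub>AH\<^esub> = counit_map ?e"
    by simp
  then show ?thesis
    using e_closed
    by (simp add: algebra_homs_one[OF counit_map_hom] counit_map_pure ring_hom_one[OF counit_ring_hom])
qed

text \<open>Both sides of the equation are multiplicative in \<open>X\<close>, being built from
  algebra homomorphisms into a commutative ring.\<close>

lemma cocycle_eq_mult:
  assumes "X \<in> carrier AH" "Y \<in> carrier AH" "cocycle_eq X" "cocycle_eq Y"
  shows "cocycle_eq (X \<otimes>\<^bsub>AH\<^esub> Y)"
proof -
  interpret AHH: cring AHH by (rule AHH_cring)
  show ?thesis
    using assms unfolding cocycle_eq_def
    by (simp add: algebra_homs_mult[OF comult_map_hom] algebra_homs_mult[OF face_left_hom]
        algebra_homs_mult[OF coact_map_hom] algebra_homs_closed[OF comult_map_hom]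
        algebra_homs_closed[OF face_left_hom] algebra_homs_closed[OF coact_map_hom] AHH.m_ac)
qed

lemma cocycle_eq_one: "cocycle_eq \<one>\<^bsub>AH\<^esub>"
proof -
  interpret AHH: cring AHH by (rule AHH_cring)
  show ?thesis
    unfolding cocycle_eq_def
    by (simp add: algebra_homs_one[OF comult_map_hom] algebra_homs_one[OF face_left_hom]
        algebra_homs_one[OF coact_map_hom])
qed

text \<open>Multiplicativity again, with the unit \<open>comult_map X\<close> cancelled. For
  \<open>Y\<close> the inverse of \<open>X\<close> this shows that cocycles are closed under
  inverses.\<close>

lemma cocycle_eq_cancel:
  assumes X: "X \<in> Units AH" and Y: "Y \<in> carrier AH"
    and coc: "cocycle_eq X" "cocycle_eq (X \<otimes>\<^bsub>AH\<^esub> Y)"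
  shows "cocycle_eq Y"
proof -
  interpret AH: cring AH by (rule AH_cring)
  interpret AHH: cring AHH by (rule AHH_cring)
  have Xc: "X \<in> carrier AH"
    using X by auto
  note closed = algebra_homs_closed[OF comult_map_hom] algebra_homs_closed[OF face_left_hom]
    algebra_homs_closed[OF coact_map_hom]
  have unit: "comult_map X \<in> Units AHH"
    by (rule algebra_homs_Units[OF comult_map_hom X])
  have "comult_map X \<otimes>\<^bsub>AHH\<^esub> comult_map Y = comult_map (X \<otimes>\<^bsub>AH\<^esub> Y)"
    by (simp add: algebra_homs_mult[OF comult_map_hom] Xc Y)
  also have "\<dots> = face_left X \<otimes>\<^bsub>AHH\<^esub> coact_map X \<otimes>\<^bsub>AHH\<^esub> (face_left Y \<otimes>\<^bsub>AHH\<^esub> coact_map Y)"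
    using coc(2) Xc Y unfolding cocycle_eq_def
    by (simp add: algebra_homs_mult[OF face_left_hom] algebra_homs_mult[OF coact_map_hom] closed
        AHH.m_ac)
  also have "\<dots> = comult_map X \<otimes>\<^bsub>AHH\<^esub> (face_left Y \<otimes>\<^bsub>AHH\<^esub> coact_map Y)"
    using coc(1) by (simp add: cocycle_eq_def)
  finally show ?thesis
    using unit Y by (simp add: cocycle_eq_def closed AHH.Units_l_cancel)
qed

lemma harrison_coboundaries_eq:
  "harrison_coboundaries k H A =
    {pure_tensor k A H (inv\<^bsub>A\<^esub> u) \<one>\<^bsub>H\<^esub> \<otimes>\<^bsub>AH\<^esub> coact A u |u. u \<in> Units A}"
proof -
  have "sweedler AH (coact A u) (\<lambda>a0 a1. pure_tensor k A H (inv\<^bsub>A\<^esub> u \<otimes>\<^bsub>A\<^esub> a0) a1)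
    = pure_tensor k A H (inv\<^bsub>A\<^esub> u) \<one>\<^bsub>H\<^esub> \<otimes>\<^bsub>AH\<^esub> coact A u" if u: "u \<in> Units A" for u
  proof -
    have "u \<in> carrier A" "inv\<^bsub>A\<^esub> u \<in> carrier A"
      using u monoid.Units_closed monoid.Units_inv_closed comm_monoid.axioms(1) cring.axioms(2)
        A_cring by blast+
    then show ?thesis
      by (intro sweedler_eq_linear[OF A_module H_module AH_module
            mult_linear_right[OF AH_algebra linear_maps_id]])
        (simp_all add: pure_closed coaction_closed mult_pure)
  qed
  then show ?thesis
    unfolding harrison_coboundaries_def by (simp cong: rev_conj_cong)
qed

text \<open>With \<open>v\<close> the inverse of \<open>u\<close>, the right-hand side is \<open>(v
  \<otimes> 1 \<otimes> 1) (\<rho> u \<otimes> 1) (\<rho> v \<otimes> 1) (\<rho> \<otimes>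
  id)(\<rho> u)\<close>. The middle factors cancel, and coassociativity of \<rho> turns the last one
  into \<open>(id \<otimes> \<Delta>)(\<rho> u)\<close>.\<close>

lemma cocycle_eq_coboundary:
  assumes u: "u \<in> Units A"
  shows "cocycle_eq (pure_tensor k A H (inv\<^bsub>A\<^esub> u) \<one>\<^bsub>H\<^esub> \<otimes>\<^bsub>AH\<^esub> coact A u)"
proof -
  interpret AHH: cring AHH by (rule AHH_cring)
  note monoid_A = comm_monoid.axioms(1)[OF cring.axioms(2)[OF A_cring]]
  define v where "v = inv\<^bsub>A\<^esub> u"
  have uv: "u \<in> carrier A" "v \<in> carrier A" "u \<otimes>\<^bsub>A\<^esub> v = \<one>\<^bsub>A\<^esub>"
    using u by (auto simp: v_def monoid.Units_r_inv[OF monoid_A] monoid.Units_inv_closed[OF monoid_A]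
        monoid.Units_closed[OF monoid_A])
  let ?e = "pure_tensor k A H v \<one>\<^bsub>H\<^esub>"
  have e: "?e \<in> carrier AH" "comult_map ?e = face_left ?e" "coact_map ?e = face_left (coact A v)"
    using uv by (simp_all add: pure_closed comult_map_pure face_left_pure coact_map_left
        algebra_homs_one[OF comult_hom] one_tensor[OF H_algebra H_algebra])
  note closed = algebra_homs_closed[OF comult_map_hom] algebra_homs_closed[OF face_left_hom]
    algebra_homs_closed[OF coact_map_hom] coaction_closed
  have "face_left (coact A u) \<otimes>\<^bsub>AHH\<^esub> face_left (coact A v) = \<one>\<^bsub>AHH\<^esub>"
    using uv by (simp add: coaction_closed algebra_homs_one[OF coaction_hom]
        algebra_homs_one[OF face_left_hom]
        flip: algebra_homs_mult[OF face_left_hom] algebra_homs_mult[OF coaction_hom])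
  then have "face_left (coact A u) \<otimes>\<^bsub>AHH\<^esub> (face_left (coact A v) \<otimes>\<^bsub>AHH\<^esub> t) = t"
    if "t \<in> carrier AHH" for t
    using that uv by (simp add: closed flip: AHH.m_assoc)
  then show ?thesis
    using uv e unfolding v_def[symmetric] cocycle_eq_def
    by (simp add: algebra_homs_mult[OF comult_map_hom] algebra_homs_mult[OF face_left_hom]
        algebra_homs_mult[OF coact_map_hom] closed coact_map_coaction[symmetric] AHH.m_assoc)
qed

end

section \<open>Hopf modules that are free of rank one\<close>

text \<open>Needed because \<open>restrict_scalars A (hopf_unit A)\<close> and \<open>A\<close> are
  different records whose scalar actions agree only on the carrier. Their relators coincide, and
  hence so do the tensor products as sets.\<close>

lemma carrier_tensor_cong:
  assumes "carrier M' = carrier M" "add M' = add M"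
    and "\<And>r m. r \<in> carrier R \<Longrightarrow> m \<in> carrier M \<Longrightarrow> r \<odot>\<^bsub>M'\<^esub> m = r \<odot>\<^bsub>M\<^esub> m"
  shows "carrier (tensor R M' N) = carrier (tensor R M N)"
proof -
  have "tensor_relators R M' N = tensor_relators R M N"
    unfolding tensor_relators_def assms(1,2) using assms(3)
    by (intro arg_cong2[of _ _ _ _ "(\<union>)"] refl Collect_cong ex_cong1) auto
  then show ?thesis
    by (simp add: carrier_tensor tensor_group_def tensor_relations_def assms(1))
qed

lemma regular_module_simps [simp]:
  "carrier (regular_module R) = carrier R" "add (regular_module R) = add R"
  "\<zero>\<^bsub>regular_module R\<^esub> = \<zero>\<^bsub>R\<^esub>" "a \<odot>\<^bsub>regular_module R\<^esub> b = a \<otimes>\<^bsub>R\<^esub> b"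
  by (simp_all add: regular_module_def)

lemma restrict_scalars_simps [simp]:
  "carrier (restrict_scalars A M) = carrier M" "add (restrict_scalars A M) = add M"
  "\<zero>\<^bsub>restrict_scalars A M\<^esub> = \<zero>\<^bsub>M\<^esub>"
  "c \<odot>\<^bsub>restrict_scalars A M\<^esub> m = (c \<odot>\<^bsub>A\<^esub> \<one>\<^bsub>A\<^esub>) \<odot>\<^bsub>M\<^esub> m"
  by (simp_all add: restrict_scalars_def)

lemma with_coact_simps [simp]:
  "carrier (with_coact M \<rho>) = carrier M" "add (with_coact M \<rho>) = add M"
  "\<zero>\<^bsub>with_coact M \<rho>\<^esub> = \<zero>\<^bsub>M\<^esub>" "a \<odot>\<^bsub>with_coact M \<rho>\<^esub> m = a \<odot>\<^bsub>M\<^esub> m"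
  "coact (with_coact M \<rho>) = \<rho>"
  by (simp_all add: with_coact_def)

lemma module_cong:
  assumes "module R M" "carrier M' = carrier M" "add M' = add M" "\<zero>\<^bsub>M'\<^esub> = \<zero>\<^bsub>M\<^esub>"
    and "\<And>r m. r \<in> carrier R \<Longrightarrow> m \<in> carrier M \<Longrightarrow> r \<odot>\<^bsub>M'\<^esub> m = r \<odot>\<^bsub>M\<^esub> m"
  shows "module R M'"
proof -
  interpret M: module R M by fact
  have "abelian_group M'"
    by (rule abelian_groupI) (auto simp: assms(2-4) M.a_ac intro: M.l_neg)
  then show ?thesis
    by (intro moduleI M.R.is_cring)
      (simp_all add: assms(2-5) M.smult_l_distr M.smult_r_distr M.smult_assoc1)
qed

lemma regular_module_module:
  assumes "cring R"
  shows "module R (regular_module R)"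
proof -
  interpret cring R by fact
  have "abelian_group (regular_module R)"
    by (rule abelian_groupI) (auto simp: a_ac intro: l_neg)
  then show ?thesis
    by (intro moduleI assms) (simp_all add: l_distr r_distr m_assoc)
qed

text \<open>If \<open>f e = 1\<close> then \<open>m = f(m) e\<close> for every \<open>m\<close>, so
  \<open>m \<otimes> n = e \<otimes> f(m) n\<close> and \<open>n \<mapsto> e \<otimes> n\<close> is
  inverse to \<open>h\<close>.\<close>

lemma tensor_rank_one:
  assumes M: "module R M" and N: "module R N"
    and f: "f \<in> linear_maps R M (regular_module R)" and bij: "bij_betw f (carrier M) (carrier R)"
  obtains h where "h \<in> linear_maps R (tensor R M N) N" "bij_betw h (carrier (tensor R M N)) (carrier N)"
    "\<And>m n. m \<in> carrier M \<Longrightarrow> n \<in> carrier N \<Longrightarrow> h (pure_tensor R M N m n) = f m \<odot>\<^bsub>N\<^esub> n"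
proof
  interpret M: module R M by (fact M)
  interpret N: module R N by (fact N)
  have f_closed: "f m \<in> carrier R" if "m \<in> carrier M" for m
    using linear_maps_closed[OF f that] by simp
  let ?h = "\<lambda>t. sweedler N t (\<lambda>m n. f m \<odot>\<^bsub>N\<^esub> n)"
  have bil: "(\<lambda>m n. f m \<odot>\<^bsub>N\<^esub> n) \<in> bilinear_maps R M N N"
    by (intro bilinear_mapsI linear_maps_regular_smult linear_maps_smult_const N f f_closed)
  show h: "?h \<in> linear_maps R (tensor R M N) N"
    by (rule sweedler_linear[OF M N N bil])
  show pure: "?h (pure_tensor R M N m n) = f m \<odot>\<^bsub>N\<^esub> n" if "m \<in> carrier M" "n \<in> carrier N" for m n
    using that by (rule sweedler_pure_bilinear[OF M N N bil])
  obtain e where e: "e \<in> carrier M" "f e = \<one>\<^bsub>R\<^esub>"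
    using bij M.R.one_closed unfolding bij_betw_def by (metis imageE)
  have f_e: "f m \<odot>\<^bsub>M\<^esub> e = m" if m: "m \<in> carrier M" for m
  proof -
    have "f (f m \<odot>\<^bsub>M\<^esub> e) = f m"
      using linear_maps_smult[OF f, of "f m" e] f_closed[OF m] e by simp
    then show ?thesis
      using m e f_closed inj_on_eq_iff[OF bij_betw_imp_inj_on[OF bij], of "f m \<odot>\<^bsub>M\<^esub> e" m] by auto
  qed
  have \<psi>: "(\<lambda>n. pure_tensor R M N e n) \<in> linear_maps R N (tensor R M N)"
    by (rule pure_tensor_linear_right[OF M N linear_maps_id e(1)])
  show "bij_betw ?h (carrier (tensor R M N)) (carrier N)"
  proof (rule bij_betwI[of _ _ _ "pure_tensor R M N e"])
    show "?h \<in> carrier (tensor R M N) \<rightarrow> carrier N"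
      "pure_tensor R M N e \<in> carrier N \<rightarrow> carrier (tensor R M N)"
      using linear_maps_closed[OF h] linear_maps_closed[OF \<psi>] by auto
    show "?h (pure_tensor R M N e n) = n" if "n \<in> carrier N" for n
      using that e by (simp add: pure)
    show "pure_tensor R M N e (?h t) = t" if "t \<in> carrier (tensor R M N)" for t
      by (rule tensor_ext[OF M N linear_maps_comp[OF h \<psi>] linear_maps_id _ that])
        (use e in \<open>simp add: pure f_e f_closed flip: pure_tensor_balanced[OF M N]\<close>)
  qed
qed

lemma module_isomorphic_iff:
  assumes "module R M"
  shows "module_isomorphic R M N \<longleftrightarrow> (\<exists>f\<in>linear_maps R M N. bij_betw f (carrier M) (carrier N))"
proof
  assume "module_isomorphic R M N"
  then obtain f g where "f \<in> linear_maps R M N" "g \<in> linear_maps R N M"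
    "\<forall>m\<in>carrier M. g (f m) = m" "\<forall>n\<in>carrier N. f (g n) = n"
    by (auto simp: module_isomorphic_def)
  then have "bij_betw f (carrier M) (carrier N)"
    by (intro bij_betwI[of _ _ _ g]) (auto simp: linear_maps_closed)
  with \<open>f \<in> linear_maps R M N\<close> show "\<exists>f\<in>linear_maps R M N. bij_betw f (carrier M) (carrier N)"
    by blast
next
  assume "\<exists>f\<in>linear_maps R M N. bij_betw f (carrier M) (carrier N)"
  then obtain f where f: "f \<in> linear_maps R M N" "bij_betw f (carrier M) (carrier N)"
    by blast
  have "inv_into (carrier M) f \<in> linear_maps R N M"
    by (rule linear_maps_inv_into[OF f assms])
  with f show "module_isomorphic R M N"
    unfolding module_isomorphic_def
    by (intro bexI[of _ f] bexI[of _ "inv_into (carrier M) f"])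
      (auto simp: bij_betw_def f_inv_into_f)
qed

lemma module_isomorphic_sym: "module_isomorphic R M N \<Longrightarrow> module_isomorphic R N M"
  by (auto simp: module_isomorphic_def)

lemma module_isomorphic_trans:
  "module_isomorphic R M N \<Longrightarrow> module_isomorphic R N P \<Longrightarrow> module_isomorphic R M P"
  unfolding module_isomorphic_def
  by (elim bexE conjE, intro bexI conjI ballI; (rule linear_maps_comp)?; assumption?)
    (simp_all add: linear_maps_closed)

lemma module_class_eqI: "module_isomorphic R M N \<Longrightarrow> module_class R M = module_class R N"
  unfolding module_class_def by (blast intro: module_isomorphic_trans module_isomorphic_sym)

section \<open>Coordinates \<open>f \<otimes> id\<close> of M \<otimes> H in A \<otimes> H, for a
  linear map \<open>f\<close> from M to A\<close>

context comm_comodule_algebra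
begin

abbreviation "MH M \<equiv> tensor k (restrict_scalars A M) H"
abbreviation "coord M \<equiv> tensor_map k (restrict_scalars A M) A H"

lemma A_comm: "a \<in> carrier A \<Longrightarrow> b \<in> carrier A \<Longrightarrow> a \<otimes>\<^bsub>A\<^esub> b = b \<otimes>\<^bsub>A\<^esub> a"
  by (rule comm_monoid.m_comm[OF cring.axioms(2)[OF A_cring]])

lemma scalar_hom: "(\<lambda>c. c \<odot>\<^bsub>A\<^esub> \<one>\<^bsub>A\<^esub>) \<in> ring_hom k A"
  by (rule ring_hom_memI)
    (simp_all add: module.smult_l_distr[OF A_module] module.smult_assoc1[OF A_module]
      module.smult_one[OF A_module] algebra.smult_assoc2[OF A_algebra])

context
  fixes M :: "('a, 'm, 'v) module_scheme"
  assumes M: "module A M"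
begin

interpretation M: module A M by (fact M)

lemma restrict_scalars_module: "module k (restrict_scalars A M)"
proof (rule moduleI)
  show "abelian_group (restrict_scalars A M)"
    by (rule abelian_groupI) (auto simp: M.a_ac intro: M.l_neg)
  show "cring k"
    by (rule module.axioms(1)[OF A_module])
qed (auto simp: ring_hom_closed[OF scalar_hom] ring_hom_add[OF scalar_hom] ring_hom_mult[OF scalar_hom]
    ring_hom_one[OF scalar_hom] M.smult_l_distr M.smult_r_distr M.smult_assoc1)

lemma restrict_scalars_linear:
  assumes "f \<in> linear_maps A M N"
  shows "f \<in> linear_maps k (restrict_scalars A M) (restrict_scalars A N)"
  using assms by (auto simp: linear_maps_def ring_hom_closed[OF scalar_hom])

text \<open>The target is the \<open>k\<close>-module \<open>A\<close> itself, so that coordinates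
  take values in the same A \<otimes> H as the coaction of \<open>A\<close>.\<close>

lemma restrict_scalars_linear_regular:
  assumes "f \<in> linear_maps A M (regular_module A)"
  shows "f \<in> linear_maps k (restrict_scalars A M) A"
  using assms algebra.smult_assoc2[OF A_algebra]
  by (auto simp: linear_maps_def ring_hom_closed[OF scalar_hom] Pi_def)

lemma restrict_scalars_smult_linear_left [linear_intros]:
  "m \<in> carrier M \<Longrightarrow> (\<lambda>a. a \<odot>\<^bsub>M\<^esub> m) \<in> linear_maps k A (restrict_scalars A M)"
  using algebra.smult_assoc2[OF A_algebra, of _ "\<one>\<^bsub>A\<^esub>"]
  by (intro linear_mapsI) (auto simp: M.smult_l_distr ring_hom_closed[OF scalar_hom]
      simp flip: M.smult_assoc1)

lemma restrict_scalars_smult_linear_right [linear_intros]: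
  "a \<in> carrier A \<Longrightarrow>
    (\<lambda>m. a \<odot>\<^bsub>M\<^esub> m) \<in> linear_maps k (restrict_scalars A M) (restrict_scalars A M)"
  by (intro linear_mapsI)
    (auto simp: M.smult_r_distr ring_hom_closed[OF scalar_hom] A_comm simp flip: M.smult_assoc1)

lemma MH_module: "module k (MH M)"
  by (rule tensor_module[OF restrict_scalars_module H_module])

lemma coaction_smult_bilinear:
  assumes "m \<in> carrier M" "h \<in> carrier H"
  shows "(\<lambda>a0 a1. pure_tensor k (restrict_scalars A M) H (a0 \<odot>\<^bsub>M\<^esub> m) (h \<otimes>\<^bsub>H\<^esub> a1))
    \<in> bilinear_maps k A H (MH M)"
  using assms by - (rule bilinear_mapsI linear_intros restrict_scalars_module H_module H_algebra
      | assumption | simp)+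

lemma coaction_smult_bilinear_outer:
  assumes "a \<in> carrier A"
  shows "(\<lambda>m0 m1. sweedler (MH M) (coact A a) (\<lambda>a0 a1.
      pure_tensor k (restrict_scalars A M) H (a0 \<odot>\<^bsub>M\<^esub> m0) (m1 \<otimes>\<^bsub>H\<^esub> a1)))
    \<in> bilinear_maps k (restrict_scalars A M) H (MH M)"
  using coaction_closed[OF assms] by - (rule bilinear_mapsI coaction_smult_bilinear linear_intros restrict_scalars_module
      H_module A_module MH_module H_algebra | assumption | simp)+

context
  fixes f
  assumes f: "f \<in> linear_maps A M (regular_module A)"
begin

lemmas coord_linear = tensor_map_linear[OF restrict_scalars_module H_module A_module
    restrict_scalars_linear_regular[OF f]]
lemmas coord_pure = tensor_map_pure[OF restrict_scalars_module H_module A_module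
    restrict_scalars_linear_regular[OF f]]

lemma coord_closed: "t \<in> carrier (MH M) \<Longrightarrow> coord M f t \<in> carrier AH"
  by (rule linear_maps_closed[OF coord_linear])

lemma regular_map_closed: "m \<in> carrier M \<Longrightarrow> f m \<in> carrier A"
  using linear_maps_closed[OF f] by simp

text \<open>On pure tensors this is
  \<open>f(a0 m) \<otimes> h a1 = (f m \<otimes> h) (a0 \<otimes> a1)\<close>. It turns the
  compatibility axiom of a Hopf module into multiplication by \<open>\<rho> a\<close>.\<close>

lemma coord_coaction_smult:
  assumes t: "t \<in> carrier (MH M)" and a: "a \<in> carrier A"
  shows "coord M f (sweedler (MH M) t (\<lambda>m0 m1. sweedler (MH M) (coact A a) (\<lambda>a0 a1.
      pure_tensor k (restrict_scalars A M) H (a0 \<odot>\<^bsub>M\<^esub> m0) (m1 \<otimes>\<^bsub>H\<^esub> a1)))) =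
    coord M f t \<otimes>\<^bsub>AH\<^esub> coact A a"
proof -
  note RM = restrict_scalars_module
  have "coord M f (sweedler (MH M) t (\<lambda>m0 m1. sweedler (MH M) (coact A a) (\<lambda>a0 a1.
      pure_tensor k (restrict_scalars A M) H (a0 \<odot>\<^bsub>M\<^esub> m0) (m1 \<otimes>\<^bsub>H\<^esub> a1))))
    = sweedler AH t (\<lambda>m0 m1. coord M f (sweedler (MH M) (coact A a) (\<lambda>a0 a1.
      pure_tensor k (restrict_scalars A M) H (a0 \<odot>\<^bsub>M\<^esub> m0) (m1 \<otimes>\<^bsub>H\<^esub> a1))))"
    by (rule sweedler_linear_comp[OF RM H_module MH_module coord_linear
          coaction_smult_bilinear_outer[OF a] t AH_module])
  also have "\<dots> = coord M f t \<otimes>\<^bsub>AH\<^esub> coact A a"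
  proof (rule sweedler_eq_linear[OF RM H_module AH_module
        mult_linear_left[OF AH_algebra coord_linear coaction_closed[OF a]] t])
    fix m h
    assume "m \<in> carrier (restrict_scalars A M)" and h: "h \<in> carrier H"
    then have m: "m \<in> carrier M"
      by simp
    have "coord M f (sweedler (MH M) (coact A a) (\<lambda>a0 a1.
        pure_tensor k (restrict_scalars A M) H (a0 \<odot>\<^bsub>M\<^esub> m) (h \<otimes>\<^bsub>H\<^esub> a1)))
      = sweedler AH (coact A a) (\<lambda>a0 a1. coord M f
        (pure_tensor k (restrict_scalars A M) H (a0 \<odot>\<^bsub>M\<^esub> m) (h \<otimes>\<^bsub>H\<^esub> a1)))"
      by (rule sweedler_linear_comp[OF A_module H_module MH_module coord_linear
            coaction_smult_bilinear[OF m h] coaction_closed[OF a] AH_module])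
    also have "\<dots> = pure_tensor k A H (f m) h \<otimes>\<^bsub>AH\<^esub> coact A a"
      by (rule sweedler_eq_linear[OF A_module H_module AH_module
            mult_linear_right[OF AH_algebra linear_maps_id] coaction_closed[OF a]])
        (use m h linear_maps_smult[OF f] A_comm in \<open>auto simp: coord_pure mult_pure regular_map_closed pure_closed\<close>)
    finally show "coord M f (sweedler (MH M) (coact A a) (\<lambda>a0 a1.
        pure_tensor k (restrict_scalars A M) H (a0 \<odot>\<^bsub>M\<^esub> m) (h \<otimes>\<^bsub>H\<^esub> a1)))
      = coord M f (pure_tensor k (restrict_scalars A M) H m h) \<otimes>\<^bsub>AH\<^esub> coact A a"
      using m h by (simp add: coord_pure)
  qed
  finally show ?thesis .
qed

end

end

text \<open>In the coordinate \<open>f\<close>, the coaction of \<open>M\<close> is \<open>a \<mapsto> X \<rho>(a)\<close>.\<close>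

definition free_twist where
  "free_twist X M f \<longleftrightarrow> X \<in> carrier AH \<and> module A M \<and> f \<in> linear_maps A M (regular_module A) \<and>
    bij_betw f (carrier M) (carrier A) \<and>
    (\<forall>m\<in>carrier M. coact M m \<in> carrier (tensor k (restrict_scalars A M) H) \<and>
      tensor_map k (restrict_scalars A M) A H f (coact M m) = X \<otimes>\<^bsub>AH\<^esub> coact A (f m))"

context
  fixes M :: "('a, 'm, 'h, 'v) comodule_scheme" and f X
  assumes tw: "free_twist X M f"
begin

private abbreviation (input) "RM \<equiv> restrict_scalars A M"

lemma free_twistD:
  shows free_twist_closed: "X \<in> carrier AH" and free_twist_module: "module A M"
    and free_twist_linear: "f \<in> linear_maps A M (regular_module A)"
    and free_twist_bij: "bij_betw f (carrier M) (carrier A)"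
    and free_twist_coact_closed: "m \<in> carrier M \<Longrightarrow> coact M m \<in> carrier (tensor k RM H)"
    and free_twist_coact: "m \<in> carrier M \<Longrightarrow>
      tensor_map k RM A H f (coact M m) = X \<otimes>\<^bsub>AH\<^esub> coact A (f m)"
  using tw by (auto simp: free_twist_def)

lemmas free_twist_restrict_module = restrict_scalars_module[OF free_twist_module]
lemmas free_twist_linear_k = restrict_scalars_linear_regular[OF free_twist_module free_twist_linear]
lemmas free_twist_coord_linear = coord_linear[OF free_twist_module free_twist_linear]
lemmas free_twist_coord_pure = coord_pure[OF free_twist_module free_twist_linear]
lemmas free_twist_f_closed = regular_map_closed[OF free_twist_module free_twist_linear]

lemma free_twist_coord_bij: "bij_betw (coord M f) (carrier (MH M)) (carrier AH)"
  using free_twist_bij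
  by (intro tensor_map_bij_betw free_twist_restrict_module A_module H_module free_twist_linear_k) simp

lemma coord_cancel:
  "s \<in> carrier (MH M) \<Longrightarrow> t \<in> carrier (MH M) \<Longrightarrow> coord M f s = coord M f t \<longleftrightarrow> s = t"
  using bij_betw_imp_inj_on[OF free_twist_coord_bij] by (rule inj_on_eq_iff)

text \<open>The coordinate map is bijective, so the coaction is the composite of linear maps
  \<open>m \<mapsto> X \<rho>(f m)\<close> followed by the inverse coordinate map.\<close>

lemma free_twist_coact_linear: "coact M \<in> linear_maps k RM (MH M)"
proof (rule linear_maps_cong)
  let ?g = "inv_into (carrier (MH M)) (coord M f)"
  have g: "?g \<in> linear_maps k AH (MH M)"
    by (rule linear_maps_inv_into[OF free_twist_coord_linear free_twist_coord_bij
          MH_module[OF free_twist_module]])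
  show "(\<lambda>m. ?g (X \<otimes>\<^bsub>AH\<^esub> coact A (f m))) \<in> linear_maps k RM (MH M)"
    by (intro linear_maps_comp[OF _ g] mult_linear_right AH_algebra free_twist_closed
        linear_maps_comp[OF free_twist_linear_k coaction_linear])
  show "coact M m = ?g (X \<otimes>\<^bsub>AH\<^esub> coact A (f m))" if "m \<in> carrier RM" for m
    using that bij_betw_imp_inj_on[OF free_twist_coord_bij]
    by (simp add: free_twist_coact_closed flip: free_twist_coact)
qed (rule free_twist_restrict_module)

lemma free_twist_ex: "a \<in> carrier A \<Longrightarrow> \<exists>m\<in>carrier M. f m = a"
  using free_twist_bij unfolding bij_betw_def by (metis imageE)

text \<open>In the coordinate \<open>f \<otimes> id \<otimes> id\<close>, which is injective, the
  two sides at \<open>m\<close> are \<open>(X \<otimes> 1) (\<rho> \<otimes> id)(X) Z\<close> and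
  \<open>(id \<otimes> \<Delta>)(X) Z\<close>, where
  \<open>Z = (\<rho> \<otimes> id)(\<rho>(f m))\<close> by coassociativity of \<open>A\<close>. For
  \<open>f m = 1\<close> the common factor is 1.\<close>

lemma free_twist_coassociative: "coassociative k H RM (coact M) \<longleftrightarrow> cocycle_eq X"
proof -
  interpret AHH: cring AHH by (rule AHH_cring)
  let ?T = "tensor k RM HH"
  let ?F = "tensor_map k RM A HH f"
  note mods = free_twist_restrict_module H_module HH_module A_module AH_module AHH_module
    tensor_module[OF free_twist_restrict_module H_module] tensor_module[OF free_twist_restrict_module HH_module]
  have F_lin: "?F \<in> linear_maps k ?T AHH"
    by (intro tensor_map_linear mods free_twist_linear_k)
  have F_pure: "?F (pure_tensor k RM HH m u) = pure_tensor k A HH (f m) u"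
    if "m \<in> carrier M" "u \<in> carrier HH" for m u
    using that by (intro tensor_map_pure mods free_twist_linear_k) simp
  have F_bij: "bij_betw ?F (carrier ?T) (carrier AHH)"
    using free_twist_bij by (intro tensor_map_bij_betw mods free_twist_linear_k) simp
  let ?i = "\<lambda>h. pure_tensor k A HH \<one>\<^bsub>A\<^esub> (pure_tensor k H H \<one>\<^bsub>H\<^esub> h)"
  have bil: "(\<lambda>m00 m01. pure_tensor k RM HH m00 (pure_tensor k H H m01 h)) \<in> bilinear_maps k RM H ?T"
    if "h \<in> carrier H" for h
    using that by - (rule bilinear_mapsI linear_intros mods pure_closed | assumption)+
  have inner: "?F (sweedler ?T s (\<lambda>m00 m01. pure_tensor k RM HH m00 (pure_tensor k H H m01 h)))
      = face_left (coord M f s) \<otimes>\<^bsub>AHH\<^esub> ?i h"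
    if s: "s \<in> carrier (MH M)" and h: "h \<in> carrier H" for s h
  proof -
    have "?F (sweedler ?T s (\<lambda>m00 m01. pure_tensor k RM HH m00 (pure_tensor k H H m01 h)))
        = sweedler AHH s (\<lambda>m00 m01. ?F (pure_tensor k RM HH m00 (pure_tensor k H H m01 h)))"
      by (rule sweedler_linear_comp[OF mods(1,2,8) F_lin bil[OF h] s mods(6)])
    also have "\<dots> = face_left (coord M f s) \<otimes>\<^bsub>AHH\<^esub> ?i h"
      by (rule sweedler_eq_linear[OF mods(1,2,6) mult_linear_left[OF AHH_algebra
              linear_maps_comp[OF free_twist_coord_linear algebra_homs_linear[OF face_left_hom]]] s])
        (use h in \<open>simp_all add: pure_closed F_pure free_twist_coord_pure face_left_mult_pure
            free_twist_f_closed\<close>)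
    finally show ?thesis .
  qed
  have bil1: "(\<lambda>m0 m1. sweedler ?T (coact M m0)
      (\<lambda>m00 m01. pure_tensor k RM HH m00 (pure_tensor k H H m01 m1))) \<in> bilinear_maps k RM H ?T"
    by (rule bilinear_mapsI free_twist_coact_linear linear_maps_closed[OF free_twist_coact_linear]
        bil linear_intros mods pure_closed | assumption)+
  have bil2: "(\<lambda>m0 m1. pure_tensor k RM HH m0 (comult H m1)) \<in> bilinear_maps k RM H ?T"
    by (rule bilinear_mapsI comult_linear comult_closed linear_intros mods | assumption)+
  let ?L = "\<lambda>m. sweedler ?T (coact M m) (\<lambda>m0 m1. sweedler ?T (coact M m0)
    (\<lambda>m00 m01. pure_tensor k RM HH m00 (pure_tensor k H H m01 m1)))"
  let ?R = "\<lambda>m. sweedler ?T (coact M m) (\<lambda>m0 m1. pure_tensor k RM HH m0 (comult H m1))"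
  note closed = algebra_homs_closed[OF face_left_hom] algebra_homs_closed[OF coact_map_hom]
    algebra_homs_closed[OF comult_map_hom] coaction_closed free_twist_f_closed free_twist_closed
  have L: "?F (?L m) = face_left X \<otimes>\<^bsub>AHH\<^esub> coact_map X \<otimes>\<^bsub>AHH\<^esub> coact_map (coact A (f m))"
    if m: "m \<in> carrier M" for m
  proof -
    have "?F (?L m) = sweedler AHH (coact M m) (\<lambda>m0 m1. ?F (sweedler ?T (coact M m0)
      (\<lambda>m00 m01. pure_tensor k RM HH m00 (pure_tensor k H H m01 m1))))"
      by (rule sweedler_linear_comp[OF mods(1,2,8) F_lin bil1 free_twist_coact_closed[OF m] mods(6)])
    also have "\<dots> = face_left X \<otimes>\<^bsub>AHH\<^esub> coact_map (coord M f (coact M m))"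
    proof (rule sweedler_eq_linear[OF mods(1,2,6) mult_linear_right[OF AHH_algebra
              linear_maps_comp[OF free_twist_coord_linear algebra_homs_linear[OF coact_map_hom]]]
              free_twist_coact_closed[OF m]])
      fix m0 h
      assume m0: "m0 \<in> carrier RM" and h: "h \<in> carrier H"
      then show "?F (sweedler ?T (coact M m0)
          (\<lambda>m00 m01. pure_tensor k RM HH m00 (pure_tensor k H H m01 h)))
        = face_left X \<otimes>\<^bsub>AHH\<^esub> coact_map (coord M f (pure_tensor k RM H m0 h))"
        by (simp add: inner free_twist_coact_closed free_twist_coact free_twist_coord_pure coact_map_pure
            algebra_homs_mult[OF face_left_hom] closed pure_closed AHH.m_assoc)
    qed (simp add: closed)
    finally show ?thesis
      using m by (simp add: free_twist_coact algebra_homs_mult[OF coact_map_hom] closed AHH.m_assoc)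
  qed
  have R: "?F (?R m) = comult_map X \<otimes>\<^bsub>AHH\<^esub> coact_map (coact A (f m))" if m: "m \<in> carrier M" for m
  proof -
    have "?F (?R m) = sweedler AHH (coact M m) (\<lambda>m0 m1. ?F (pure_tensor k RM HH m0 (comult H m1)))"
      by (rule sweedler_linear_comp[OF mods(1,2,8) F_lin bil2 free_twist_coact_closed[OF m] mods(6)])
    also have "\<dots> = comult_map (coord M f (coact M m))"
      by (rule sweedler_eq_linear[OF mods(1,2,6)
              linear_maps_comp[OF free_twist_coord_linear algebra_homs_linear[OF comult_map_hom]]
              free_twist_coact_closed[OF m]])
        (simp add: F_pure comult_closed free_twist_coord_pure comult_map_pure free_twist_f_closed)
    finally show ?thesis
      using m by (simp add: free_twist_coact algebra_homs_mult[OF comult_map_hom] closed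
          coact_map_coaction)
  qed
  have "?L m = ?R m \<longleftrightarrow> ?F (?L m) = ?F (?R m)" if m: "m \<in> carrier M" for m
  proof -
    have "?L m \<in> carrier ?T" "?R m \<in> carrier ?T"
      by (rule sweedler_closed_bilinear[OF mods(1,2,8)] bil1 bil2 free_twist_coact_closed[OF m])+
    then show ?thesis
      using inj_on_eq_iff[OF bij_betw_imp_inj_on[OF F_bij]] by blast
  qed
  then have "coassociative k H RM (coact M) \<longleftrightarrow> (\<forall>m\<in>carrier M.
      face_left X \<otimes>\<^bsub>AHH\<^esub> coact_map X \<otimes>\<^bsub>AHH\<^esub> coact_map (coact A (f m)) =
      comult_map X \<otimes>\<^bsub>AHH\<^esub> coact_map (coact A (f m)))"
    unfolding coassociative_def Let_def by (simp add: L R)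
  also have "\<dots> \<longleftrightarrow> cocycle_eq X"
  proof
    assume eq: "\<forall>m\<in>carrier M.
      face_left X \<otimes>\<^bsub>AHH\<^esub> coact_map X \<otimes>\<^bsub>AHH\<^esub> coact_map (coact A (f m)) =
      comult_map X \<otimes>\<^bsub>AHH\<^esub> coact_map (coact A (f m))"
    obtain m where "m \<in> carrier M" "f m = \<one>\<^bsub>A\<^esub>"
      using free_twist_ex[of "\<one>\<^bsub>A\<^esub>"] by auto
    with bspec[OF eq this(1)] show "cocycle_eq X"
      by (simp add: cocycle_eq_def algebra_homs_one[OF coaction_hom] algebra_homs_one[OF coact_map_hom]
          closed)
  qed (simp add: cocycle_eq_def)
  finally show ?thesis .
qed

text \<open>The map \<open>id \<otimes> \<epsilon>\<close> is an algebra homomorphism and sends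
  \<open>\<rho>(f m)\<close> to \<open>f m\<close>, so from \<open>X \<rho>(f m)\<close> only the
  factor \<open>counit_map X\<close> is added.\<close>

lemma free_twist_counit:
  assumes m: "m \<in> carrier M"
  shows "f (sweedler RM (coact M m) (\<lambda>m0 m1. counit H m1 \<odot>\<^bsub>RM\<^esub> m0)) = counit_map X \<otimes>\<^bsub>A\<^esub> f m"
proof -
  have counit_closed: "counit H h \<in> carrier k" if "h \<in> carrier H" for h
    using counit_ring_hom that by (rule ring_hom_closed)
  have bil: "(\<lambda>m0 m1. counit H m1 \<odot>\<^bsub>RM\<^esub> m0) \<in> bilinear_maps k RM H RM"
    by (rule bilinear_mapsI linear_maps_smult_const linear_maps_regular_smult counit_linear
        counit_closed free_twist_restrict_module | assumption)+
  have "f (sweedler RM (coact M m) (\<lambda>m0 m1. counit H m1 \<odot>\<^bsub>RM\<^esub> m0))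
      = sweedler A (coact M m) (\<lambda>m0 m1. f (counit H m1 \<odot>\<^bsub>RM\<^esub> m0))"
    by (rule sweedler_linear_comp[OF free_twist_restrict_module H_module free_twist_restrict_module free_twist_linear_k bil
          free_twist_coact_closed[OF m] A_module])
  also have "\<dots> = counit_map (coord M f (coact M m))"
  proof (rule sweedler_eq_linear[OF free_twist_restrict_module H_module A_module
          linear_maps_comp[OF free_twist_coord_linear algebra_homs_linear[OF counit_map_hom]]
          free_twist_coact_closed[OF m]])
    fix m0 h
    assume "m0 \<in> carrier RM" and h: "h \<in> carrier H"
    then show "f (counit H h \<odot>\<^bsub>RM\<^esub> m0) = counit_map (coord M f (pure_tensor k RM H m0 h))"
      using linear_maps_smult[OF free_twist_linear_k counit_closed[OF h], of m0]
      by (simp add: free_twist_coord_pure counit_map_pure free_twist_f_closed)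
  qed
  finally show ?thesis
    using m by (simp add: free_twist_coact algebra_homs_mult[OF counit_map_hom] free_twist_closed
        coaction_closed free_twist_f_closed counit_map_coaction)
qed

text \<open>Multiplicativity of \<rho> makes both sides \<open>X \<rho>(f m) \<rho>(a)\<close> in
  coordinates, and the coordinate map is injective.\<close>

lemma free_twist_smult:
  assumes a: "a \<in> carrier A" and m: "m \<in> carrier M"
  shows "coact M (a \<odot>\<^bsub>M\<^esub> m) = sweedler (MH M) (coact M m) (\<lambda>m0 m1.
    sweedler (MH M) (coact A a) (\<lambda>a0 a1. pure_tensor k RM H (a0 \<odot>\<^bsub>M\<^esub> m0) (m1 \<otimes>\<^bsub>H\<^esub> a1)))"
proof -
  interpret AH: cring AH by (rule AH_cring)
  interpret M: module A M by (rule free_twist_module)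
  note mc = free_twist_coact_closed[OF m]
  have "sweedler (MH M) (coact M m) (\<lambda>m0 m1. sweedler (MH M) (coact A a)
      (\<lambda>a0 a1. pure_tensor k RM H (a0 \<odot>\<^bsub>M\<^esub> m0) (m1 \<otimes>\<^bsub>H\<^esub> a1))) \<in> carrier (MH M)"
    by (rule sweedler_closed_bilinear[OF free_twist_restrict_module H_module MH_module[OF free_twist_module]
          coaction_smult_bilinear_outer[OF free_twist_module a] mc])
  moreover have "coord M f (coact M (a \<odot>\<^bsub>M\<^esub> m)) = coord M f (coact M m) \<otimes>\<^bsub>AH\<^esub> coact A a"
    using a m linear_maps_smult[OF free_twist_linear a m]
    by (simp add: free_twist_coact algebra_homs_mult[OF coaction_hom] free_twist_f_closed
        coaction_closed free_twist_closed AH.m_ac)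
  ultimately show ?thesis
    using a m coord_coaction_smult[OF free_twist_module free_twist_linear mc a]
    by (simp add: coord_cancel[symmetric] free_twist_coact_closed)
qed

text \<open>Linearity of the coaction and compatibility with \<open>A\<close> hold for every
  \<open>X\<close>; the two conditions on the right are what coassociativity and counitality amount
  to. For the second one the counit axiom is read at the element with coordinate 1.\<close>

theorem free_twist_rel_hopf_module:
  "rel_hopf_module k H A M \<longleftrightarrow> cocycle_eq X \<and> counit_map X = \<one>\<^bsub>A\<^esub>"
proof
  assume "rel_hopf_module k H A M"
  then interpret M: rel_hopf_module k H A M .
  obtain m where m: "m \<in> carrier M" "f m = \<one>\<^bsub>A\<^esub>"
    using free_twist_ex[of "\<one>\<^bsub>A\<^esub>"] by auto
  have "right_comodule k H RM (coact M)"
    by unfold_locales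
  then have "counit_map X = \<one>\<^bsub>A\<^esub>"
    using right_comodule.coaction_counit[of k H RM "coact M" m] free_twist_counit[OF m(1)] m
      algebra_homs_closed[OF counit_map_hom free_twist_closed] by simp
  moreover have "cocycle_eq X"
    using right_comodule.coaction_coassociative \<open>right_comodule k H RM (coact M)\<close>
    by (simp flip: free_twist_coassociative)
  ultimately show "cocycle_eq X \<and> counit_map X = \<one>\<^bsub>A\<^esub>"
    by simp
next
  assume X: "cocycle_eq X \<and> counit_map X = \<one>\<^bsub>A\<^esub>"
  have counit: "sweedler RM (coact M m) (\<lambda>m0 m1. counit H m1 \<odot>\<^bsub>RM\<^esub> m0) = m"
    if m: "m \<in> carrier RM" for m
  proof -
    have counit_closed: "counit H h \<in> carrier k" if "h \<in> carrier H" for h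
      using counit_ring_hom that by (rule ring_hom_closed)
    have bil: "(\<lambda>m0 m1. counit H m1 \<odot>\<^bsub>RM\<^esub> m0) \<in> bilinear_maps k RM H RM"
      by (rule bilinear_mapsI linear_maps_smult_const linear_maps_regular_smult counit_linear
          counit_closed free_twist_restrict_module | assumption)+
    have "sweedler RM (coact M m) (\<lambda>m0 m1. counit H m1 \<odot>\<^bsub>RM\<^esub> m0) \<in> carrier M"
      using sweedler_closed_bilinear[OF free_twist_restrict_module H_module free_twist_restrict_module bil free_twist_coact_closed] m
      by simp
    moreover have "f (sweedler RM (coact M m) (\<lambda>m0 m1. counit H m1 \<odot>\<^bsub>RM\<^esub> m0)) = f m"
      using m X free_twist_counit by (simp add: free_twist_f_closed)
    ultimately show ?thesis
      using m inj_on_eq_iff[OF bij_betw_imp_inj_on[OF free_twist_bij]] by simp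
  qed
  have "right_comodule k H RM (coact M)"
    by (intro right_comodule.intro comm_bialgebra_axioms free_twist_restrict_module right_comodule_axioms.intro
        free_twist_coact_linear counit)
      (use X in \<open>simp_all add: free_twist_coassociative\<close>)
  then show "rel_hopf_module k H A M"
    by (intro rel_hopf_module.intro comm_comodule_algebra_axioms free_twist_module
        rel_hopf_module_axioms.intro free_twist_smult)
qed

end

section \<open>Hopf maps between twisted free modules of rank one\<close>

lemma monoid_A: "monoid A" and monoid_AH: "monoid AH"
  using A_cring AH_cring by (simp_all add: cring_def comm_monoid_def)

lemma hopf_maps_eq: "hopf_maps k H A M N = {h \<in> linear_maps A M N. \<forall>m\<in>carrier M.
    coact N (h m) = tensor_map k (restrict_scalars A M) (restrict_scalars A N) H h (coact M m)}"
  by (simp add: hopf_maps_def tensor_map_def)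

lemma rel_hopf_module_coact_closed:
  "rel_hopf_module k H A M \<Longrightarrow> m \<in> carrier M \<Longrightarrow> coact M m \<in> carrier (MH M)"
  using linear_maps_closed[OF right_comodule.coaction_linear[OF rel_hopf_module.axioms(3)]]
  by fastforce

text \<open>Colinearity says that \<open>h \<otimes> id\<close> carries the coaction of
  \<open>P\<close> to that of \<open>M\<close>, so the coordinate \<open>f\<close> after
  \<open>h\<close> sees the same \<open>X\<close>.\<close>

lemma free_twist_hopf_map:
  assumes M: "free_twist X M f" and P: "module A P"
    and closed: "\<And>p. p \<in> carrier P \<Longrightarrow> coact P p \<in> carrier (MH P)"
    and h: "h \<in> hopf_maps k H A P M" and bij: "bij_betw h (carrier P) (carrier M)"
  shows "free_twist X P (\<lambda>p. f (h p))"
  unfolding free_twist_def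
proof (intro conjI ballI)
  note MD = free_twistD[OF M]
  have h_lin: "h \<in> linear_maps A P M"
    using h by (simp add: hopf_maps_def)
  show "X \<in> carrier AH" "module A P"
    by (rule MD P)+
  show "(\<lambda>p. f (h p)) \<in> linear_maps A P (regular_module A)"
    by (rule linear_maps_comp[OF h_lin MD(3)])
  show "bij_betw (\<lambda>p. f (h p)) (carrier P) (carrier A)"
    using bij_betw_trans[OF bij MD(4)] by (simp add: comp_def)
  fix p
  assume p: "p \<in> carrier P"
  then show "coact P p \<in> carrier (MH P)"
    by (rule closed)
  have "coord P (\<lambda>p. f (h p)) (coact P p) = coord M f (coact M (h p))"
    using h p tensor_map_comp[OF restrict_scalars_module[OF P] restrict_scalars_module[OF MD(2)]
        A_module H_module restrict_scalars_linear[OF P h_lin]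
        restrict_scalars_linear_regular[OF MD(2,3)] closed[OF p]]
    by (simp add: hopf_maps_eq)
  then show "coord P (\<lambda>p. f (h p)) (coact P p) = X \<otimes>\<^bsub>AH\<^esub> coact A (f (h p))"
    using MD(6)[of "h p"] linear_maps_closed[OF h_lin p] by simp
qed

lemma coord_scaled:
  assumes M: "free_twist X M f" and u: "u \<in> carrier A" and t: "t \<in> carrier (MH M)"
  shows "coord M (\<lambda>m. u \<otimes>\<^bsub>A\<^esub> f m) t = pure_tensor k A H u \<one>\<^bsub>H\<^esub> \<otimes>\<^bsub>AH\<^esub> coord M f t"
proof -
  note MD = free_twistD[OF M]
  note RM = restrict_scalars_module[OF MD(2)] and lin = restrict_scalars_linear_regular[OF MD(2,3)]
  have lin': "(\<lambda>m. u \<otimes>\<^bsub>A\<^esub> f m) \<in> linear_maps k (restrict_scalars A M) A"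
    by (rule mult_linear_right[OF A_algebra lin u])
  show ?thesis
    by (rule tensor_ext[OF RM H_module tensor_map_linear[OF RM H_module A_module lin']
          mult_linear_right[OF AH_algebra coord_linear[OF MD(2,3)]] _ t])
      (use u linear_maps_closed[OF lin] in \<open>simp_all add: pure_closed coord_pure[OF MD(2,3)]
          tensor_map_pure[OF RM H_module A_module lin'] mult_pure\<close>)
qed

text \<open>In the coordinates \<open>f\<close> and \<open>g\<close> the map is multiplication by
  \<open>u\<close>. Colinearity becomes
  \<open>Y \<rho>(u) \<rho>(a) = (u \<otimes> 1) X \<rho>(a)\<close>, which is the hypothesis
  multiplied by \<open>\<rho> a\<close>.\<close>

lemma free_twist_hopf_mapI:
  assumes M: "free_twist X M f" and N: "free_twist Y N g" and u: "u \<in> carrier A"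
    and eq: "Y \<otimes>\<^bsub>AH\<^esub> coact A u = pure_tensor k A H u \<one>\<^bsub>H\<^esub> \<otimes>\<^bsub>AH\<^esub> X"
  shows "(\<lambda>m. inv_into (carrier N) g (u \<otimes>\<^bsub>A\<^esub> f m)) \<in> hopf_maps k H A M N" (is "?h \<in> _")
  unfolding hopf_maps_eq
proof (intro CollectI conjI ballI)
  interpret AH: cring AH by (rule AH_cring)
  note MD = free_twistD[OF M] and ND = free_twistD[OF N]
  note RM = restrict_scalars_module[OF MD(2)] and RN = restrict_scalars_module[OF ND(2)]
  let ?R = "regular_module A"
  have inv: "inv_into (carrier N) g \<in> linear_maps A ?R N"
    using linear_maps_inv_into[OF ND(3) _ ND(2)] ND(4) by simp
  have mul: "(\<lambda>m. u \<otimes>\<^bsub>A\<^esub> f m) \<in> linear_maps A M ?R"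
    using linear_maps_comp[OF MD(3) linear_maps_smult_const[OF regular_module_module[OF A_cring] u]]
    by simp
  show h: "?h \<in> linear_maps A M N"
    by (rule linear_maps_comp[OF mul inv])
  fix m
  assume m: "m \<in> carrier M"
  have g_inv: "g (inv_into (carrier N) g a) = a" if "a \<in> carrier A" for a
    using that ND(4) by (simp add: bij_betw_def f_inv_into_f)
  have fm: "f m \<in> carrier A"
    using linear_maps_closed[OF MD(3) m] by simp
  have hm: "?h m \<in> carrier N"
    by (rule linear_maps_closed[OF h m])
  note ac = MD(5)[OF m]
  have "coord N g (tensor_map k (restrict_scalars A M) (restrict_scalars A N) H ?h (coact M m))
      = coord M (\<lambda>m. g (?h m)) (coact M m)"
    by (rule tensor_map_comp[OF RM RN A_module H_module restrict_scalars_linear[OF MD(2) h]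
          restrict_scalars_linear_regular[OF ND(2,3)] ac])
  also have "\<dots> = coord M (\<lambda>m. u \<otimes>\<^bsub>A\<^esub> f m) (coact M m)"
    using linear_maps_closed[OF mul]
    by (intro tensor_map_cong RM A_module H_module ac g_inv
        restrict_scalars_linear_regular[OF MD(2) mul]) simp
  also have "\<dots> = pure_tensor k A H u \<one>\<^bsub>H\<^esub> \<otimes>\<^bsub>AH\<^esub> (X \<otimes>\<^bsub>AH\<^esub> coact A (f m))"
    using coord_scaled[OF M u ac] MD(6)[OF m] by simp
  also have "\<dots> = Y \<otimes>\<^bsub>AH\<^esub> coact A u \<otimes>\<^bsub>AH\<^esub> coact A (f m)"
    using u fm MD(1) by (simp add: eq pure_closed coaction_closed AH.m_assoc)
  also have "\<dots> = coord N g (coact N (?h m))"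
    using u fm ND(1) ND(6)[OF hm]
    by (simp add: g_inv algebra_homs_mult[OF coaction_hom] coaction_closed AH.m_assoc)
  finally show "coact N (?h m)
      = tensor_map k (restrict_scalars A M) (restrict_scalars A N) H ?h (coact M m)"
    using ND(5)[OF hm] linear_maps_closed[OF tensor_map_linear[OF RM H_module RN
          restrict_scalars_linear[OF MD(2) h]] ac]
    by (simp add: coord_cancel[OF N])
qed

text \<open>A linear map between modules of rank one is multiplication by a constant in coordinates,
  namely by the coordinate \<open>g (h e)\<close> of the image of the generator \<open>e\<close>.
  Colinearity evaluated at \<open>e\<close> is the stated relation.\<close>

theorem free_twist_isomorphic_iff:
  assumes M: "free_twist X M f" and N: "free_twist Y N g"
  shows "hopf_isomorphic k H A M N \<longleftrightarrow>
    (\<exists>u\<in>Units A. Y \<otimes>\<^bsub>AH\<^esub> coact A u = pure_tensor k A H u \<one>\<^bsub>H\<^esub> \<otimes>\<^bsub>AH\<^esub> X)"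
proof
  interpret AH: cring AH by (rule AH_cring)
  note MD = free_twistD[OF M] and ND = free_twistD[OF N]
  note RM = restrict_scalars_module[OF MD(2)] and RN = restrict_scalars_module[OF ND(2)]
  interpret Mm: module A M by (rule MD(2))
  have f_closed: "f m \<in> carrier A" if "m \<in> carrier M" for m
    using linear_maps_closed[OF MD(3) that] by simp
  have g_closed: "g n \<in> carrier A" if "n \<in> carrier N" for n
    using linear_maps_closed[OF ND(3) that] by simp
  {
    assume "hopf_isomorphic k H A M N"
    then obtain h h' where h: "h \<in> hopf_maps k H A M N" and h': "h' \<in> hopf_maps k H A N M"
      and inv: "\<And>n. n \<in> carrier N \<Longrightarrow> h (h' n) = n"
      by (auto simp: hopf_isomorphic_def)
    have h_lin: "h \<in> linear_maps A M N" and h'_lin: "h' \<in> linear_maps A N M"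
      using h h' by (simp_all add: hopf_maps_def)
    obtain e where e: "e \<in> carrier M" "f e = \<one>\<^bsub>A\<^esub>"
      using free_twist_ex[OF M, of "\<one>\<^bsub>A\<^esub>"] by auto
    obtain n where n: "n \<in> carrier N" "g n = \<one>\<^bsub>A\<^esub>"
      using free_twist_ex[OF N, of "\<one>\<^bsub>A\<^esub>"] by auto
    define u where "u = g (h e)"
    have u: "u \<in> carrier A"
      unfolding u_def by (intro g_closed linear_maps_closed[OF h_lin] e)
    have gh: "g (h m) = u \<otimes>\<^bsub>A\<^esub> f m" if m: "m \<in> carrier M" for m
    proof -
      have "f (f m \<odot>\<^bsub>M\<^esub> e) = f m"
        using linear_maps_smult[OF MD(3), of "f m" e] f_closed[OF m] e by simp
      then have "m = f m \<odot>\<^bsub>M\<^esub> e"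
        using m e f_closed inj_on_eq_iff[OF bij_betw_imp_inj_on[OF MD(4)], of "f m \<odot>\<^bsub>M\<^esub> e" m] by auto
      then have "g (h m) = g (h (f m \<odot>\<^bsub>M\<^esub> e))"
        by simp
      also have "\<dots> = f m \<otimes>\<^bsub>A\<^esub> u"
        using linear_maps_smult[OF linear_maps_comp[OF h_lin ND(3)], of "f m" e] f_closed[OF m] e
        by (simp add: u_def)
      finally show ?thesis
        using u f_closed[OF m] by (simp add: A_comm)
    qed
    \<comment> \<open>Surjectivity of \<open>h\<close> makes \<open>u\<close> a unit:
      \<open>u f(h' n) = g(h(h' n)) = g n = 1\<close>.\<close>
    have "h' n \<in> carrier M"
      using linear_maps_closed[OF h'_lin n(1)] .
    with gh[OF this] have "u \<otimes>\<^bsub>A\<^esub> f (h' n) = \<one>\<^bsub>A\<^esub>" "f (h' n) \<in> carrier A"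
      by (simp_all add: inv n f_closed)
    then have "u \<in> Units A"
      using u A_comm[OF u] unfolding Units_def by auto
    moreover have "Y \<otimes>\<^bsub>AH\<^esub> coact A u = pure_tensor k A H u \<one>\<^bsub>H\<^esub> \<otimes>\<^bsub>AH\<^esub> X"
    proof -
      have "Y \<otimes>\<^bsub>AH\<^esub> coact A u = coord N g (coact N (h e))"
        using ND(6)[OF linear_maps_closed[OF h_lin e(1)]] by (simp add: u_def)
      also have "\<dots> = coord N g (tensor_map k (restrict_scalars A M) (restrict_scalars A N) H h (coact M e))"
        using h e by (simp add: hopf_maps_eq)
      also have "\<dots> = coord M (\<lambda>m. g (h m)) (coact M e)"
        by (rule tensor_map_comp[OF RM RN A_module H_module restrict_scalars_linear[OF MD(2) h_lin]
              restrict_scalars_linear_regular[OF ND(2,3)] MD(5)[OF e(1)]])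
      also have "\<dots> = coord M (\<lambda>m. u \<otimes>\<^bsub>A\<^esub> f m) (coact M e)"
        by (intro tensor_map_cong RM A_module H_module MD(5)[OF e(1)] mult_linear_right A_algebra
            restrict_scalars_linear_regular[OF MD(2,3)] u) (simp add: gh)
      also have "\<dots> = pure_tensor k A H u \<one>\<^bsub>H\<^esub> \<otimes>\<^bsub>AH\<^esub> X"
        using coord_scaled[OF M u MD(5)[OF e(1)]] MD(6)[OF e(1)] e MD(1)
        by (simp add: algebra_homs_one[OF coaction_hom])
      finally show ?thesis .
    qed
    ultimately show "\<exists>u\<in>Units A. Y \<otimes>\<^bsub>AH\<^esub> coact A u = pure_tensor k A H u \<one>\<^bsub>H\<^esub> \<otimes>\<^bsub>AH\<^esub> X"
      by blast
  next
    assume "\<exists>u\<in>Units A. Y \<otimes>\<^bsub>AH\<^esub> coact A u = pure_tensor k A H u \<one>\<^bsub>H\<^esub> \<otimes>\<^bsub>AH\<^esub> X"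
    then obtain u where u: "u \<in> Units A"
      and eq: "Y \<otimes>\<^bsub>AH\<^esub> coact A u = pure_tensor k A H u \<one>\<^bsub>H\<^esub> \<otimes>\<^bsub>AH\<^esub> X"
      by blast
    define v where "v = inv\<^bsub>A\<^esub> u"
    have uv: "u \<in> carrier A" "v \<in> carrier A" "u \<otimes>\<^bsub>A\<^esub> v = \<one>\<^bsub>A\<^esub>" "v \<otimes>\<^bsub>A\<^esub> u = \<one>\<^bsub>A\<^esub>"
      using u by (simp_all add: v_def monoid.Units_r_inv[OF monoid_A] monoid.Units_l_inv[OF monoid_A]
          monoid.Units_inv_closed[OF monoid_A] monoid.Units_closed[OF monoid_A])
    let ?u = "pure_tensor k A H u \<one>\<^bsub>H\<^esub>" and ?v = "pure_tensor k A H v \<one>\<^bsub>H\<^esub>"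
    have vu: "?v \<otimes>\<^bsub>AH\<^esub> ?u = \<one>\<^bsub>AH\<^esub>" "coact A u \<otimes>\<^bsub>AH\<^esub> coact A v = \<one>\<^bsub>AH\<^esub>"
      using uv by (simp_all add: mult_pure one_tensor[OF A_algebra H_algebra]
          algebra_homs_one[OF coaction_hom] flip: algebra_homs_mult[OF coaction_hom])
    have c: "?u \<in> carrier AH" "?v \<in> carrier AH" "coact A u \<in> carrier AH" "coact A v \<in> carrier AH"
      using uv by (simp_all add: pure_closed coaction_closed)
    \<comment> \<open>Multiplying the relation for \<open>u\<close> by \<open>v \<otimes> 1\<close>
      and by \<open>\<rho> v\<close> gives the relation that makes multiplication by
      \<open>v\<close> colinear in the other direction.\<close>
    have "?v \<otimes>\<^bsub>AH\<^esub> Y = ?v \<otimes>\<^bsub>AH\<^esub> (Y \<otimes>\<^bsub>AH\<^esub> (coact A u \<otimes>\<^bsub>AH\<^esub> coact A v))"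
      using c MD(1) ND(1) vu by simp
    also have "\<dots> = ?v \<otimes>\<^bsub>AH\<^esub> (?u \<otimes>\<^bsub>AH\<^esub> X \<otimes>\<^bsub>AH\<^esub> coact A v)"
      using c MD(1) ND(1) by (simp add: eq flip: AH.m_assoc)
    also have "\<dots> = X \<otimes>\<^bsub>AH\<^esub> coact A v"
      using c MD(1) ND(1) vu by (simp flip: AH.m_assoc)
    finally have eq': "X \<otimes>\<^bsub>AH\<^esub> coact A v = ?v \<otimes>\<^bsub>AH\<^esub> Y"
      by simp
    note inv_f = f_inv_into_f[of _ f "carrier M"] inv_into_f_f[OF bij_betw_imp_inj_on[OF MD(4)]]
      bij_betw_imp_surj_on[OF MD(4)]
    note inv_g = f_inv_into_f[of _ g "carrier N"] inv_into_f_f[OF bij_betw_imp_inj_on[OF ND(4)]]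
      bij_betw_imp_surj_on[OF ND(4)]
    have canc: "u \<otimes>\<^bsub>A\<^esub> (v \<otimes>\<^bsub>A\<^esub> a) = a" "v \<otimes>\<^bsub>A\<^esub> (u \<otimes>\<^bsub>A\<^esub> a) = a" if "a \<in> carrier A" for a
      using uv that by (simp_all flip: monoid.m_assoc[OF monoid_A] add: monoid.l_one[OF monoid_A])
    show "hopf_isomorphic k H A M N"
      unfolding hopf_isomorphic_def
      by (intro bexI[OF _ free_twist_hopf_mapI[OF M N uv(1) eq]]
          bexI[OF _ free_twist_hopf_mapI[OF N M uv(2) eq']])
        (use uv f_closed g_closed in \<open>simp add: inv_f inv_g canc monoid.m_closed[OF monoid_A]\<close>)
  }
qed

lemma free_twist_unit: "free_twist \<one>\<^bsub>AH\<^esub> (hopf_unit A) (\<lambda>a. a)"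
proof -
  interpret AH: cring AH by (rule AH_cring)
  let ?R = "restrict_scalars A (hopf_unit A)"
  have mod: "module A (hopf_unit A)"
    by (rule module_cong[OF regular_module_module[OF A_cring]]) (simp_all add: hopf_unit_def)
  have "carrier (tensor k ?R H) = carrier AH"
    by (rule carrier_tensor_cong)
      (simp_all add: hopf_unit_def algebra.smult_assoc2[OF A_algebra] monoid.l_one[OF monoid_A])
  moreover have "coord (hopf_unit A) (\<lambda>a. a) t = t" if "t \<in> carrier AH" for t
    using that by (simp add: tensor_map_def sweedler_pure_tensor_id[OF A_module H_module])
  ultimately show ?thesis
    using mod by (auto simp: free_twist_def hopf_unit_def coaction_closed linear_maps_def bij_betw_def
        inj_on_def)
qed

text \<open>Isomorphism classes live on the type \<open>'u\<close>, so a copy of \<open>A\<close> is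
  built there along \<iota>. Its coaction is \<open>a \<mapsto> X \<rho>(a)\<close> transported by
  \<open>\<iota> \<otimes> id\<close>.\<close>

lemma free_twist_exists:
  fixes \<iota> :: "'a \<Rightarrow> 'u"
  assumes X: "X \<in> carrier AH" and inj: "inj_on \<iota> (carrier A)"
  shows "\<exists>(M :: ('a, 'u, 'h) comodule) f. free_twist X M f"
proof -
  define j where "j = inv_into (carrier A) \<iota>"
  have j: "j (\<iota> a) = a" if "a \<in> carrier A" for a
    using that inj by (simp add: j_def)
  define M0 :: "('a, 'u) module" where
    "M0 = \<lparr>carrier = \<iota> ` carrier A, monoid.mult = undefined, one = undefined, ring.zero = \<iota> \<zero>\<^bsub>A\<^esub>,
      ring.add = (\<lambda>x y. \<iota> (j x \<oplus>\<^bsub>A\<^esub> j y)), smult = (\<lambda>a x. \<iota> (a \<otimes>\<^bsub>A\<^esub> j x))\<rparr>"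
  have M0_simps: "carrier M0 = \<iota> ` carrier A" "\<zero>\<^bsub>M0\<^esub> = \<iota> \<zero>\<^bsub>A\<^esub>"
    "x \<oplus>\<^bsub>M0\<^esub> y = \<iota> (j x \<oplus>\<^bsub>A\<^esub> j y)" "a \<odot>\<^bsub>M0\<^esub> x = \<iota> (a \<otimes>\<^bsub>A\<^esub> j x)" for x y a
    by (simp_all add: M0_def)
  note Ar = cring.cring_simprules[OF A_cring]
  have "abelian_group M0"
  proof (rule abelian_groupI)
    fix x
    assume "x \<in> carrier M0"
    then obtain a where "a \<in> carrier A" "x = \<iota> a"
      by (auto simp: M0_simps)
    then show "\<exists>y\<in>carrier M0. y \<oplus>\<^bsub>M0\<^esub> x = \<zero>\<^bsub>M0\<^esub>"
      by (intro bexI[of _ "\<iota> (\<ominus>\<^bsub>A\<^esub> a)"]) (simp_all add: M0_simps j Ar)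
  qed (auto simp: M0_simps j Ar)
  then have M0: "module A M0"
    by (intro moduleI A_cring) (auto simp: M0_simps j Ar)
  define M where "M = with_coact M0 (\<lambda>x. tensor_map k A (restrict_scalars A M0) H \<iota>
    (X \<otimes>\<^bsub>AH\<^esub> coact A (j x)))"
  have RM: "restrict_scalars A M = restrict_scalars A M0"
    by (simp add: M_def with_coact_def restrict_scalars_def)
  have j_lin: "j \<in> linear_maps A M (regular_module A)"
    by (rule linear_mapsI) (auto simp: M_def M0_simps j Ar)
  have bij: "bij_betw j (carrier M) (carrier A)"
    by (rule bij_betwI[of _ _ _ \<iota>]) (auto simp: M_def M0_simps j)
  have M: "module A M"
    by (rule module_cong[OF M0]) (simp_all add: M_def)
  have RM_mod: "module k (restrict_scalars A M0)"
    by (rule restrict_scalars_module[OF M0])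
  have j_k: "j \<in> linear_maps k (restrict_scalars A M0) A"
    using restrict_scalars_linear_regular[OF M j_lin] by (simp add: RM)
  have i_k: "\<iota> \<in> linear_maps k A (restrict_scalars A M0)"
    by (rule linear_maps_inverse[OF j_k RM_mod]) (auto simp: M0_simps j)
  interpret AH: cring AH by (rule AH_cring)
  have "free_twist X M j"
    unfolding free_twist_def RM
  proof (intro conjI ballI X M j_lin bij)
    fix m
    assume "m \<in> carrier M"
    then have t: "X \<otimes>\<^bsub>AH\<^esub> coact A (j m) \<in> carrier AH"
      using X by (auto simp: M_def M0_simps j coaction_closed)
    show "coact M m \<in> carrier (MH M0)"
      using linear_maps_closed[OF tensor_map_linear[OF A_module H_module RM_mod i_k] t]
      by (simp add: M_def)
    show "tensor_map k (restrict_scalars A M0) A H j (coact M m) = X \<otimes>\<^bsub>AH\<^esub> coact A (j m)"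
      using tensor_map_inverse[OF A_module RM_mod H_module i_k j_k j t] by (simp add: M_def)
  qed
  then show ?thesis
    by blast
qed

text \<open>\<open>X\<close> is the coordinate of the coaction at the generator \<open>e\<close>
  with \<open>f e = 1\<close>. Every \<open>m\<close> equals \<open>f(m) e\<close>, so compatibility
  with \<open>A\<close> determines the coaction everywhere.\<close>

lemma rel_hopf_module_free_twist:
  assumes M: "rel_hopf_module k H A M" and f: "f \<in> linear_maps A M (regular_module A)"
    and bij: "bij_betw f (carrier M) (carrier A)"
  shows "\<exists>X. free_twist X M f"
proof -
  interpret AH: cring AH by (rule AH_cring)
  have mod: "module A M"
    by (rule rel_hopf_module.axioms(2)[OF M])
  interpret Mm: module A M by (rule mod)
  have f_closed: "f m \<in> carrier A" if "m \<in> carrier M" for m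
    using linear_maps_closed[OF f that] by simp
  have "\<one>\<^bsub>A\<^esub> \<in> f ` carrier M"
    using bij by (simp add: bij_betw_def)
  then obtain e where e: "e \<in> carrier M" "f e = \<one>\<^bsub>A\<^esub>"
    by auto
  note closed = rel_hopf_module_coact_closed[OF M]
  have "coord M f (coact M m) = coord M f (coact M e) \<otimes>\<^bsub>AH\<^esub> coact A (f m)"
    if m: "m \<in> carrier M" for m
  proof -
    have "f (f m \<odot>\<^bsub>M\<^esub> e) = f m"
      using linear_maps_smult[OF f, of "f m" e] f_closed[OF m] e by simp
    then have "m = f m \<odot>\<^bsub>M\<^esub> e"
      using m e f_closed inj_on_eq_iff[OF bij_betw_imp_inj_on[OF bij], of "f m \<odot>\<^bsub>M\<^esub> e" m] by auto
    then have "coord M f (coact M m) = coord M f (coact M (f m \<odot>\<^bsub>M\<^esub> e))"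
      by simp
    also have "\<dots> = coord M f (coact M e) \<otimes>\<^bsub>AH\<^esub> coact A (f m)"
      using rel_hopf_module.coaction_smult[OF M f_closed[OF m] e(1)]
        coord_coaction_smult[OF mod f closed[OF e(1)] f_closed[OF m]] by simp
    finally show ?thesis .
  qed
  then have "free_twist (coord M f (coact M e)) M f"
    unfolding free_twist_def using mod f bij closed coord_closed[OF mod f closed[OF e(1)]] by blast
  then show ?thesis ..
qed

section \<open>The tensor product over \<open>A\<close> of two twisted free modules\<close>

context
  fixes M :: "('a, 'm, 'h, 'v) comodule_scheme" and N :: "('a, 'n, 'h, 'w) comodule_scheme"
    and f g X Y
  assumes M: "free_twist X M f" and N: "free_twist Y N g"
begin

private abbreviation (input) "Mk \<equiv> restrict_scalars A M"
private abbreviation (input) "Nk \<equiv> restrict_scalars A N"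
private abbreviation (input) "MN \<equiv> tensor A M N"
private abbreviation (input) "MNk \<equiv> restrict_scalars A (tensor A M N)"
private abbreviation (input) "Reg \<equiv> regular_module A"

private lemmas MD = free_twistD[OF M] and ND = free_twistD[OF N]
private lemmas MN_module = tensor_module[OF MD(2) ND(2)]
private lemmas Reg_module = regular_module_module[OF A_cring]
private lemmas R_modules = restrict_scalars_module[OF MD(2)] restrict_scalars_module[OF ND(2)]
  restrict_scalars_module[OF MN_module]
private lemmas T_module = MH_module[OF MN_module]

private lemma f_g_closed: "m \<in> carrier M \<Longrightarrow> f m \<in> carrier A" "n \<in> carrier N \<Longrightarrow> g n \<in> carrier A"
  using linear_maps_closed[OF MD(3), of m] linear_maps_closed[OF ND(3), of n] by simp_all

definition prod_coord where
  "prod_coord t = sweedler (regular_module A) t (\<lambda>m n. f m \<otimes>\<^bsub>A\<^esub> g n)"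

private lemma prod_bilinear: "(\<lambda>m n. f m \<otimes>\<^bsub>A\<^esub> g n) \<in> bilinear_maps A M N Reg"
proof (rule bilinear_mapsI)
  show "(\<lambda>n. f m \<otimes>\<^bsub>A\<^esub> g n) \<in> linear_maps A N Reg" if "m \<in> carrier M" for m
    using linear_maps_comp[OF ND(3) linear_maps_smult_const[OF Reg_module f_g_closed(1)[OF that]]]
    by simp
  show "(\<lambda>m. f m \<otimes>\<^bsub>A\<^esub> g n) \<in> linear_maps A M Reg" if "n \<in> carrier N" for n
    using linear_maps_regular_smult[OF Reg_module MD(3), of "g n"] f_g_closed(2)[OF that] by simp
qed

private lemma prod_coord_linear: "prod_coord \<in> linear_maps A MN Reg"
  unfolding prod_coord_def[abs_def] by (rule sweedler_linear[OF MD(2) ND(2) Reg_module prod_bilinear])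

private lemma prod_coord_pure: "m \<in> carrier M \<Longrightarrow> n \<in> carrier N \<Longrightarrow>
    prod_coord (pure_tensor A M N m n) = f m \<otimes>\<^bsub>A\<^esub> g n"
  unfolding prod_coord_def by (rule sweedler_pure_bilinear[OF MD(2) ND(2) Reg_module prod_bilinear])

text \<open>It is \<open>g\<close> composed with the isomorphism from M \<otimes>_A N to N that the
  coordinate of \<open>M\<close> provides.\<close>

private lemma prod_coord_bij: "bij_betw prod_coord (carrier MN) (carrier A)"
proof -
  obtain h where h: "h \<in> linear_maps A MN N" "bij_betw h (carrier MN) (carrier N)"
    and pure: "\<And>m n. m \<in> carrier M \<Longrightarrow> n \<in> carrier N \<Longrightarrow> h (pure_tensor A M N m n) = f m \<odot>\<^bsub>N\<^esub> n"
    using tensor_rank_one[OF MD(2) ND(2) MD(3,4)] by blast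
  have "prod_coord t = (g \<circ> h) t" if "t \<in> carrier MN" for t
    unfolding comp_def by (rule tensor_ext[OF MD(2) ND(2) prod_coord_linear linear_maps_comp[OF h(1) ND(3)] _ that])
      (use linear_maps_smult[OF ND(3)] in \<open>simp add: prod_coord_pure pure f_g_closed\<close>)
  then show ?thesis
    using bij_betw_trans[OF h(2) ND(4)] bij_betw_cong[of "carrier MN" prod_coord "g \<circ> h"] by blast
qed

private lemmas prod_coord_k = restrict_scalars_linear_regular[OF MN_module prod_coord_linear]

private abbreviation (input) "tensor_coact s t \<equiv> sweedler (MH MN) s (\<lambda>m0 m1. sweedler (MH MN) t
    (\<lambda>n0 n1. pure_tensor k MNk H (pure_tensor A M N m0 n0) (m1 \<otimes>\<^bsub>H\<^esub> n1)))"

private lemma pure_left_k: "n \<in> carrier N \<Longrightarrow> (\<lambda>m. pure_tensor A M N m n) \<in> linear_maps k Mk MNk"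
  by (rule restrict_scalars_linear[OF MD(2) pure_tensor_linear_left[OF MD(2) ND(2) linear_maps_id]])

private lemma pure_right_k: "m \<in> carrier M \<Longrightarrow> (\<lambda>n. pure_tensor A M N m n) \<in> linear_maps k Nk MNk"
  by (rule restrict_scalars_linear[OF ND(2) pure_tensor_linear_right[OF MD(2) ND(2) linear_maps_id]])

private lemma pure_MN_closed:
  "m \<in> carrier M \<Longrightarrow> n \<in> carrier N \<Longrightarrow> pure_tensor A M N m n \<in> carrier MNk"
  using pure_tensor_closed[OF MD(2) ND(2)] by simp

private lemma tensor_coact_bilinear:
  assumes "m \<in> carrier M" "h \<in> carrier H"
  shows "(\<lambda>n0 n1. pure_tensor k MNk H (pure_tensor A M N m n0) (h \<otimes>\<^bsub>H\<^esub> n1))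
    \<in> bilinear_maps k Nk H (MH MN)"
  using assms by - (rule bilinear_mapsI pure_right_k pure_MN_closed linear_intros R_modules H_module H_algebra
      | assumption | simp)+

private lemma tensor_coact_bilinear_outer:
  assumes "t \<in> carrier (MH N)"
  shows "(\<lambda>m0 m1. sweedler (MH MN) t
    (\<lambda>n0 n1. pure_tensor k MNk H (pure_tensor A M N m0 n0) (m1 \<otimes>\<^bsub>H\<^esub> n1)))
    \<in> bilinear_maps k Mk H (MH MN)"
  using assms by - (rule bilinear_mapsI tensor_coact_bilinear pure_left_k pure_MN_closed
      pure_tensor_linear_left[OF R_modules(3) H_module] pure_tensor_linear_right[OF R_modules(3) H_module]
      sweedler_linear_param[OF R_modules(2) H_module T_module]
      mult_linear_left[OF H_algebra linear_maps_id] R_modules H_module H_algebra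
      | assumption | simp)+

private lemma tensor_coact_closed:
  "s \<in> carrier (MH M) \<Longrightarrow> t \<in> carrier (MH N) \<Longrightarrow> tensor_coact s t \<in> carrier (MH MN)"
  by (rule sweedler_closed_bilinear[OF R_modules(1) H_module T_module tensor_coact_bilinear_outer])

private lemmas coord_lin = coord_linear[OF MN_module prod_coord_linear]
  and coord_p = coord_pure[OF MN_module prod_coord_linear]

text \<open>On pure tensors this is \<open>f(m) g(n) \<otimes> h h' = (f m \<otimes> h) (g n
  \<otimes> h')\<close>: the coaction of a tensor product was defined so that coordinates
  multiply.\<close>

private lemma coord_tensor_coact:
  assumes s: "s \<in> carrier (MH M)" and t: "t \<in> carrier (MH N)"
  shows "coord MN prod_coord (tensor_coact s t) = coord M f s \<otimes>\<^bsub>AH\<^esub> coord N g t"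
proof -
  have "coord MN prod_coord (tensor_coact s t) = sweedler AH s (\<lambda>m0 m1. coord MN prod_coord
      (sweedler (MH MN) t (\<lambda>n0 n1. pure_tensor k MNk H (pure_tensor A M N m0 n0) (m1 \<otimes>\<^bsub>H\<^esub> n1))))"
    by (rule sweedler_linear_comp[OF R_modules(1) H_module T_module coord_lin
          tensor_coact_bilinear_outer[OF t] s AH_module])
  also have "\<dots> = coord M f s \<otimes>\<^bsub>AH\<^esub> coord N g t"
  proof (rule sweedler_eq_linear[OF R_modules(1) H_module AH_module
        mult_linear_left[OF AH_algebra coord_linear[OF MD(2,3)] coord_closed[OF ND(2,3) t]] s])
    fix m h
    assume "m \<in> carrier Mk" and h: "h \<in> carrier H"
    then have m: "m \<in> carrier M"
      by simp
    have "coord MN prod_coord (sweedler (MH MN) t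
        (\<lambda>n0 n1. pure_tensor k MNk H (pure_tensor A M N m n0) (h \<otimes>\<^bsub>H\<^esub> n1)))
      = sweedler AH t (\<lambda>n0 n1. coord MN prod_coord
        (pure_tensor k MNk H (pure_tensor A M N m n0) (h \<otimes>\<^bsub>H\<^esub> n1)))"
      by (rule sweedler_linear_comp[OF R_modules(2) H_module T_module coord_lin
            tensor_coact_bilinear[OF m h] t AH_module])
    also have "\<dots> = pure_tensor k A H (f m) h \<otimes>\<^bsub>AH\<^esub> coord N g t"
      by (rule sweedler_eq_linear[OF R_modules(2) H_module AH_module
            mult_linear_right[OF AH_algebra coord_linear[OF ND(2,3)]] t])
        (use m h in \<open>simp_all add: coord_p coord_pure[OF ND(2,3)] prod_coord_pure mult_pure f_g_closed
            pure_closed pure_tensor_closed[OF MD(2) ND(2)]\<close>)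
    finally show "coord MN prod_coord (sweedler (MH MN) t
        (\<lambda>n0 n1. pure_tensor k MNk H (pure_tensor A M N m n0) (h \<otimes>\<^bsub>H\<^esub> n1)))
      = coord M f (pure_tensor k Mk H m h) \<otimes>\<^bsub>AH\<^esub> coord N g t"
      using m h by (simp add: coord_pure[OF MD(2,3)])
  qed
  finally show ?thesis .
qed

private lemma coord_bij: "bij_betw (coord MN prod_coord) (carrier (MH MN)) (carrier AH)"
  using prod_coord_bij
  by (intro tensor_map_bij_betw R_modules A_module H_module prod_coord_k) simp

private lemma coord_tensor_coact_pure:
  assumes "m \<in> carrier M" "n \<in> carrier N"
  shows "coord MN prod_coord (tensor_coact (coact M m) (coact N n))
    = X \<otimes>\<^bsub>AH\<^esub> Y \<otimes>\<^bsub>AH\<^esub> coact A (f m \<otimes>\<^bsub>A\<^esub> g n)"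
proof -
  interpret AH: cring AH by (rule AH_cring)
  show ?thesis
    using assms MD(1) ND(1)
    by (simp add: coord_tensor_coact MD(5,6) ND(5,6) algebra_homs_mult[OF coaction_hom] f_g_closed
        coaction_closed AH.m_ac)
qed

text \<open>Since the coordinate map is injective, balancedness over \<open>A\<close> may be checked in \<open>A \<otimes> H\<close>, where the
  coaction of \<open>m \<otimes> n\<close> becomes \<open>X Y \<rho>(f m \<cdot> g n)\<close>.\<close>

private lemma tensor_coact_balanced:
  "balanced A M N (MH MN) (\<lambda>m n. tensor_coact (coact M m) (coact N n))"
proof -
  interpret AH: cring AH by (rule AH_cring)
  interpret Mm: module A M by (rule MD(2))
  interpret Nm: module A N by (rule ND(2))
  interpret T: module k "MH MN" by (rule T_module)
  have closed: "tensor_coact (coact M m) (coact N n) \<in> carrier (MH MN)"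
    if "m \<in> carrier M" "n \<in> carrier N" for m n
    using that by (intro tensor_coact_closed MD ND)
  have eqI: "s = t" if "s \<in> carrier (MH MN)" "t \<in> carrier (MH MN)"
    "coord MN prod_coord s = coord MN prod_coord t" for s t
    using that inj_onD[OF bij_betw_imp_inj_on[OF coord_bij]] by blast
  note simps = coord_tensor_coact_pure closed linear_maps_add[OF coord_lin]
    linear_maps_add[OF coaction_linear] f_g_closed coaction_closed MD(1) ND(1) AH.r_distr
  note f_simps = linear_maps_add[OF MD(3), simplified] linear_maps_smult[OF MD(3), simplified]
    and g_simps = linear_maps_add[OF ND(3), simplified] linear_maps_smult[OF ND(3), simplified]
  show ?thesis
    by (rule balancedI; (rule eqI)?)
      (simp_all add: simps f_simps g_simps cring.cring_simprules[OF A_cring])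
qed

theorem free_twist_tensor: "free_twist (X \<otimes>\<^bsub>AH\<^esub> Y) (hopf_tensor k H A M N) prod_coord"
  unfolding free_twist_def
proof (intro conjI ballI)
  interpret AH: cring AH by (rule AH_cring)
  interpret T: module k "MH MN" by (rule T_module)
  interpret Reg: module A Reg by (rule Reg_module)
  let ?P = "hopf_tensor k H A M N"
  have P: "carrier ?P = carrier MN" "add ?P = add MN" "\<zero>\<^bsub>?P\<^esub> = \<zero>\<^bsub>MN\<^esub>" "smult ?P = smult MN"
    "restrict_scalars A ?P = MNk"
    "coact ?P t = sweedler (MH MN) t (\<lambda>m n. tensor_coact (coact M m) (coact N n))" for t
    by (simp_all add: hopf_tensor_def Let_def with_coact_def restrict_scalars_def)
  show "X \<otimes>\<^bsub>AH\<^esub> Y \<in> carrier AH"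
    using MD(1) ND(1) by simp
  show "module A ?P"
    by (rule module_cong[OF MN_module]) (simp_all add: P)
  show "prod_coord \<in> linear_maps A ?P Reg"
    using prod_coord_linear by (simp add: linear_maps_def P)
  show "bij_betw prod_coord (carrier ?P) (carrier A)"
    using prod_coord_bij by (simp add: P)
  fix t
  assume "t \<in> carrier ?P"
  then have t: "t \<in> carrier MN"
    by (simp add: P)
  show "coact ?P t \<in> carrier (MH ?P)"
    unfolding P by (rule sweedler_closed[OF MD(2) ND(2) T.abelian_group_axioms tensor_coact_balanced t])
  let ?F = "\<lambda>a. X \<otimes>\<^bsub>AH\<^esub> Y \<otimes>\<^bsub>AH\<^esub> coact A a"
  \<comment> \<open>The outer sum runs over a tensor over \<open>A\<close>. Both the coordinate map
    and \<open>?F\<close> are additive, so they can be moved through it, and the summands agree on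
    pure tensors.\<close>
  have "coord MN prod_coord (coact ?P t)
      = sweedler AH t (\<lambda>m n. coord MN prod_coord (tensor_coact (coact M m) (coact N n)))"
    unfolding P(6)
    by (rule sweedler_additive_comp[OF MD(2) ND(2) tensor_coact_balanced T.abelian_group_axioms
          AH.abelian_group_axioms _ _ t])
      (simp_all add: linear_maps_closed[OF coord_lin] linear_maps_add[OF coord_lin])
  also have "\<dots> = sweedler AH t (\<lambda>m n. ?F (f m \<otimes>\<^bsub>A\<^esub> g n))"
    by (rule sweedler_cong[OF MD(2) ND(2) t coord_tensor_coact_pure AH.abelian_group_axioms])
      (simp_all add: MD(1) ND(1) f_g_closed coaction_closed)
  also have "\<dots> = ?F (prod_coord t)"
    unfolding prod_coord_def
    by (rule sweedler_additive_comp[OF MD(2) ND(2) bilinear_maps_balanced[OF prod_bilinear]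
          Reg.abelian_group_axioms AH.abelian_group_axioms _ _ t, symmetric])
      (simp_all add: MD(1) ND(1) coaction_closed linear_maps_add[OF coaction_linear] AH.r_distr)
  finally show "tensor_map k (restrict_scalars A ?P) A H prod_coord (coact ?P t) = ?F (prod_coord t)"
    unfolding P .
qed

end

end

section \<open>The kernel of the forgetful map\<close>

context comm_comodule_algebra
begin

text \<open>A class described through \<open>X\<close> alone, without a representative. It is empty
  unless \<open>X\<close> satisfies the cocycle equation and has counit 1.\<close>

definition twist_class :: "('a \<times> 'h \<Rightarrow>\<^sub>0 int) set \<Rightarrow> ('a, 'u, 'h) comodule set" where
  "twist_class X = {P. rel_hopf_module k H A P \<and> (\<exists>f. free_twist X P f)}"

lemma hopf_isomorphic_bij:
  assumes "hopf_isomorphic k H A P M"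
  obtains h where "h \<in> hopf_maps k H A P M" "bij_betw h (carrier P) (carrier M)"
proof -
  obtain h h' where h: "h \<in> hopf_maps k H A P M" "h' \<in> hopf_maps k H A M P"
    "\<forall>p\<in>carrier P. h' (h p) = p" "\<forall>m\<in>carrier M. h (h' m) = m"
    using assms by (auto simp: hopf_isomorphic_def)
  then have "h \<in> linear_maps A P M" "h' \<in> linear_maps A M P"
    by (simp_all add: hopf_maps_def)
  then have "bij_betw h (carrier P) (carrier M)"
    using h by (intro bij_betwI[of _ _ _ h']) (auto simp: linear_maps_closed)
  with h(1) show ?thesis
    by (rule that)
qed

lemma free_twist_isomorphic:
  assumes M: "free_twist X M f" and N: "free_twist X N g"
  shows "hopf_isomorphic k H A M N"
proof -
  interpret AH: cring AH by (rule AH_cring)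
  show ?thesis
    unfolding free_twist_isomorphic_iff[OF M N]
    using free_twist_closed[OF M]
    by (intro bexI[of _ "\<one>\<^bsub>A\<^esub>"])
      (simp_all add: algebra_homs_one[OF coaction_hom] monoid.Units_one_closed[OF monoid_A]
        flip: one_tensor[OF A_algebra H_algebra])
qed

text \<open>\<open>M\<close> may live on a type other than \<open>'u\<close>, as
  \<open>hopf_unit A\<close> and tensor products do. Hopf isomorphisms transport \<open>X\<close>,
  and conversely two modules with the same \<open>X\<close> are isomorphic through the unit
  \<open>u = 1\<close>.\<close>

lemma hopf_class_free_twist:
  assumes M: "free_twist X M f"
  shows "hopf_class k H A M = twist_class X"
proof (intro subset_antisym subsetI)
  fix P
  assume "P \<in> hopf_class k H A M"
  then have P: "rel_hopf_module k H A P" and "hopf_isomorphic k H A P M"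
    by (simp_all add: hopf_class_def)
  then obtain h where "h \<in> hopf_maps k H A P M" "bij_betw h (carrier P) (carrier M)"
    by (auto elim: hopf_isomorphic_bij)
  then show "P \<in> twist_class X"
    using P free_twist_hopf_map[OF M rel_hopf_module.axioms(2)[OF P] rel_hopf_module_coact_closed[OF P]]
    by (auto simp: twist_class_def)
next
  fix P
  assume "P \<in> twist_class X"
  then show "P \<in> hopf_class k H A M"
    using free_twist_isomorphic[OF _ M] by (auto simp: twist_class_def hopf_class_def)
qed

lemma harrison_cocyclesD:
  assumes "X \<in> harrison_cocycles k H A"
  shows "X \<in> Units AH" "X \<in> carrier AH" "cocycle_eq X" "counit_map X = \<one>\<^bsub>A\<^esub>"
  using assms cocycle_counit[of X]
  by (auto simp: harrison_cocycles_eq monoid.Units_closed[OF monoid_AH])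

lemma free_twist_cocycle:
  fixes \<iota> :: "'a \<Rightarrow> 'u"
  assumes X: "X \<in> harrison_cocycles k H A" and \<iota>: "inj_on \<iota> (carrier A)"
  obtains M :: "('a, 'u, 'h) comodule" and f where "free_twist X M f" "rel_hopf_module k H A M"
proof -
  obtain M :: "('a, 'u, 'h) comodule" and f where "free_twist X M f"
    using free_twist_exists[OF harrison_cocyclesD(2)[OF X] \<iota>] by blast
  moreover from this have "rel_hopf_module k H A M"
    using free_twist_rel_hopf_module harrison_cocyclesD[OF X] by blast
  ultimately show ?thesis
    by (rule that)
qed

lemma twist_class_eq_iff:
  fixes \<iota> :: "'a \<Rightarrow> 'u"
  assumes X: "X \<in> harrison_cocycles k H A" and Y: "Y \<in> harrison_cocycles k H A"
    and \<iota>: "inj_on \<iota> (carrier A)"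
  shows "(twist_class X :: ('a, 'u, 'h) comodule set) = twist_class Y \<longleftrightarrow>
    (\<exists>u\<in>Units A. Y \<otimes>\<^bsub>AH\<^esub> coact A u = pure_tensor k A H u \<one>\<^bsub>H\<^esub> \<otimes>\<^bsub>AH\<^esub> X)" (is "?L \<longleftrightarrow> ?R")
proof
  obtain M :: "('a, 'u, 'h) comodule" and f where M: "free_twist X M f" "rel_hopf_module k H A M"
    using free_twist_cocycle[OF X \<iota>] .
  obtain N :: "('a, 'u, 'h) comodule" and g where N: "free_twist Y N g" "rel_hopf_module k H A N"
    using free_twist_cocycle[OF Y \<iota>] .
  {
    assume ?L
    moreover have "M \<in> twist_class X"
      using M by (auto simp: twist_class_def)
    ultimately obtain f' where M': "free_twist Y M f'"
      by (auto simp: twist_class_def)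
    \<comment> \<open>The module \<open>M\<close> now carries \<open>X\<close> through
      \<open>f\<close> and \<open>Y\<close> through \<open>f'\<close>; the isomorphism criterion for
      \<open>M\<close> with itself yields \<open>u\<close>.\<close>
    show ?R
      using free_twist_isomorphic[OF M(1) M(1)] by (simp add: free_twist_isomorphic_iff[OF M(1) M'])
  next
    assume ?R
    then have "hopf_isomorphic k H A M N"
      by (simp add: free_twist_isomorphic_iff[OF M(1) N(1)])
    then obtain h where "h \<in> hopf_maps k H A M N" "bij_betw h (carrier M) (carrier N)"
      by (rule hopf_isomorphic_bij)
    from free_twist_hopf_map[OF N(1) rel_hopf_module.axioms(2)[OF M(2)]
        rel_hopf_module_coact_closed[OF M(2)] this]
    show ?L
      using hopf_class_free_twist[OF M(1)] hopf_class_free_twist by blast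
  }
qed

text \<open>The product in \<open>relative_Pic\<close> is a union over all representatives. Each
  term is the same class, and the union is not empty because every cocycle is realised on
  \<open>'u\<close>.\<close>

lemma twist_class_mult:
  fixes \<iota> :: "'a \<Rightarrow> 'u"
  assumes X: "X \<in> harrison_cocycles k H A" and Y: "Y \<in> harrison_cocycles k H A"
    and \<iota>: "inj_on \<iota> (carrier A)"
  shows "twist_class X \<otimes>\<^bsub>relative_Pic k H A\<^esub> twist_class Y =
    (twist_class (X \<otimes>\<^bsub>AH\<^esub> Y) :: ('a, 'u, 'h) comodule set)"
proof -
  have "(hopf_class k H A (hopf_tensor k H A M N) :: ('a, 'u, 'h) comodule set)
      = twist_class (X \<otimes>\<^bsub>AH\<^esub> Y)"
    if MN: "M \<in> twist_class X" "N \<in> twist_class Y" for M N :: "('a, 'u, 'h) comodule"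
  proof -
    obtain f g where "free_twist X M f" "free_twist Y N g"
      using MN by (auto simp: twist_class_def)
    then show ?thesis
      by (rule hopf_class_free_twist[OF free_twist_tensor])
  qed
  moreover have "(twist_class Z :: ('a, 'u, 'h) comodule set) \<noteq> {}"
    if Z: "Z \<in> harrison_cocycles k H A" for Z
    by (rule free_twist_cocycle[OF Z \<iota>]) (auto simp: twist_class_def)
  ultimately show ?thesis
    using X Y by (simp add: relative_Pic_def)
qed

lemma free_twist_module_isomorphic:
  assumes "free_twist X M f"
  shows "module_isomorphic A M (regular_module A)"
  using free_twist_linear[OF assms] free_twist_bij[OF assms]
  by (auto simp: module_isomorphic_iff[OF free_twist_module[OF assms]])

section \<open>The group of cocycles and its subgroup of coboundaries\<close>

definition cocycle_group where
  "cocycle_group = (units_of AH)\<lparr>carrier := harrison_cocycles k H A\<rparr>"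

lemma cocycle_subgroup: "subgroup (harrison_cocycles k H A) (units_of AH)"
proof -
  interpret AH: cring AH by (rule AH_cring)
  interpret U: group "units_of AH" by (rule AH.units_group)
  show ?thesis
  proof (rule U.subgroupI)
    have "\<one>\<^bsub>AH\<^esub> \<in> harrison_cocycles k H A"
      by (simp add: harrison_cocycles_eq cocycle_eq_one)
    then show "harrison_cocycles k H A \<noteq> {}"
      by auto
  next
    fix X
    assume "X \<in> harrison_cocycles k H A"
    then have X: "X \<in> Units AH" "cocycle_eq X"
      by (simp_all add: harrison_cocycles_eq)
    have "cocycle_eq (X \<otimes>\<^bsub>AH\<^esub> inv\<^bsub>AH\<^esub> X)"
      unfolding AH.Units_r_inv[OF X(1)] by (rule cocycle_eq_one)
    then have "cocycle_eq (inv\<^bsub>AH\<^esub> X)"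
      by (rule cocycle_eq_cancel[OF X(1) AH.Units_inv_closed[OF X(1)] X(2)])
    then show "inv\<^bsub>units_of AH\<^esub> X \<in> harrison_cocycles k H A"
      using X by (simp add: harrison_cocycles_eq AH.units_of_inv)
    show "X \<otimes>\<^bsub>units_of AH\<^esub> Y \<in> harrison_cocycles k H A" if "Y \<in> harrison_cocycles k H A" for Y
      using X that by (auto simp: harrison_cocycles_eq units_of_mult intro: cocycle_eq_mult)
  qed (auto simp: harrison_cocycles_eq units_of_carrier)
qed

lemma cocycle_comm_group: "comm_group cocycle_group"
proof -
  interpret AH: cring AH by (rule AH_cring)
  interpret U: comm_group "units_of AH" by (rule AH.units_comm_group)
  interpret C: group cocycle_group
    unfolding cocycle_group_def by (rule U.subgroup_imp_group[OF cocycle_subgroup])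
  show ?thesis
    by (rule C.group_comm_groupI)
      (simp add: cocycle_group_def harrison_cocycles_eq units_of_mult AH.m_comm AH.Units_closed)
qed

lemma cocycle_mult: "X \<otimes>\<^bsub>cocycle_group\<^esub> Y = X \<otimes>\<^bsub>AH\<^esub> Y"
  and cocycle_one: "\<one>\<^bsub>cocycle_group\<^esub> = \<one>\<^bsub>AH\<^esub>"
  and cocycle_carrier: "carrier cocycle_group = harrison_cocycles k H A"
  by (simp_all add: cocycle_group_def units_of_mult units_of_one)

text \<open>The left side is the isomorphism criterion between the twist by \<open>X\<close> and the
  trivial twist; multiplying by the inverse of \<open>u \<otimes> 1\<close> solves it for
  \<open>X\<close>.\<close>

lemma coboundary_iff:
  assumes u: "u \<in> Units A" and X: "X \<in> carrier AH"
  shows "coact A u = pure_tensor k A H u \<one>\<^bsub>H\<^esub> \<otimes>\<^bsub>AH\<^esub> X \<longleftrightarrow>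
    X = pure_tensor k A H (inv\<^bsub>A\<^esub> u) \<one>\<^bsub>H\<^esub> \<otimes>\<^bsub>AH\<^esub> coact A u"
proof -
  interpret AH: cring AH by (rule AH_cring)
  have uv: "u \<in> carrier A" "inv\<^bsub>A\<^esub> u \<in> carrier A" "u \<otimes>\<^bsub>A\<^esub> inv\<^bsub>A\<^esub> u = \<one>\<^bsub>A\<^esub>" "inv\<^bsub>A\<^esub> u \<otimes>\<^bsub>A\<^esub> u = \<one>\<^bsub>A\<^esub>"
    using u by (simp_all add: monoid.Units_closed[OF monoid_A] monoid.Units_inv_closed[OF monoid_A]
        monoid.Units_r_inv[OF monoid_A] monoid.Units_l_inv[OF monoid_A])
  let ?u = "pure_tensor k A H u \<one>\<^bsub>H\<^esub>" and ?v = "pure_tensor k A H (inv\<^bsub>A\<^esub> u) \<one>\<^bsub>H\<^esub>"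
  have c: "?u \<in> carrier AH" "?v \<in> carrier AH" "coact A u \<in> carrier AH"
    using uv by (simp_all add: pure_closed coaction_closed)
  have "?u \<otimes>\<^bsub>AH\<^esub> ?v = \<one>\<^bsub>AH\<^esub>" "?v \<otimes>\<^bsub>AH\<^esub> ?u = \<one>\<^bsub>AH\<^esub>"
    using uv by (simp_all add: mult_pure one_tensor[OF A_algebra H_algebra])
  then have "?u \<otimes>\<^bsub>AH\<^esub> (?v \<otimes>\<^bsub>AH\<^esub> t) = t" "?v \<otimes>\<^bsub>AH\<^esub> (?u \<otimes>\<^bsub>AH\<^esub> t) = t" if "t \<in> carrier AH" for t
    using c that by (simp_all flip: AH.m_assoc)
  then show ?thesis
    using c X by auto
qed

lemma harrison_coboundaries_subset: "harrison_coboundaries k H A \<subseteq> harrison_cocycles k H A"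
proof -
  interpret AH: cring AH by (rule AH_cring)
  have "pure_tensor k A H (inv\<^bsub>A\<^esub> u) \<one>\<^bsub>H\<^esub> \<otimes>\<^bsub>AH\<^esub> coact A u \<in> Units AH" if u: "u \<in> Units A" for u
    using u monoid.Units_inv_Units[OF monoid_A]
    by (intro AH.Units_m_closed algebra_homs_Units[OF coaction_hom]
        algebra_homs_Units[OF algebra_hom_left[OF A_algebra H_algebra]])
  then show ?thesis
    by (auto simp: harrison_coboundaries_eq harrison_cocycles_eq cocycle_eq_coboundary)
qed

theorem kernel_forget_coaction:
  fixes \<iota> :: "'a \<Rightarrow> 'u"
  assumes \<iota>: "inj_on \<iota> (carrier A)"
  shows "kernel (relative_Pic k H A :: ('a, 'u, 'h) comodule set monoid) (Pic A :: ('a, 'u) module set monoid)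
      (forget_coaction A) = twist_class ` harrison_cocycles k H A"
proof (intro subset_antisym subsetI)
  interpret AH: cring AH by (rule AH_cring)
  interpret C: comm_group cocycle_group by (rule cocycle_comm_group)
  fix C :: "('a, 'u, 'h) comodule set"
  assume "C \<in> twist_class ` harrison_cocycles k H A"
  then obtain X where X: "X \<in> harrison_cocycles k H A" and C: "C = twist_class X"
    by blast
  have X': "inv\<^bsub>cocycle_group\<^esub> X \<in> harrison_cocycles k H A"
    "X \<otimes>\<^bsub>AH\<^esub> inv\<^bsub>cocycle_group\<^esub> X = \<one>\<^bsub>AH\<^esub>"
    using C.inv_closed[of X] C.r_inv[of X] X by (simp_all add: cocycle_carrier cocycle_mult cocycle_one)
  obtain M :: "('a, 'u, 'h) comodule" and f where M: "free_twist X M f" "rel_hopf_module k H A M"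
    using free_twist_cocycle[OF X \<iota>] .
  obtain N :: "('a, 'u, 'h) comodule" and g
    where N: "free_twist (inv\<^bsub>cocycle_group\<^esub> X) N g" "rel_hopf_module k H A N"
    using free_twist_cocycle[OF X'(1) \<iota>] .
  \<comment> \<open>The product has the twist \<open>X\<close> times its inverse, which is 1, and
    the unit object has the same twist.\<close>
  have "hopf_isomorphic k H A (hopf_tensor k H A M N) (hopf_unit A)"
    using free_twist_isomorphic[OF free_twist_tensor[OF M(1) N(1), unfolded X'(2)] free_twist_unit] .
  then have "hopf_invertible k H A M"
    using M N by (auto simp: hopf_invertible_def)
  moreover have "C = hopf_class k H A M"
    unfolding C by (rule hopf_class_free_twist[OF M(1), symmetric])
  moreover have "module_class A P = module_class A (regular_module A)"
    if "P \<in> C" for P :: "('a, 'u, 'h) comodule"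
    using that free_twist_module_isomorphic by (auto simp: C twist_class_def intro!: module_class_eqI)
  then have "forget_coaction A C = module_class A (regular_module A)"
    using M unfolding C forget_coaction_def by (auto simp: twist_class_def)
  ultimately show "C \<in> kernel (relative_Pic k H A) (Pic A) (forget_coaction A)"
    by (auto simp: kernel_def relative_Pic_def Pic_def)
next
  interpret AH: cring AH by (rule AH_cring)
  fix C :: "('a, 'u, 'h) comodule set"
  assume "C \<in> kernel (relative_Pic k H A) (Pic A :: ('a, 'u) module set monoid) (forget_coaction A)"
  then obtain M :: "('a, 'u, 'h) comodule" where C: "C = hopf_class k H A M" and inv: "hopf_invertible k H A M"
    and forget: "forget_coaction A C = (module_class A (regular_module A) :: ('a, 'u) module set)"
    by (auto simp: kernel_def relative_Pic_def Pic_def)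
  then obtain N :: "('a, 'u, 'h) comodule" where M: "rel_hopf_module k H A M"
    and N: "rel_hopf_module k H A N"
    and MN: "hopf_isomorphic k H A (hopf_tensor k H A M N) (hopf_unit A)"
    by (auto simp: hopf_invertible_def)
  note M_mod = rel_hopf_module.axioms(2)[OF M] and N_mod = rel_hopf_module.axioms(2)[OF N]
  have M_class: "M \<in> hopf_class k H A M"
  proof -
    have "tensor_map k (restrict_scalars A M) (restrict_scalars A M) H (\<lambda>m. m) (coact M m) = coact M m"
      if "m \<in> carrier M" for m
      using rel_hopf_module_coact_closed[OF M that]
      by (simp add: tensor_map_def sweedler_pure_tensor_id[OF restrict_scalars_module[OF M_mod] H_module])
    then have "(\<lambda>m. m) \<in> hopf_maps k H A M M"
      by (simp add: hopf_maps_eq linear_maps_id)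
    then show ?thesis
      using M by (auto simp: hopf_class_def hopf_isomorphic_def intro!: bexI)
  qed
  \<comment> \<open>Module classes contain plain module records, so \<open>M\<close> has to lose its
    coaction field before it can be a member of one. This member links the class of \<open>M\<close>
    with that of \<open>A\<close>.\<close>
  have trunc: "module.truncate M \<in> module_class A M"
  proof -
    have M': "module A (module.truncate M)"
      by (rule module_cong[OF M_mod]) (simp_all add: module.truncate_def)
    have "(\<lambda>m. m) \<in> linear_maps A (module.truncate M) M"
      by (simp add: linear_maps_def module.truncate_def)
    moreover have "bij_betw (\<lambda>m. m) (carrier (module.truncate M)) (carrier M)"
      by (simp add: module.truncate_def bij_betw_def)
    ultimately show ?thesis
      using M' module_isomorphic_iff[OF M'] by (auto simp: module_class_def)
  qed
  then have "module.truncate M \<in> module_class A (regular_module A)"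
    using forget M_class unfolding C forget_coaction_def by blast
  with trunc have "module_isomorphic A M (regular_module A)"
    unfolding module_class_def using module_isomorphic_sym module_isomorphic_trans by blast
  then obtain f where f: "f \<in> linear_maps A M (regular_module A)" "bij_betw f (carrier M) (carrier A)"
    by (auto simp: module_isomorphic_iff[OF M_mod])
  then obtain X where X: "free_twist X M f"
    using rel_hopf_module_free_twist[OF M] by blast
  \<comment> \<open>The inverse \<open>N\<close> must itself be free of rank one before it has a
    coordinate: \<open>M\<close> of rank one gives M \<otimes>_A N \<cong> N, and invertibility
    gives M \<otimes>_A N \<cong> A.\<close>
  obtain h where h: "h \<in> linear_maps A (tensor A M N) N" "bij_betw h (carrier (tensor A M N)) (carrier N)"
    by (rule tensor_rank_one[OF M_mod N_mod f]) (rule that)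
  note MN_mod = tensor_module[OF M_mod N_mod]
  obtain q where "q \<in> hopf_maps k H A (hopf_tensor k H A M N) (hopf_unit A)"
    "bij_betw q (carrier (hopf_tensor k H A M N)) (carrier (hopf_unit A))"
    using MN by (rule hopf_isomorphic_bij)
  then have "q \<in> linear_maps A (tensor A M N) (regular_module A)"
    "bij_betw q (carrier (tensor A M N)) (carrier (regular_module A))"
    by (simp_all add: hopf_maps_def hopf_tensor_def hopf_unit_def Let_def linear_maps_def)
  then have "module_isomorphic A (tensor A M N) (regular_module A)"
    using module_isomorphic_iff[OF MN_mod] by blast
  moreover have "module_isomorphic A (tensor A M N) N"
    using h module_isomorphic_iff[OF MN_mod] by blast
  ultimately have "module_isomorphic A N (regular_module A)"
    using module_isomorphic_sym module_isomorphic_trans by blast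
  then obtain g where g: "g \<in> linear_maps A N (regular_module A)" "bij_betw g (carrier N) (carrier A)"
    by (auto simp: module_isomorphic_iff[OF N_mod])
  then obtain Y where Y: "free_twist Y N g"
    using rel_hopf_module_free_twist[OF N] by blast
  \<comment> \<open>The twist of M \<otimes>_A N is \<open>X Y\<close> and that of the unit object
    is 1. The resulting relation exhibits \<open>X\<close> as a divisor of the unit
    \<open>\<rho> u\<close>.\<close>
  obtain u where u: "u \<in> Units A"
    and eq: "\<one>\<^bsub>AH\<^esub> \<otimes>\<^bsub>AH\<^esub> coact A u = pure_tensor k A H u \<one>\<^bsub>H\<^esub> \<otimes>\<^bsub>AH\<^esub> (X \<otimes>\<^bsub>AH\<^esub> Y)"
    using MN free_twist_isomorphic_iff[OF free_twist_tensor[OF X Y] free_twist_unit] by blast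
  have c: "u \<in> carrier A" "X \<in> carrier AH" "Y \<in> carrier AH" "pure_tensor k A H u \<one>\<^bsub>H\<^esub> \<in> carrier AH"
    using u free_twist_closed[OF X] free_twist_closed[OF Y]
    by (simp_all add: monoid.Units_closed[OF monoid_A] pure_closed)
  let ?Z = "Y \<otimes>\<^bsub>AH\<^esub> pure_tensor k A H u \<one>\<^bsub>H\<^esub>"
  have \<rho>u: "coact A u \<in> Units AH"
    by (rule algebra_homs_Units[OF coaction_hom u])
  have "X \<otimes>\<^bsub>AH\<^esub> ?Z = coact A u"
    using eq c by (simp add: coaction_closed AH.m_ac)
  then have "X \<otimes>\<^bsub>AH\<^esub> (?Z \<otimes>\<^bsub>AH\<^esub> inv\<^bsub>AH\<^esub> (coact A u)) = \<one>\<^bsub>AH\<^esub>"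
    using c AH.m_assoc[of X ?Z "inv\<^bsub>AH\<^esub> (coact A u)"] \<rho>u by simp
  then have "X \<in> Units AH"
    using c AH.m_comm[of X "?Z \<otimes>\<^bsub>AH\<^esub> inv\<^bsub>AH\<^esub> (coact A u)"] \<rho>u AH.Units_inv_closed[OF \<rho>u]
    unfolding Units_def by auto
  moreover have "cocycle_eq X"
    using M free_twist_rel_hopf_module[OF X] by simp
  ultimately have "X \<in> harrison_cocycles k H A"
    by (simp add: harrison_cocycles_eq)
  then show "C \<in> twist_class ` harrison_cocycles k H A"
    using hopf_class_free_twist[OF X] C by blast
qed

text \<open>The first isomorphism theorem for \<open>twist_class\<close> on the group of cocycles:
  its image is the kernel of the forgetful map, and its own kernel consists of the
  coboundaries.\<close>

theorem kernel_iso_harrison_H1: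
  fixes \<iota> :: "'a \<Rightarrow> 'u"
  assumes \<iota>: "inj_on \<iota> (carrier A)"
  defines "P \<equiv> (relative_Pic k H A :: ('a, 'u, 'h) comodule set monoid)"
  defines "K \<equiv> P\<lparr>carrier := kernel P (Pic A :: ('a, 'u) module set monoid) (forget_coaction A)\<rparr>"
  shows "comm_group K \<and> comm_group (harrison_H1 k H A) \<and> K \<cong> harrison_H1 k H A"
proof -
  interpret AH: cring AH by (rule AH_cring)
  interpret C: comm_group cocycle_group by (rule cocycle_comm_group)
  have K: "carrier K = twist_class ` carrier cocycle_group"
    using kernel_forget_coaction[OF \<iota>] by (simp add: K_def P_def cocycle_carrier)
  have one: "\<one>\<^bsub>P\<^esub> = twist_class \<one>\<^bsub>cocycle_group\<^esub>"
    using hopf_class_free_twist[OF free_twist_unit] by (simp add: P_def relative_Pic_def cocycle_one)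
  have "twist_class \<in> hom cocycle_group P"
  proof (rule homI)
    show "twist_class X \<in> carrier P" if "X \<in> carrier cocycle_group" for X
      using that kernel_forget_coaction[OF \<iota>] unfolding P_def kernel_def by (auto simp: cocycle_carrier)
    show "twist_class (X \<otimes>\<^bsub>cocycle_group\<^esub> Y) = twist_class X \<otimes>\<^bsub>P\<^esub> twist_class Y"
      if "X \<in> carrier cocycle_group" "Y \<in> carrier cocycle_group" for X Y
      using that twist_class_mult[OF _ _ \<iota>] by (simp add: P_def cocycle_mult cocycle_carrier)
  qed
  \<comment> \<open>The image of a commutative group under a multiplicative map is a commutative
    group whose unit is the image of 1. Here that is the unit of \<open>P\<close>, so the image with
    this structure is \<open>K\<close> itself.\<close>
  then have "comm_group (P\<lparr>carrier := twist_class ` carrier cocycle_group,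
      one := twist_class \<one>\<^bsub>cocycle_group\<^esub>\<rparr>)" and hom: "twist_class \<in> hom cocycle_group K"
    using C.hom_imp_img_comm_group K by (auto simp: hom_def K_def)
  moreover have "P\<lparr>carrier := twist_class ` carrier cocycle_group,
      one := twist_class \<one>\<^bsub>cocycle_group\<^esub>\<rparr> = K"
    using K by (simp add: K_def flip: one)
  ultimately have comm_K: "comm_group K"
    by simp
  interpret K: comm_group K by (rule comm_K)
  interpret h: group_hom cocycle_group K twist_class
    by (intro group_hom.intro group_hom_axioms.intro hom C.is_group K.is_group)
  have "kernel cocycle_group K twist_class = harrison_coboundaries k H A"
  proof -
    have one_cocycle: "\<one>\<^bsub>AH\<^esub> \<in> harrison_cocycles k H A"
      using C.one_closed by (simp add: cocycle_one cocycle_carrier)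
    have "(X \<in> harrison_cocycles k H A \<and> twist_class X = (twist_class \<one>\<^bsub>AH\<^esub> :: ('a, 'u, 'h) comodule set))
        \<longleftrightarrow> X \<in> harrison_coboundaries k H A" for X
    proof (cases "X \<in> harrison_cocycles k H A")
      case X: True
      note Xc = harrison_cocyclesD(2)[OF X]
      have "(twist_class X :: ('a, 'u, 'h) comodule set) = twist_class \<one>\<^bsub>AH\<^esub> \<longleftrightarrow>
          (\<exists>u\<in>Units A. coact A u = pure_tensor k A H u \<one>\<^bsub>H\<^esub> \<otimes>\<^bsub>AH\<^esub> X)"
        unfolding twist_class_eq_iff[OF X one_cocycle \<iota>]
        by (intro bex_cong refl) (simp add: coaction_closed monoid.Units_closed[OF monoid_A])
      also have "\<dots> \<longleftrightarrow> X \<in> harrison_coboundaries k H A"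
        using coboundary_iff[OF _ Xc] by (auto simp: harrison_coboundaries_eq)
      finally show ?thesis
        using X by simp
    qed (use harrison_coboundaries_subset in blast)
    moreover have "\<one>\<^bsub>K\<^esub> = twist_class \<one>\<^bsub>AH\<^esub>"
      using one by (simp add: K_def cocycle_one)
    ultimately show ?thesis
      by (auto simp: kernel_def cocycle_carrier)
  qed
  then have H1: "harrison_H1 k H A = cocycle_group Mod kernel cocycle_group K twist_class"
    by (simp add: harrison_H1_def cocycle_group_def)
  have comm_H1: "comm_group (harrison_H1 k H A)"
    unfolding H1 by (rule C.abelian_FactGroup[OF h.subgroup_kernel])
  have "harrison_H1 k H A \<cong> K"
    unfolding H1 by (rule h.FactGroup_iso) (simp add: K)
  then have "K \<cong> harrison_H1 k H A"
    by (rule group.iso_sym[OF comm_group.axioms(2)[OF comm_H1]])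
  with comm_K comm_H1 show ?thesis
    by blast
qed

end

theorem corollary2p3:
  fixes k :: "'k ring" and H :: "('k, 'h) bialgebra" and A :: "('k, 'a, 'h) comodule"
    and \<iota> :: "'a \<Rightarrow> 'u"
  assumes "cring k" and "comm_bialgebra k H" and "comm_comodule_algebra k H A"
    and "infinite (UNIV :: 'u set)" and "inj_on \<iota> (carrier A)"
  shows "let PicH = (relative_Pic k H A :: ('a, 'u, 'h) comodule set monoid);
             PicA = (Pic A :: ('a, 'u) module set monoid);
             K = PicH\<lparr>carrier := kernel PicH PicA (forget_coaction A)\<rparr>;
             H1 = harrison_H1 k H A
         in comm_group K \<and> comm_group H1 \<and> K \<cong> H1"
  unfolding Let_def by (rule comm_comodule_algebra.kernel_iso_harrison_H1[OF assms(3,5)])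

end
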